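(* Let $0 < p < 1 < c < \sqrt{3}$. Then for all sufficiently large $N$ there exist $N$-dimensional strictly bi-quadratic cooperative Boolean networks that are both $p$-$c$-chaotic and $p$-unstable.
   Context: Write $[N]=\{1,\dots,N\}$. An $N$-dimensional Boolean network is a pair $(2^{[N]},f)$ with $f:\{0,1\}^{[N]}\to\{0,1\}^{[N]}$; it is updated synchronously in discrete time by $\vec{s}(t+1)=f(\vec{s}(t))$, $t=0,1,2,\dots$. The coordinate function $f_j$ is the regulatory function of variable $j$. An attractor is a periodic orbit of $f$ (including fixed points); its length is the number of states in it. Every trajectory eventually enters exactly one attractor, and the basin of attraction of an attractor is the set of initial states whose trajectories reach it. The network is cooperative if $\vec{s}\le\vec{s}^{\,*}$ coordinatewise implies $f(\vec{s})\le f(\vec{s}^{\,*})$ coordinatewise. The indegree of variable $j$ is the number of variables from which $f_j$ takes input (i.e. on which $f_j$ depends; $j$ itself is allowed); the outdegree of variable $i$ is the number of variables $j$ such that $f_j$ takes input from $i$. The network is strictly bi-quadratic if every variable has indegree exactly $2$ and outdegree exactly $2$ (so in a cooperative strictly bi-quadratic network every regulatory function is a binary AND or a binary OR of two distinct variables). A randomly chosen initial condition is uniformly distributed on $\{0,1\}^{[N]}$; a random single-bit flip changes the value of one coordinate chosen uniformly from $[N]$, independently of the state. The network is $p$-$c$-chaotic if with probability $>p$ the trajectory of a randomly chosen initial condition reaches an attractor of length $>c^N$. It is $p$-unstable if a random single-bit flip in a randomly chosen initial state moves the trajectory into the basin of attraction of a different attractor with probability at least $p$. *)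

theory Defs
  imports "HOL-Probability.Probability"
begin

text \<open>The state space \<open>{0,1} ^ [N]\<close>: extensional functions on \<open>{1..N}\<close> (equal to \<^const>\<open>undefined\<close>
  elsewhere), so that equality of states is equality of functions. The truth values stand for
  1 and 0.\<close>

type_synonym bstate = "nat \<Rightarrow> bool"

definition states :: "nat \<Rightarrow> bstate set" where
  "states N = {1..N} \<rightarrow>\<^sub>E UNIV"

lemma finite_states: "finite (states N)"
  by (simp add: states_def finite_PiE)

lemma states_nonempty: "states N \<noteq> {}"
  by (simp add: states_def PiE_eq_empty_iff)

lemma card_states: "card (states N) = 2 ^ N"
  by (simp add: states_def card_PiE)

definition boolean_network :: "nat \<Rightarrow> (bstate \<Rightarrow> bstate) \<Rightarrow> bool" where
  "boolean_network N f \<longleftrightarrow> f \<in> states N \<rightarrow> states N"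

definition flip :: "nat \<Rightarrow> bstate \<Rightarrow> bstate" where
  "flip i s = s(i := \<not> s i)"

lemma flip_in_states: "s \<in> states N \<Longrightarrow> i \<in> {1..N} \<Longrightarrow> flip i s \<in> states N"
  by (auto simp: states_def flip_def PiE_def extensional_def)

text \<open>On \<^typ>\<open>bool\<close>, \<open>\<le>\<close> is implication, i.e. the order \<open>0 \<le> 1\<close>.\<close>

definition cooperative :: "nat \<Rightarrow> (bstate \<Rightarrow> bstate) \<Rightarrow> bool" where
  "cooperative N f \<longleftrightarrow>
     (\<forall>s\<in>states N. \<forall>s'\<in>states N.
        (\<forall>i\<in>{1..N}. s i \<le> s' i) \<longrightarrow> (\<forall>i\<in>{1..N}. f s i \<le> f s' i))"

definition takes_input :: "nat \<Rightarrow> (bstate \<Rightarrow> bstate) \<Rightarrow> nat \<Rightarrow> nat \<Rightarrow> bool" where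
  "takes_input N f j i \<longleftrightarrow> (\<exists>s\<in>states N. f s j \<noteq> f (flip i s) j)"

definition indegree :: "nat \<Rightarrow> (bstate \<Rightarrow> bstate) \<Rightarrow> nat \<Rightarrow> nat" where
  "indegree N f j = card {i \<in> {1..N}. takes_input N f j i}"

definition outdegree :: "nat \<Rightarrow> (bstate \<Rightarrow> bstate) \<Rightarrow> nat \<Rightarrow> nat" where
  "outdegree N f i = card {j \<in> {1..N}. takes_input N f j i}"

definition strictly_biquadratic :: "nat \<Rightarrow> (bstate \<Rightarrow> bstate) \<Rightarrow> bool" where
  "strictly_biquadratic N f \<longleftrightarrow>
     (\<forall>j\<in>{1..N}. indegree N f j = 2 \<and> outdegree N f j = 2)"

text \<open>Attractors are sets of states, so the length of an attractor is its cardinality.\<close>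

definition attractor :: "nat \<Rightarrow> (bstate \<Rightarrow> bstate) \<Rightarrow> bstate set \<Rightarrow> bool" where
  "attractor N f A \<longleftrightarrow>
     (\<exists>s\<in>states N. (\<exists>k>0. (f ^^ k) s = s) \<and> A = {(f ^^ t) s | t. True})"

definition basin :: "nat \<Rightarrow> (bstate \<Rightarrow> bstate) \<Rightarrow> bstate set \<Rightarrow> bstate set" where
  "basin N f A = {s \<in> states N. \<exists>t. (f ^^ t) s \<in> A}"

definition chaotic :: "real \<Rightarrow> real \<Rightarrow> nat \<Rightarrow> (bstate \<Rightarrow> bstate) \<Rightarrow> bool" where
  "chaotic p c N f \<longleftrightarrow>
     measure_pmf.prob (pmf_of_set (states N))
       {s. \<exists>A. attractor N f A \<and> real (card A) > c ^ N \<and> s \<in> basin N f A} > p"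

text \<open>The product distribution \<^const>\<open>pair_pmf\<close> makes the flipped coordinate independent of the
  initial state.\<close>

definition unstable :: "real \<Rightarrow> nat \<Rightarrow> (bstate \<Rightarrow> bstate) \<Rightarrow> bool" where
  "unstable p N f \<longleftrightarrow>
     measure_pmf.prob (pair_pmf (pmf_of_set (states N)) (pmf_of_set {1..N}))
       {(s, i). \<exists>A B. attractor N f A \<and> attractor N f B \<and> A \<noteq> B \<and>
          s \<in> basin N f A \<and> flip i s \<in> basin N f B} \<ge> p"

end

theory Submission
  imports Defs "HOL-Real_Asymp.Real_Asymp"
begin

text \<open>
  Iterating a monotone map forces strong rigidity: two comparable states of one attractor are equal
  (\<open>attractor_antichain\<close>).  So a flipped bit either heals or ends in another attractor, and an unstable
  network must remember most flips for ever.  On the other hand its attractors must be long.  The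
  network built here keeps the two tasks apart.  One part, the \<^emph>\<open>odometer\<close>, forgets its initial state
  and runs through one very long cycle; another, the \<^emph>\<open>store\<close>, is written once and then kept.

  \<^bold>\<open>Material.\<close>  A pair of variables fed by the conjunction and the disjunction of the preceding pair
  holds one of the three values 00, 01, 11 and passes it on unchanged.  Chains of such pairs are
  strictly bi-quadratic delay lines with three states per two variables; this is where \<open>\<surd>3\<close> comes
  from.  Almost all variables lie in \<open>w + q + 2\<close> delay lines of this kind, of length about \<open>n\<close>, all
  closed through one \<^emph>\<open>gadget\<close> whose size does not depend on \<open>n\<close>.  The values arriving at the gadget
  on the \<open>w\<close> tape lines at one time are a \<^emph>\<open>column\<close>.  Any non-constant monotone function can be
  computed by the gadget with a fixed delay (\<open>monotone_formula\<close>, \<open>loop\<close>).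

  \<^bold>\<open>The long cycle.\<close>  Words of constant weight over \<open>{0, 1, 2}\<close> form an antichain; some weight class
  has at least \<open>3\<^sup>w / (2 w + 1)\<close> elements (\<open>antichain_code\<close>), and every function on an antichain is the restriction
  of a monotone one.  Hence columns can serve as digits to a base \<open>B\<close> of this size, and the gadget as the
  head of a counter with \<open>n - 1\<close> digits.  Its period is at least \<open>B ^ (n - 1)\<close>
  (\<open>odometer_period\<close>), which exceeds \<open>c ^ N\<close> since \<open>N\<close> is about \<open>(2 w + 2 q + 6) n\<close>.

  \<^bold>\<open>The start.\<close>  By rigidity, typical initial states have to be driven to the same point of the cycle at
  the same time, so a start signal is needed whose timing does not depend on the initial state.  It is
  obtained by amplification: a latch fed by another bit is on with probability 1/2 at time 0 and with
  probability at least 3/4 from time 1 on, and a tree of alternating conjunctions and disjunctions turns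
  these probabilities into almost 0 and almost 1 (\<open>amplification\<close>).  A line of conjunctions of
  neighbours delays this step and, after a short while, is off until it arrives, because it takes
  conjunctions over ever longer windows of its random initial content (\<open>control\<close>).  The dual construction provides the complementary
  signal.

  \<^bold>\<open>The store.\<close>  During the start every column passes the gadget, which replaces it by a blank and
  records in the store which of \<open>2 q\<close> thresholds near the mean its weight reaches.  A flip changes this
  weight by one, and the weight is close to the mean for most states (\<open>weight_concentration\<close>), so for
  most flips on the tape the stores differ for ever and the attractors are different
  (\<open>flip_changes_attractor\<close>).  With \<open>w = R\<^sup>3\<close> and \<open>q = R\<^sup>2\<close> the tape makes up nearly all of the network.
\<close>

section \<open>Attractors reached by a trajectory\<close>

lemma funpow_in_states:
  assumes "boolean_network N f" "s \<in> states N"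
  shows "(f ^^ t) s \<in> states N"
  using assms by (induction t) (auto simp: boolean_network_def)

lemma trajectory_recurs:
  assumes "boolean_network N f" "s \<in> states N"
  obtains t k where "T \<le> t" "k > 0" "(f ^^ (t + k)) s = (f ^^ t) s"
proof -
  have "\<not> inj_on (\<lambda>t. (f ^^ t) s) {T..}"
  proof
    assume "inj_on (\<lambda>t. (f ^^ t) s) {T..}"
    moreover have "finite ((\<lambda>t. (f ^^ t) s) ` {T..})"
      by (rule finite_subset[OF _ finite_states[of N]]) (use funpow_in_states[OF assms] in auto)
    ultimately have "finite {T..}"
      by (rule finite_imageD[rotated])
    then show False
      using infinite_Ici by blast
  qed
  then obtain t1 t2 where *: "T \<le> t1" "T \<le> t2" "t1 \<noteq> t2" "(f ^^ t1) s = (f ^^ t2) s"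
    unfolding inj_on_def by auto
  show ?thesis
  proof (cases "t1 < t2")
    case True
    then show ?thesis
      using that[of t1 "t2 - t1"] * by simp
  next
    case False
    then show ?thesis
      using that[of t2 "t1 - t2"] * by simp
  qed
qed

lemma attractor_tail:
  assumes "boolean_network N f" "s \<in> states N" "k > 0" "(f ^^ (t + k)) s = (f ^^ t) s"
  shows "attractor N f {(f ^^ (u + t)) s | u. True}"
proof -
  have "(f ^^ k) ((f ^^ t) s) = (f ^^ t) s"
    using assms(4) by (simp add: add.commute[of t k] funpow_add)
  then show ?thesis
    unfolding attractor_def using assms(3) funpow_in_states[OF assms(1,2), of t]
    by (intro bexI[of _ "(f ^^ t) s"]) (auto simp: funpow_add)
qed

text \<open>The trajectory reaches its attractor eventually, so a lower bound on the return times of its tail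
  bounds the length of the attractor, and the attractor itself need not be described.\<close>

lemma long_attractor:
  assumes net: "boolean_network N f" and s: "s \<in> states N"
    and ret: "\<And>t u. T \<le> t \<Longrightarrow> t < u \<Longrightarrow> (f ^^ t) s = (f ^^ u) s \<Longrightarrow> P \<le> u - t"
  shows "\<exists>A. attractor N f A \<and> P \<le> card A \<and> s \<in> basin N f A"
proof -
  obtain t k where t: "T \<le> t" "k > 0" "(f ^^ (t + k)) s = (f ^^ t) s"
    using trajectory_recurs[OF net s] by blast
  define A where "A = {(f ^^ (u + t)) s | u. True}"
  have att: "attractor N f A"
    unfolding A_def by (rule attractor_tail[OF net s t(2,3)])
  have "inj_on (\<lambda>u. (f ^^ (u + t)) s) {..<P}"
  proof (rule linorder_inj_onI)
    fix u v assume "u < v" "u \<in> {..<P}" "v \<in> {..<P}"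
    then show "(f ^^ (u + t)) s \<noteq> (f ^^ (v + t)) s"
      using ret[of "u + t" "v + t"] t(1) by force
  qed linarith
  then have "P = card ((\<lambda>u. (f ^^ (u + t)) s) ` {..<P})"
    by (simp add: card_image)
  also have "\<dots> \<le> card A"
  proof (rule card_mono)
    show "finite A"
      by (rule finite_subset[OF _ finite_states[of N]])
         (use funpow_in_states[OF net s] in \<open>auto simp: A_def\<close>)
  qed (auto simp: A_def)
  finally have "P \<le> card A" .
  moreover have "(f ^^ t) s \<in> A"
    unfolding A_def by (auto intro!: exI[of _ 0])
  ultimately show ?thesis
    using att s unfolding basin_def by blast
qed

definition below :: "nat \<Rightarrow> bstate \<Rightarrow> bstate \<Rightarrow> bool" where
  "below N s s' \<longleftrightarrow> (\<forall>i\<in>{1..N}. s i \<le> s' i)"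

lemma below_trans: "below N r s \<Longrightarrow> below N s s' \<Longrightarrow> below N r s'"
  unfolding below_def by (meson order_trans)

lemma below_antisym:
  assumes "s \<in> states N" "s' \<in> states N" "below N s s'" "below N s' s"
  shows "s = s'"
proof
  fix i show "s i = s' i"
    using assms by (cases "i \<in> {1..N}") (auto simp: states_def below_def PiE_def extensional_def)
qed

lemma below_funpow:
  assumes "boolean_network N f" "cooperative N f" "s \<in> states N" "s' \<in> states N" "below N s s'"
  shows "below N ((f ^^ t) s) ((f ^^ t) s')"
proof (induction t)
  case (Suc t)
  then show ?case
    using assms(2) funpow_in_states[OF assms(1,3), of t] funpow_in_states[OF assms(1,4), of t]
    unfolding cooperative_def below_def by auto
qed (use assms in simp)

text \<open>Comparable states of one attractor are equal: if \<open>x\<close> lies below a later state \<open>f\<^sup>m x\<close> of its own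
  orbit, monotonicity makes \<open>x, f\<^sup>m x, f\<^sup>2\<^sup>m x, \<dots>\<close> an increasing sequence that returns to \<open>x\<close>.\<close>

lemma attractor_antichain:
  assumes net: "boolean_network N f" and coop: "cooperative N f" and A: "attractor N f A"
    and x: "x \<in> A" and y: "y \<in> A" and le: "below N x y"
  shows "x = y"
proof -
  obtain z k where z: "z \<in> states N" "k > 0" "(f ^^ k) z = z" "A = {(f ^^ t) z | t. True}"
    using A unfolding attractor_def by blast
  obtain i j where ij: "x = (f ^^ i) z" "y = (f ^^ j) z"
    using x y z(4) by blast
  have ret: "(f ^^ (k * l)) z = z" for l
    using funpow_mod_eq[OF z(3), of "k * l"] by simp
  define m where "m = j + (k * i - i)"
  have "m + i = j + k * i"
    using z(2) by (simp add: m_def) (cases k; simp)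
  then have ym: "y = (f ^^ m) x"
    using ret[of i] ij funpow_add[of m i f] funpow_add[of j "k * i" f] by (metis comp_apply)
  have xs: "x \<in> states N" and ys: "y \<in> states N"
    using ij funpow_in_states[OF net z(1)] by auto
  have up: "below N y ((f ^^ (m * Suc l)) x)" for l
  proof (induction l)
    case 0
    then show ?case using ym by (simp add: below_def)
  next
    case (Suc l)
    have "below N ((f ^^ (m * Suc l)) x) ((f ^^ (m * Suc l)) y)"
      by (rule below_funpow[OF net coop xs ys le])
    also have "(f ^^ (m * Suc l)) y = (f ^^ (m * Suc (Suc l))) x"
      unfolding ym using funpow_add[of "m * Suc l" m f] by (simp add: add.commute)
    finally show ?case
      using Suc.IH below_trans by blast
  qed
  have "(f ^^ (m * Suc (k - 1))) x = x"
    using ret[of m] z(2) ij(1) funpow_add[of "k * m" i f] funpow_add[of i "k * m" f]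
    by (simp add: mult.commute add.commute) (metis comp_apply)
  then have "below N y x"
    using up[of "k - 1"] by simp
  then show ?thesis
    using below_antisym[OF xs ys le] by simp
qed

text \<open>Hence in a cooperative network a perturbation that raises (or lowers) bits either heals
  completely or leads to another attractor; a mere phase shift is impossible.\<close>

lemma different_attractors:
  assumes net: "boolean_network N f" and coop: "cooperative N f"
    and s: "s \<in> states N" "s' \<in> states N" and cmp: "below N s s' \<or> below N s' s"
    and ne: "\<And>t. (f ^^ t) s \<noteq> (f ^^ t) s'"
  shows "\<exists>A B. attractor N f A \<and> attractor N f B \<and> A \<noteq> B \<and> s \<in> basin N f A \<and> s' \<in> basin N f B"
proof -
  obtain t k where t: "k > 0" "(f ^^ (t + k)) s = (f ^^ t) s"
    using trajectory_recurs[OF net s(1)] by blast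
  obtain t' k' where t': "k' > 0" "(f ^^ (t' + k')) s' = (f ^^ t') s'"
    using trajectory_recurs[OF net s(2)] by blast
  define A where "A = {(f ^^ (u + t)) s | u. True}"
  define B where "B = {(f ^^ (u + t')) s' | u. True}"
  have A: "attractor N f A" and B: "attractor N f B"
    unfolding A_def B_def using attractor_tail[OF net s(1) t] attractor_tail[OF net s(2) t'] by auto
  have inA: "(f ^^ (t' + t)) s \<in> A" and inB: "(f ^^ (t + t')) s' \<in> B"
    unfolding A_def B_def by blast+
  have "A \<noteq> B"
  proof
    assume "A = B"
    then have inA': "(f ^^ (t' + t)) s' \<in> A"
      using inB by (simp add: add.commute)
    from cmp show False
    proof
      assume "below N s s'"
      then show False
        using attractor_antichain[OF net coop A inA inA' below_funpow[OF net coop s]] ne by blast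
    next
      assume "below N s' s"
      then show False
        using attractor_antichain[OF net coop A inA' inA below_funpow[OF net coop s(2,1)]] ne
        by metis
    qed
  qed
  then show ?thesis
    using A B inA inB s unfolding basin_def by blast
qed

lemma flip_comparable: "below N s (flip i s) \<or> below N (flip i s) s"
  by (cases "s i") (auto simp: below_def flip_def)

section \<open>Two-regular wirings\<close>

definition gate :: "bool \<Rightarrow> bool \<Rightarrow> bool \<Rightarrow> bool" where
  "gate c x y = (if c then x \<and> y else x \<or> y)"

text \<open>A strictly bi-quadratic cooperative network is an assignment of a gate type and of two source
  vertices to every vertex of a finite set, such that every vertex is a source exactly twice.  The
  vertices are numbered by a bijection \<open>\<gamma>\<close> onto \<open>{1..N}\<close>.\<close>

definition wired_net ::
    "nat \<Rightarrow> 'v set \<Rightarrow> ('v \<Rightarrow> nat) \<Rightarrow> ('v \<Rightarrow> bool) \<Rightarrow> ('v \<Rightarrow> bool \<Rightarrow> 'v) \<Rightarrow> bstate \<Rightarrow> bstate" where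
  "wired_net N V \<gamma> op inp s = (\<lambda>i. if i \<in> {1..N} then
      (let v = inv_into V \<gamma> i in gate (op v) (s (\<gamma> (inp v False))) (s (\<gamma> (inp v True))))
    else undefined)"

locale wiring =
  fixes N :: nat and V :: "'v set" and \<gamma> :: "'v \<Rightarrow> nat" and op :: "'v \<Rightarrow> bool"
    and inp :: "'v \<Rightarrow> bool \<Rightarrow> 'v"
  assumes bij: "bij_betw \<gamma> V {1..N}"
    and closed: "v \<in> V \<Longrightarrow> inp v c \<in> V"
    and distinct: "v \<in> V \<Longrightarrow> inp v False \<noteq> inp v True"
    and two_out: "u \<in> V \<Longrightarrow> card {v \<in> V. u = inp v False \<or> u = inp v True} = 2"
begin

abbreviation net :: "bstate \<Rightarrow> bstate" where
  "net \<equiv> wired_net N V \<gamma> op inp"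

lemma numbering: "v \<in> V \<Longrightarrow> \<gamma> v \<in> {1..N}"
  using bij unfolding bij_betw_def by blast

lemma net_vertex: "v \<in> V \<Longrightarrow> net (s :: bstate) (\<gamma> v) = gate (op v) (s (\<gamma> (inp v False))) (s (\<gamma> (inp v True)))"
proof -
  assume v: "v \<in> V"
  then have "inv_into V \<gamma> (\<gamma> v) = v"
    using bij by (simp add: bij_betw_def)
  then show ?thesis
    unfolding wired_net_def Let_def using numbering[OF v] by (simp only: if_True)
qed

lemma numbering_eq: "u \<in> V \<Longrightarrow> v \<in> V \<Longrightarrow> \<gamma> u = \<gamma> v \<longleftrightarrow> u = v"
  using bij unfolding bij_betw_def inj_on_def by blast

lemma numbered: "i \<in> {1..N} \<Longrightarrow> \<exists>v\<in>V. i = \<gamma> v"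
  using bij unfolding bij_betw_def by blast

lemma numbered_Collect: "{i \<in> {1..N}. P i} = \<gamma> ` {v \<in> V. P (\<gamma> v)}"
proof -
  have "{1..N} = \<gamma> ` V"
    using bij by (simp add: bij_betw_def)
  then show ?thesis
    by (simp only:) blast
qed

lemma boolean_network: "boolean_network N net"
  by (auto simp: boolean_network_def states_def wired_net_def)

lemma cooperative: "cooperative N net"
  unfolding cooperative_def
proof (intro ballI impI)
  fix s s' :: bstate and i
  assume le: "\<forall>i\<in>{1..N}. s i \<le> s' i" and i: "i \<in> {1..N}"
  obtain v where v: "v \<in> V" "i = \<gamma> v"
    using numbered[OF i] by blast
  have "s (\<gamma> (inp v c)) \<le> s' (\<gamma> (inp v c))" for c
    using le numbering[OF closed[OF v(1)]] by blast
  from this[of True] this[of False] show "net s i \<le> net s' i"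
    unfolding v(2) net_vertex[OF v(1)] gate_def by (cases "op v") (simp_all add: le_bool_def)
qed

lemma takes_input_iff:
  assumes u: "u \<in> V" and v: "v \<in> V"
  shows "takes_input N net (\<gamma> v) (\<gamma> u) \<longleftrightarrow> u = inp v False \<or> u = inp v True"
proof
  assume "takes_input N net (\<gamma> v) (\<gamma> u)"
  then obtain s where "s \<in> states N" and s: "net s (\<gamma> v) \<noteq> net (flip (\<gamma> u) s) (\<gamma> v)"
    unfolding takes_input_def by (rule bexE)
  show "u = inp v False \<or> u = inp v True"
  proof (rule ccontr)
    assume "\<not> (u = inp v False \<or> u = inp v True)"
    then have "u \<noteq> inp v c" for c
      by (cases c) simp_all
    then have "\<gamma> (inp v c) \<noteq> \<gamma> u" for c
      using numbering_eq[OF u closed[OF v, of c]] by metis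
    then have "flip (\<gamma> u) s (\<gamma> (inp v c)) = s (\<gamma> (inp v c))" for c
      unfolding flip_def by (rule fun_upd_other)
    with s show False
      by (simp add: net_vertex[OF v])
  qed
next
  assume src: "u = inp v False \<or> u = inp v True"
  define s where "s = (\<lambda>i. if i \<in> {1..N} then op v else undefined)"
  have "s \<in> states N"
    by (auto simp: s_def states_def)
  have val: "s (\<gamma> w) = op v" if "w \<in> V" for w
    using numbering[OF that] by (simp add: s_def)
  have "flip (\<gamma> u) s (\<gamma> (inp v c)) = (op v \<longleftrightarrow> u \<noteq> inp v c)" for c
    using val[OF u] val[OF closed[OF v, of c]] numbering_eq[OF u closed[OF v, of c]]
    by (cases "u = inp v c") (simp_all add: flip_def eq_commute[of "\<gamma> u"])
  moreover have "s (\<gamma> (inp v c)) = op v" for c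
    using val closed[OF v] by blast
  ultimately have "net s (\<gamma> v) \<noteq> net (flip (\<gamma> u) s) (\<gamma> v)"
    unfolding net_vertex[OF v] gate_def using src distinct[OF v] by (cases "op v") simp_all
  then show "takes_input N net (\<gamma> v) (\<gamma> u)"
    unfolding takes_input_def using \<open>s \<in> states N\<close> by (rule bexI)
qed

lemma strictly_biquadratic: "strictly_biquadratic N net"
  unfolding strictly_biquadratic_def
proof
  fix i assume "i \<in> {1..N}"
  then obtain w where w: "w \<in> V" "i = \<gamma> w"
    using numbered by blast
  have crd: "card (\<gamma> ` A) = card A" if "A \<subseteq> V" for A
    by (rule card_image, rule inj_on_subset[OF _ that]) (use bij in \<open>simp add: bij_betw_def\<close>)
  have "{v \<in> V. takes_input N net i (\<gamma> v)} = {v \<in> V. v = inp w False \<or> v = inp w True}"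
    unfolding w(2) using takes_input_iff[OF _ w(1)] by (intro Collect_cong conj_cong refl)
  also have "\<dots> = {inp w False, inp w True}"
    using closed[OF w(1), of False] closed[OF w(1), of True] by blast
  finally have "{v \<in> V. takes_input N net i (\<gamma> v)} = {inp w False, inp w True}" .
  then have "indegree N net i = card {inp w False, inp w True}"
    unfolding indegree_def numbered_Collect
    using crd[of "{inp w False, inp w True}"] closed[OF w(1), of False] closed[OF w(1), of True]
    by simp
  then have ind: "indegree N net i = 2"
    using distinct[OF w(1)] by simp
  have "{v \<in> V. takes_input N net (\<gamma> v) i} = {v \<in> V. w = inp v False \<or> w = inp v True}"
    unfolding w(2) using takes_input_iff[OF w(1)] by (intro Collect_cong conj_cong refl)
  then have "outdegree N net i = card {v \<in> V. w = inp v False \<or> w = inp v True}"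
    unfolding outdegree_def numbered_Collect
    using crd[of "{v \<in> V. w = inp v False \<or> w = inp v True}"] by simp
  then have "outdegree N net i = 2"
    using two_out[OF w(1)] by simp
  with ind show "indegree N net i = 2 \<and> outdegree N net i = 2"
    by blast
qed

lemma trajectory_step:
  "v \<in> V \<Longrightarrow> (net ^^ Suc t) s (\<gamma> v) =
     gate (op v) ((net ^^ t) s (\<gamma> (inp v False))) ((net ^^ t) s (\<gamma> (inp v True)))"
  by (simp add: net_vertex)

end

text \<open>Every vertex has two in-slots and two out-slots, labelled by truth values.  A partial wiring
  prescribes the out-slot feeding some of the in-slots; since there are equally many in-slots and
  out-slots, the rest can be matched arbitrarily.  The last hypothesis guarantees that an arbitrary
  match cannot make the two sources of a vertex coincide: both out-slots of the prescribed source are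
  already taken, by whatever vertices.\<close>

lemma complete_wiring:
  fixes src :: "'v \<Rightarrow> bool \<Rightarrow> ('v \<times> bool) option"
  assumes fin: "finite V"
    and src_in: "\<And>v c u d. v \<in> V \<Longrightarrow> src v c = Some (u, d) \<Longrightarrow> u \<in> V"
    and inj: "\<And>v c v' c' y. v \<in> V \<Longrightarrow> v' \<in> V \<Longrightarrow> src v c = Some y \<Longrightarrow> src v' c' = Some y \<Longrightarrow>
                v = v' \<and> c = c'"
    and diff: "\<And>v u d u' d'. v \<in> V \<Longrightarrow> src v False = Some (u, d) \<Longrightarrow> src v True = Some (u', d') \<Longrightarrow>
                u \<noteq> u'"
    and left: "\<And>v. v \<in> V \<Longrightarrow> src v False \<noteq> None"
    and full: "\<And>v u d e. v \<in> V \<Longrightarrow> src v False = Some (u, d) \<Longrightarrow> src v True = None \<Longrightarrow>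
                \<exists>w\<in>V. \<exists>c. src w c = Some (u, e)"
  shows "\<exists>inp. (\<forall>v\<in>V. \<forall>c. inp v c \<in> V) \<and> (\<forall>v\<in>V. inp v False \<noteq> inp v True) \<and>
           (\<forall>u\<in>V. card {v \<in> V. u = inp v False \<or> u = inp v True} = 2) \<and>
           (\<forall>v\<in>V. \<forall>c u d. src v c = Some (u, d) \<longrightarrow> inp v c = u)"
proof -
  define S where "S = V \<times> (UNIV :: bool set)"
  define K where "K = {(v, c) \<in> S. src v c \<noteq> None}"
  define k where "k = (\<lambda>(v, c). the (src v c))"
  have finS: "finite S"
    using fin by (simp add: S_def)
  have KS: "K \<subseteq> S"
    by (auto simp: K_def)
  have kS: "k ` K \<subseteq> S"
  proof
    fix y assume "y \<in> k ` K"
    then obtain v c where "v \<in> V" "src v c = Some y"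
      by (auto simp: K_def k_def S_def)
    then show "y \<in> S"
      using src_in[of v c "fst y" "snd y"] by (simp add: S_def mem_Times_iff)
  qed
  have injk: "inj_on k K"
  proof (rule inj_onI)
    fix e e' assume e: "e \<in> K" "e' \<in> K" "k e = k e'"
    obtain v c v' c' where vc: "e = (v, c)" "e' = (v', c')"
      by (cases e, cases e') blast
    then have "v \<in> V" "v' \<in> V" "src v c = Some (k e)" "src v' c' = Some (k e)"
      using e by (auto simp: K_def S_def k_def)
    then show "e = e'"
      using inj[of v v' c "k e" c'] vc by blast
  qed
  have "card (S - K) = card (S - k ` K)"
    using card_image[OF injk] KS kS finS by (simp add: card_Diff_subset finite_subset)
  then obtain h where h: "bij_betw h (S - K) (S - k ` K)"
    using finite_same_card_bij[of "S - K" "S - k ` K"] finS by auto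
  define g where "g = (\<lambda>e. if e \<in> K then k e else h e)"
  have "bij_betw g (K \<union> (S - K)) (k ` K \<union> (S - k ` K))"
  proof (rule bij_betw_combine)
    show "bij_betw g K (k ` K)"
      using injk by (auto simp: bij_betw_def g_def inj_on_def)
    show "bij_betw g (S - K) (S - k ` K)"
      using h by (rule bij_betw_cong[THEN iffD1, rotated]) (simp add: g_def)
  qed auto
  then have g: "bij_betw g S S"
    using KS kS by (simp add: Un_absorb1)
  define inp where "inp = (\<lambda>v c. fst (g (v, c)))"
  have gS: "g (v, c) \<in> S" if "v \<in> V" for v c
    using g that by (auto simp: bij_betw_def S_def)
  have cl: "inp v c \<in> V" if "v \<in> V" for v c
    using gS[OF that, of c] by (auto simp: inp_def S_def)
  have known: "g (v, c) = y" if "v \<in> V" "src v c = Some y" for v c y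
    using that by (auto simp: g_def K_def k_def S_def)
  have ne: "inp v False \<noteq> inp v True" if v: "v \<in> V" for v
  proof
    assume eq: "inp v False = inp v True"
    obtain u d where ud: "src v False = Some (u, d)"
      using left[OF v] by auto
    have u: "inp v True = u"
      using eq known[OF v ud] by (simp add: inp_def)
    show False
    proof (cases "src v True")
      case None
      obtain e where e: "g (v, True) = (u, e)"
        using u by (cases "g (v, True)") (auto simp: inp_def)
      obtain w c where w: "w \<in> V" "src w c = Some (u, e)"
        using full[OF v ud None] by blast
      have "(w, c) \<in> S" "(v, True) \<in> S"
        using w v by (auto simp: S_def)
      moreover have "g (w, c) = g (v, True)"
        using known[OF w] e by simp
      ultimately have "(w, c) = (v, True)"
        using g unfolding bij_betw_def inj_on_def by blast
      then show False
        using w None by simp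
    next
      case (Some y)
      then show False
        using diff[OF v ud, of "fst y" "snd y"] known[OF v Some] u by (simp add: inp_def)
    qed
  qed
  have two: "card {v \<in> V. u = inp v False \<or> u = inp v True} = 2" if u: "u \<in> V" for u
  proof -
    have "\<exists>e\<in>S. g e = (u, d)" for d
    proof -
      have "(u, d) \<in> g ` S"
        using g u by (simp add: bij_betw_def S_def)
      then show ?thesis
        by (metis imageE)
    qed
    then obtain e where e: "\<And>d. e d \<in> S" "\<And>d. g (e d) = (u, d)"
      by metis
    have "fst (e False) \<noteq> fst (e True)"
    proof
      assume eq: "fst (e False) = fst (e True)"
      have "e False \<noteq> e True"
        using e(2)[of False] e(2)[of True] by auto
      with eq have "snd (e False) \<noteq> snd (e True)"
        by (simp add: prod_eq_iff)
      moreover have "inp (fst (e d)) (snd (e d)) = u" for d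
        using e(2)[of d] by (simp add: inp_def)
      moreover have "fst (e True) \<in> V"
        using e(1)[of True] by (auto simp: S_def)
      ultimately show False
        using ne[of "fst (e True)"] eq by (metis (full_types))
    qed
    moreover have "{v \<in> V. u = inp v False \<or> u = inp v True} = {fst (e False), fst (e True)}"
    proof (intro equalityI subsetI)
      fix v assume "v \<in> {v \<in> V. u = inp v False \<or> u = inp v True}"
      then obtain c where v: "v \<in> V" "u = inp v c"
        by auto
      then have "g (v, c) = g (e (snd (g (v, c))))"
        using e(2) by (simp add: inp_def)
      moreover have "(v, c) \<in> S"
        using v by (simp add: S_def)
      ultimately have "(v, c) = e (snd (g (v, c)))"
        using g e(1) unfolding bij_betw_def inj_on_def by blast
      then have "v = fst (e (snd (g (v, c))))"
        by (metis fst_conv)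
      then show "v \<in> {fst (e False), fst (e True)}"
        by (cases "snd (g (v, c))") auto
    next
      fix v assume "v \<in> {fst (e False), fst (e True)}"
      then obtain d where d: "v = fst (e d)"
        by auto
      then have "inp v (snd (e d)) = u"
        using e(2)[of d] by (simp add: inp_def)
      moreover have "v \<in> V"
        using d e(1)[of d] by (auto simp: S_def)
      ultimately show "v \<in> {v \<in> V. u = inp v False \<or> u = inp v True}"
        by (cases "snd (e d)") auto
    qed
    ultimately show ?thesis
      by simp
  qed
  have "\<forall>v\<in>V. \<forall>c u d. src v c = Some (u, d) \<longrightarrow> inp v c = u"
    using known by (simp add: inp_def)
  moreover have "\<forall>v\<in>V. \<forall>c. inp v c \<in> V" "\<forall>v\<in>V. inp v False \<noteq> inp v True"
    using cl ne by blast+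
  moreover have "\<forall>u\<in>V. card {v \<in> V. u = inp v False \<or> u = inp v True} = 2"
    using two by blast
  ultimately show ?thesis
    by blast
qed

section \<open>Monotone functions as balanced formulas\<close>

text \<open>A formula is a full binary tree; a node is addressed by the list of the turns leading to it
  from the root, the last turn first.  All leaves have the same depth because a network that evaluates
  the formula spends one time step per level, and the inputs have to arrive simultaneously.\<close>

fun formula_value :: "(bool list \<Rightarrow> bool) \<Rightarrow> (bool list \<Rightarrow> 'i) \<Rightarrow> nat \<Rightarrow> bool list \<Rightarrow> ('i \<Rightarrow> bool) \<Rightarrow> bool"
where
  "formula_value op lab 0 p x = x (lab p)"
| "formula_value op lab (Suc k) p x =
     gate (op p) (formula_value op lab k (False # p) x) (formula_value op lab k (True # p) x)"

definition formula_of :: "'i set \<Rightarrow> nat \<Rightarrow> (('i \<Rightarrow> bool) \<Rightarrow> bool) \<Rightarrow> bool" where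
  "formula_of I k g \<longleftrightarrow>
     (\<exists>op lab. (\<forall>p. lab p \<in> I) \<and> (\<forall>x. formula_value op lab k [] x = g x))"

lemma formula_of_var: "i \<in> I \<Longrightarrow> formula_of I 0 (\<lambda>x. x i)"
  unfolding formula_of_def by (intro exI[of _ "\<lambda>_. i"] exI[of _ "\<lambda>_. True"]) auto

lemma formula_of_gate:
  assumes "formula_of I k g" "formula_of I k h"
  shows "formula_of I (Suc k) (\<lambda>x. gate c (g x) (h x))"
proof -
  obtain op1 lab1 where 1: "\<And>p. lab1 p \<in> I" "\<And>x. formula_value op1 lab1 k [] x = g x"
    using assms(1) unfolding formula_of_def by blast
  obtain op2 lab2 where 2: "\<And>p. lab2 p \<in> I" "\<And>x. formula_value op2 lab2 k [] x = h x"
    using assms(2) unfolding formula_of_def by blast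
  define op where "op = (\<lambda>p. if p = [] then c else
    if last p then op2 (butlast p) else op1 (butlast p))"
  define lab where "lab = (\<lambda>p. if p = [] then lab1 [] else
    if last p then lab2 (butlast p) else lab1 (butlast p))"
  have "formula_value op lab j (p @ [False]) x = formula_value op1 lab1 j p x" for j p x
    by (induction j arbitrary: p)
       (simp_all add: op_def lab_def append_Cons[symmetric] del: append_Cons)
  moreover have "formula_value op lab j (p @ [True]) x = formula_value op2 lab2 j p x" for j p x
    by (induction j arbitrary: p)
       (simp_all add: op_def lab_def append_Cons[symmetric] del: append_Cons)
  ultimately have "formula_value op lab (Suc k) [] x = gate c (g x) (h x)" for x
    using 1(2) 2(2) by (metis append_Nil formula_value.simps(2) op_def)
  moreover have "lab p \<in> I" for p
    using 1(1) 2(1) by (simp add: lab_def)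
  ultimately show ?thesis
    unfolding formula_of_def by blast
qed

lemma formula_of_pad:
  assumes "formula_of I k g" "k \<le> l"
  shows "formula_of I l g"
  using assms(2)
proof (induction l rule: dec_induct)
  case (step l)
  then show ?case
    using formula_of_gate[of I l g g True] by (simp add: gate_def)
qed (rule assms(1))

lemma formula_of_Ball:
  assumes "finite S" "S \<noteq> {}" "\<And>i. i \<in> S \<Longrightarrow> \<exists>k. formula_of I k (g i)"
  shows "\<exists>k. formula_of I k (\<lambda>x. \<forall>i\<in>S. g i x)"
  using assms
proof (induction S rule: finite_ne_induct)
  case (insert i S)
  obtain k1 k2 where "formula_of I k1 (g i)" "formula_of I k2 (\<lambda>x. \<forall>i\<in>S. g i x)"
    using insert by blast
  then have "formula_of I (max k1 k2) (g i)" "formula_of I (max k1 k2) (\<lambda>x. \<forall>i\<in>S. g i x)"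
    using formula_of_pad by fastforce+
  from formula_of_gate[OF this, of True] show ?case
    by (auto simp: gate_def)
qed simp

lemma formula_of_Bex:
  assumes "finite S" "S \<noteq> {}" "\<And>i. i \<in> S \<Longrightarrow> \<exists>k. formula_of I k (g i)"
  shows "\<exists>k. formula_of I k (\<lambda>x. \<exists>i\<in>S. g i x)"
  using assms
proof (induction S rule: finite_ne_induct)
  case (insert i S)
  obtain k1 k2 where "formula_of I k1 (g i)" "formula_of I k2 (\<lambda>x. \<exists>i\<in>S. g i x)"
    using insert by blast
  then have "formula_of I (max k1 k2) (g i)" "formula_of I (max k1 k2) (\<lambda>x. \<exists>i\<in>S. g i x)"
    using formula_of_pad by fastforce+
  from formula_of_gate[OF this, of False] show ?case
    by (auto simp: gate_def)
qed simp

text \<open>This is disjunctive normal form without constants: the term of an assignment asks for all its true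
  variables.  A formula cannot express the constants, which is why \<open>g\<close> must be false and true at the
  two extreme assignments.\<close>

lemma monotone_formula:
  fixes g :: "('i \<Rightarrow> bool) \<Rightarrow> bool"
  assumes fin: "finite I"
    and mono: "\<And>x y. (\<And>i. i \<in> I \<Longrightarrow> x i \<Longrightarrow> y i) \<Longrightarrow> g x \<Longrightarrow> g y"
    and bot: "\<not> g (\<lambda>_. False)" and top: "g (\<lambda>_. True)"
  shows "\<exists>k. formula_of I k g"
proof -
  define T where "T = {S. S \<subseteq> I \<and> g (\<lambda>i. i \<in> S)}"
  have "finite T"
    using fin by (simp add: T_def)
  moreover have "I \<in> T"
    unfolding T_def using mono[OF _ top, of "\<lambda>i. i \<in> I"] by simp
  moreover have "\<exists>k. formula_of I k (\<lambda>x. \<forall>i\<in>S. x i)" if "S \<in> T" for S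
  proof (rule formula_of_Ball)
    show "finite S"
      using that fin finite_subset unfolding T_def by blast
    show "S \<noteq> {}"
    proof
      assume "S = {}"
      with that have "g (\<lambda>_. False)"
        unfolding T_def by simp
      with bot show False
        by (rule notE)
    qed
    show "\<exists>k. formula_of I k (\<lambda>x. x i)" if "i \<in> S" for i
    proof -
      have "i \<in> I"
        using \<open>S \<in> T\<close> that by (auto simp: T_def)
      then show ?thesis
        using formula_of_var by (intro exI[of _ 0])
    qed
  qed
  ultimately obtain k where k: "formula_of I k (\<lambda>x. \<exists>S\<in>T. \<forall>i\<in>S. x i)"
    using formula_of_Bex[of T I "\<lambda>S x. \<forall>i\<in>S. x i"] by (metis (no_types) empty_iff)
  have "(\<exists>S\<in>T. \<forall>i\<in>S. x i) = g x" for x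
  proof
    assume "\<exists>S\<in>T. \<forall>i\<in>S. x i"
    then obtain S where S: "g (\<lambda>i. i \<in> S)" "\<forall>i\<in>S. x i"
      unfolding T_def by auto
    show "g x"
      by (rule mono[OF _ S(1)]) (use S(2) in auto)
  next
    assume "g x"
    then have "g (\<lambda>i. i \<in> {i \<in> I. x i})"
      by (rule mono[rotated]) simp
    then have "{i \<in> I. x i} \<in> T"
      unfolding T_def by simp
    then show "\<exists>S\<in>T. \<forall>i\<in>S. x i"
      by (rule bexI[rotated]) simp
  qed
  with k show ?thesis
    by (intro exI[of _ k]) simp
qed

lemma monotone_formulas:
  fixes g :: "'j \<Rightarrow> ('i \<Rightarrow> bool) \<Rightarrow> bool"
  assumes "finite I" "finite J"
    and "\<And>j x y. j \<in> J \<Longrightarrow> (\<And>i. i \<in> I \<Longrightarrow> x i \<Longrightarrow> y i) \<Longrightarrow> g j x \<Longrightarrow> g j y"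
    and "\<And>j. j \<in> J \<Longrightarrow> \<not> g j (\<lambda>_. False)" "\<And>j. j \<in> J \<Longrightarrow> g j (\<lambda>_. True)"
  shows "\<exists>k op lab. 0 < k \<and> (\<forall>j\<in>J. \<forall>p. lab j p \<in> I) \<and>
           (\<forall>j\<in>J. \<forall>x. formula_value (op j) (lab j) k [] x = g j x)"
proof -
  have "\<forall>j. \<exists>k. j \<in> J \<longrightarrow> formula_of I k (g j)"
  proof
    fix j
    show "\<exists>k. j \<in> J \<longrightarrow> formula_of I k (g j)"
    proof (cases "j \<in> J")
      case True
      have "\<exists>k. formula_of I k (g j)"
      proof (rule monotone_formula[OF assms(1)])
        fix x y :: "'i \<Rightarrow> bool" assume "\<And>i. i \<in> I \<Longrightarrow> x i \<Longrightarrow> y i" "g j x"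
        with assms(3)[OF True, of x y] show "g j y"
          by blast
      qed (rule assms(4)[OF True] assms(5)[OF True])+
      then show ?thesis
        by simp
    qed simp
  qed
  from choice[OF this] obtain k where k: "\<And>j. j \<in> J \<Longrightarrow> formula_of I (k j) (g j)"
    by blast
  define m where "m = Suc (\<Sum>j\<in>J. k j)"
  have "\<exists>op lab. (\<forall>p. lab p \<in> I) \<and> (\<forall>x. formula_value op lab m [] x = g j x)" if "j \<in> J" for j
    using formula_of_pad[OF k[OF that], of m] member_le_sum[OF that, of k] assms(2)
    by (simp add: m_def formula_of_def)
  then have "\<forall>j\<in>J. \<exists>ol. (\<forall>p. snd ol p \<in> I) \<and> (\<forall>x. formula_value (fst ol) (snd ol) m [] x = g j x)"
    by simp
  from bchoice[OF this] obtain ol where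
    "\<And>j. j \<in> J \<Longrightarrow> (\<forall>p. snd (ol j) p \<in> I) \<and>
       (\<forall>x. formula_value (fst (ol j)) (snd (ol j)) m [] x = g j x)"
    by blast
  then show ?thesis
    by (intro exI[of _ m] exI[of _ "\<lambda>j. fst (ol j)"] exI[of _ "\<lambda>j. snd (ol j)"])
       (simp add: m_def)
qed

section \<open>Fractions of the state space\<close>

definition fraction :: "nat \<Rightarrow> (bstate \<Rightarrow> bool) \<Rightarrow> real" where
  "fraction N E = card {s \<in> states N. E s} / 2 ^ N"

definition depends :: "(bstate \<Rightarrow> bool) \<Rightarrow> nat set \<Rightarrow> bool" where
  "depends E S \<longleftrightarrow> (\<forall>s s'. (\<forall>i\<in>S. s i = s' i) \<longrightarrow> E s = E s')"

lemma finite_event: "finite {s \<in> states N. E s}"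
  using finite_states by simp

lemma fraction_mono:
  assumes "\<And>s. s \<in> states N \<Longrightarrow> E s \<Longrightarrow> E' s"
  shows "fraction N E \<le> fraction N E'"
  unfolding fraction_def
  by (intro divide_right_mono of_nat_mono card_mono finite_event) (use assms in auto)

lemma fraction_compl: "fraction N (\<lambda>s. \<not> E s) = 1 - fraction N E"
proof -
  have "card (states N) = card {s \<in> states N. E s} + card {s \<in> states N. \<not> E s}"
  proof -
    have "states N = {s \<in> states N. E s} \<union> {s \<in> states N. \<not> E s}"
      by blast
    also have "card \<dots> = card {s \<in> states N. E s} + card {s \<in> states N. \<not> E s}"
      by (rule card_Un_disjoint[OF finite_event finite_event]) blast
    finally show ?thesis .
  qed
  then have "real (card (states N)) = real (card {s \<in> states N. E s}) + real (card {s \<in> states N. \<not> E s})"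
    by (simp only: of_nat_add)
  then have "real (card {s \<in> states N. \<not> E s}) = 2 ^ N - real (card {s \<in> states N. E s})"
    unfolding card_states of_nat_power of_nat_numeral by linarith
  then show ?thesis
    unfolding fraction_def by (simp add: diff_divide_distrib)
qed

lemma fraction_disj: "fraction N (\<lambda>s. E s \<or> E' s) \<le> fraction N E + fraction N E'"
proof -
  have "{s \<in> states N. E s \<or> E' s} = {s \<in> states N. E s} \<union> {s \<in> states N. E' s}"
    by blast
  then show ?thesis
    unfolding fraction_def add_divide_distrib[symmetric]
    by (intro divide_right_mono) (use card_Un_le[of "{s \<in> states N. E s}"] in \<open>simp_all flip: of_nat_add\<close>)
qed

lemma fraction_Bex: "finite A \<Longrightarrow> fraction N (\<lambda>s. \<exists>a\<in>A. E a s) \<le> (\<Sum>a\<in>A. fraction N (E a))"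
proof (induction A rule: finite_induct)
  case (insert a A)
  have "fraction N (\<lambda>s. \<exists>x\<in>insert a A. E x s) = fraction N (\<lambda>s. E a s \<or> (\<exists>x\<in>A. E x s))"
    by simp
  with insert show ?case
    using fraction_disj[of N "E a" "\<lambda>s. \<exists>x\<in>A. E x s"] by simp
qed (simp add: fraction_def)

text \<open>Events about disjoint sets of coordinates are independent.  Exchanging the coordinates in \<open>S\<close>
  between two states is an involution on pairs of states, and it turns the pairs with \<open>E s\<close> and
  \<open>E' s'\<close> into the pairs whose first component satisfies both.\<close>

lemma fraction_indep:
  assumes E: "depends E S" and E': "depends E' S'" and disj: "S \<inter> S' = {}"
  shows "fraction N (\<lambda>s. E s \<and> E' s) = fraction N E * fraction N E'"
proof -
  define mix where "mix = (\<lambda>s s' i. if i \<in> S then s i else s' i :: bool)"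
  define \<Phi> where "\<Phi> = (\<lambda>(s, s'). (mix s s', mix s' s))"
  have inv: "\<Phi> (\<Phi> x) = x" for x
    by (cases x) (auto simp: \<Phi>_def mix_def)
  have mix_in: "mix s s' \<in> states N" if "s \<in> states N" "s' \<in> states N" for s s'
    using that by (simp add: mix_def states_def PiE_def extensional_def)
  have Em: "E (mix s s') = E s" for s s'
  proof -
    have "\<forall>i\<in>S. mix s s' i = s i"
      by (simp add: mix_def)
    then show ?thesis
      using E unfolding depends_def by blast
  qed
  have Em': "E' (mix s s') = E' s'" for s s'
  proof -
    have "\<forall>i\<in>S'. mix s s' i = s' i"
      using disj by (auto simp: mix_def)
    then show ?thesis
      using E' unfolding depends_def by blast
  qed
  have "bij_betw \<Phi> ({s \<in> states N. E s} \<times> {s \<in> states N. E' s})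
          ({s \<in> states N. E s \<and> E' s} \<times> states N)"
  proof (rule bij_betw_byWitness[where f' = \<Phi>])
    show "\<Phi> ` ({s \<in> states N. E s} \<times> {s \<in> states N. E' s})
        \<subseteq> {s \<in> states N. E s \<and> E' s} \<times> states N"
      by (auto simp only: \<Phi>_def Em Em' mix_in image_subset_iff mem_Sigma_iff mem_Collect_eq split: prod.split)
    show "\<Phi> ` ({s \<in> states N. E s \<and> E' s} \<times> states N)
        \<subseteq> {s \<in> states N. E s} \<times> {s \<in> states N. E' s}"
      by (auto simp only: \<Phi>_def Em Em' mix_in image_subset_iff mem_Sigma_iff mem_Collect_eq split: prod.split)
  qed (simp_all only: inv ball_triv simp_thms)
  from bij_betw_same_card[OF this]
  have "card {s \<in> states N. E s} * card {s \<in> states N. E' s} =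
      card {s \<in> states N. E s \<and> E' s} * 2 ^ N"
    by (simp add: card_cartesian_product card_states)
  from arg_cong[OF this, of real]
  show ?thesis
    by (simp add: fraction_def field_simps)
qed

lemma depends_mono: "depends E S \<Longrightarrow> S \<subseteq> S' \<Longrightarrow> depends E S'"
  unfolding depends_def by blast

lemma depends_bit: "depends (\<lambda>s. s i = b) {i}"
  by (simp add: depends_def)

lemma fraction_bit:
  assumes i: "i \<in> {1..N}"
  shows "fraction N (\<lambda>s. s i = b) = 1 / 2"
proof -
  have "bij_betw (flip i) {s \<in> states N. s i} {s \<in> states N. \<not> s i}"
    by (rule bij_betw_byWitness[where f' = "flip i"])
       (simp_all add: image_subset_iff flip_in_states[OF _ i], simp_all add: flip_def fun_upd_idem)
  from bij_betw_same_card[OF this] have "fraction N (\<lambda>s. s i) = fraction N (\<lambda>s. \<not> s i)"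
    by (simp add: fraction_def)
  then have "fraction N (\<lambda>s. s i) = 1 / 2"
    unfolding fraction_compl by simp
  then show ?thesis
    by (cases b) (simp_all add: fraction_compl)
qed

lemma fraction_cylinder:
  assumes "finite T" "inj_on \<gamma> T" "\<gamma> ` T \<subseteq> {1..N}"
  shows "fraction N (\<lambda>s. \<forall>x\<in>T. s (\<gamma> x) = b) = (1 / 2) ^ card T"
  using assms
proof (induction T rule: finite_induct)
  case empty
  then show ?case
    using card_states[of N] by (simp add: fraction_def)
next
  case (insert x T)
  have "fraction N (\<lambda>s. \<forall>y\<in>insert x T. s (\<gamma> y) = b) =
      fraction N (\<lambda>s. s (\<gamma> x) = b \<and> (\<forall>y\<in>T. s (\<gamma> y) = b))"
    by simp
  also have "\<dots> = fraction N (\<lambda>s. s (\<gamma> x) = b) * fraction N (\<lambda>s. \<forall>y\<in>T. s (\<gamma> y) = b)"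
  proof (rule fraction_indep[OF depends_bit])
    show "depends (\<lambda>s. \<forall>y\<in>T. s (\<gamma> y) = b) (\<gamma> ` T)"
      by (auto simp: depends_def)
    show "{\<gamma> x} \<inter> \<gamma> ` T = {}"
      using insert.hyps insert.prems by (auto simp: inj_on_def)
  qed
  finally show ?case
    using insert fraction_bit[of "\<gamma> x" N b] by simp
qed

subsection \<open>Amplification by a random tree\<close>

text \<open>The probability that a node at height \<open>k\<close> of the tree is true when its leaves are independent
  and true with probability \<open>a\<close>; the nodes at odd heights are conjunctions.\<close>

fun amp :: "real \<Rightarrow> nat \<Rightarrow> real" where
  "amp a 0 = a"
| "amp a (Suc k) = (if even k then (amp a k)\<^sup>2 else 1 - (1 - amp a k)\<^sup>2)"

abbreviation tree_value :: "nat \<Rightarrow> bool list \<Rightarrow> (bool list \<Rightarrow> bool) \<Rightarrow> bool" where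
  "tree_value \<equiv> formula_value (\<lambda>p. even (length p)) (\<lambda>p. p)"

definition leaves_above :: "nat \<Rightarrow> bool list \<Rightarrow> bool list set" where
  "leaves_above d p = {r. length r = d \<and> (\<exists>t. r = t @ p)}"

lemma leaves_above_child: "leaves_above d (c # p) \<subseteq> leaves_above d p"
proof
  fix r assume "r \<in> leaves_above d (c # p)"
  then obtain t where "length r = d" "r = (t @ [c]) @ p"
    by (auto simp: leaves_above_def)
  then show "r \<in> leaves_above d p"
    unfolding leaves_above_def by blast
qed

lemma leaves_above_disjoint: "leaves_above d (False # p) \<inter> leaves_above d (True # p) = {}"
proof -
  have False if "t @ False # p = t' @ True # p" for t t'
  proof -
    have "length t = length t'"
      using arg_cong[OF that, of length] by simp
    then show False
      using that by simp
  qed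
  then show ?thesis
    unfolding leaves_above_def by fastforce
qed

lemma depends_tree_value:
  assumes "\<And>r. length r = d \<Longrightarrow> depends (\<lambda>s. val s r) (S r)" "length p + k = d"
  shows "depends (\<lambda>s. tree_value k p (val s)) (\<Union>r\<in>leaves_above d p. S r)"
  using assms(2)
proof (induction k arbitrary: p)
  case 0
  then show ?case
    using assms(1)[of p] by (auto simp: leaves_above_def intro: depends_mono)
next
  case (Suc k)
  have dep: "depends (\<lambda>s. tree_value k (c # p) (val s)) (\<Union>r\<in>leaves_above d p. S r)" for c
  proof (rule depends_mono)
    show "depends (\<lambda>s. tree_value k (c # p) (val s)) (\<Union>r\<in>leaves_above d (c # p). S r)"
      using Suc.IH[of "c # p"] Suc.prems by simp
    show "(\<Union>r\<in>leaves_above d (c # p). S r) \<subseteq> (\<Union>r\<in>leaves_above d p. S r)"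
      by (rule UN_mono[OF leaves_above_child]) simp
  qed
  show ?case
    unfolding depends_def
  proof (intro allI impI)
    fix s s' :: bstate assume agree: "\<forall>i\<in>\<Union>r\<in>leaves_above d p. S r. s i = s' i"
    have "tree_value k (c # p) (val s) = tree_value k (c # p) (val s')" for c
      using dep[of c] agree unfolding depends_def by (elim allE[of _ s] allE[of _ s'] impE)
    then show "tree_value (Suc k) p (val s) = tree_value (Suc k) p (val s')"
      by simp
  qed
qed

text \<open>The subtrees of a node have disjoint leaves and are independent.  The depth \<open>d\<close> is odd so that
  even depth below the root, by which \<open>tree_value\<close> selects conjunctions, is odd height above the leaves.\<close>

lemma fraction_tree_value:
  assumes dep: "\<And>r. length r = d \<Longrightarrow> depends (\<lambda>s. val s r) (S r)"
    and disj: "\<And>r r'. length r = d \<Longrightarrow> length r' = d \<Longrightarrow> r \<noteq> r' \<Longrightarrow> S r \<inter> S r' = {}"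
    and leaf: "\<And>r. length r = d \<Longrightarrow> fraction N (\<lambda>s. val s r) = a"
    and d: "odd d" and p: "length p + k = d"
  shows "fraction N (\<lambda>s. tree_value k p (val s)) = amp a k"
  using p
proof (induction k arbitrary: p)
  case 0
  then show ?case
    using leaf by simp
next
  case (Suc k)
  let ?E = "\<lambda>c s. tree_value k (c # p) (val s)"
  let ?S = "\<lambda>c. \<Union>r\<in>leaves_above d (c # p). S r"
  have E: "depends (?E c) (?S c)" for c
    by (rule depends_tree_value[OF dep]) (use Suc.prems in auto)
  have F: "fraction N (?E c) = amp a k" for c
    using Suc by simp
  have S: "?S False \<inter> ?S True = {}"
  proof (rule ccontr)
    assume "?S False \<inter> ?S True \<noteq> {}"
    then obtain r r' i where r: "r \<in> leaves_above d (False # p)" "r' \<in> leaves_above d (True # p)"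
      "i \<in> S r" "i \<in> S r'"
      by blast
    then have "r \<noteq> r'"
      using leaves_above_disjoint[of d p] by blast
    then show False
      using disj[of r r'] r by (auto simp: leaves_above_def)
  qed
  have par: "even (length p) \<longleftrightarrow> even k"
    using Suc.prems d by presburger
  show ?case
  proof (cases "even k")
    case True
    then have "fraction N (\<lambda>s. tree_value (Suc k) p (val s)) = fraction N (\<lambda>s. ?E False s \<and> ?E True s)"
      by (simp add: gate_def par)
    then show ?thesis
      using fraction_indep[OF E E S] True by (simp add: F power2_eq_square)
  next
    case False
    have nE: "depends (\<lambda>s. \<not> ?E c s) (?S c)" for c
      using E[of c] unfolding depends_def by simp
    have "fraction N (\<lambda>s. tree_value (Suc k) p (val s)) =
        fraction N (\<lambda>s. \<not> (\<not> ?E False s \<and> \<not> ?E True s))"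
      using False by (simp add: gate_def par)
    then show ?thesis
      unfolding fraction_compl using fraction_indep[OF nE nE S] False
      by (simp add: fraction_compl F power2_eq_square)
  qed
qed

text \<open>Two levels of the tree apply \<open>a \<mapsto> 1 - (1 - a\<^sup>2)\<^sup>2\<close>, whose repelling fixed point
  \<open>(\<surd>5 - 1) / 2\<close> separates \<open>1/2\<close> from \<open>3/4\<close>.\<close>

lemma amp_half: "amp (1 / 2) (2 * Suc m) \<le> 7 / 16 * (7 / 8) ^ m \<and> 0 \<le> amp (1 / 2) (2 * Suc m)"
proof (induction m)
  case 0
  then show ?case by (simp add: numeral_2_eq_2 power2_eq_square)
next
  case (Suc m)
  define b where "b = amp (1 / 2) (2 * Suc m)"
  have b: "0 \<le> b" "b \<le> 7 / 16 * (7 / 8) ^ m"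
    using Suc by (auto simp: b_def)
  have "(7 / 8 :: real) ^ m \<le> 1"
    by (simp add: power_le_one)
  with b have b1: "b \<le> 7 / 16"
    by linarith
  have "amp (1 / 2) (2 * Suc (Suc m)) = 1 - (1 - b\<^sup>2)\<^sup>2"
    by (simp add: b_def)
  also have "\<dots> = 2 * b\<^sup>2 - (b\<^sup>2)\<^sup>2"
    by (simp add: power2_eq_square algebra_simps)
  finally have eq: "amp (1 / 2) (2 * Suc (Suc m)) = 2 * b\<^sup>2 - (b\<^sup>2)\<^sup>2" .
  have bb: "b\<^sup>2 \<le> 7 / 16 * b"
    unfolding power2_eq_square by (rule mult_right_mono[OF b1 b(1)])
  have "b\<^sup>2 \<le> 1"
    using bb b1 by linarith
  then have "(b\<^sup>2)\<^sup>2 \<le> b\<^sup>2"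
    unfolding power2_eq_square[of "b\<^sup>2"] by (rule mult_left_le) simp
  then have "0 \<le> amp (1 / 2) (2 * Suc (Suc m))"
    unfolding eq using zero_le_power2[of b] by linarith
  moreover have "amp (1 / 2) (2 * Suc (Suc m)) \<le> 7 / 8 * b"
    unfolding eq using bb zero_le_power2[of "b\<^sup>2"] by linarith
  ultimately show ?case
    using b by simp
qed

lemma amp_three_quarters:
  "1 - amp (3 / 4) (2 * Suc m) \<le> 49 / 256 * (49 / 64) ^ m \<and> amp (3 / 4) (2 * Suc m) \<le> 1"
proof (induction m)
  case 0
  then show ?case by (simp add: numeral_2_eq_2 power2_eq_square)
next
  case (Suc m)
  define c where "c = 1 - amp (3 / 4) (2 * Suc m)"
  have c: "0 \<le> c" "c \<le> 49 / 256 * (49 / 64) ^ m"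
    using Suc by (auto simp: c_def)
  have "(49 / 64 :: real) ^ m \<le> 1"
    by (simp add: power_le_one)
  with c have c1: "c \<le> 49 / 256"
    by linarith
  have eq: "amp (3 / 4) (2 * Suc (Suc m)) = 1 - (1 - (1 - c)\<^sup>2)\<^sup>2"
    by (simp add: c_def)
  have "0 \<le> 1 - (1 - c)\<^sup>2" "1 - (1 - c)\<^sup>2 \<le> 2 * c"
    using c c1 zero_le_power2[of c] mult_left_le[of c c] by (simp_all add: power2_eq_square algebra_simps)
  then have "(1 - (1 - c)\<^sup>2)\<^sup>2 \<le> (2 * c)\<^sup>2"
    by (intro power_mono)
  also have "\<dots> = (4 * c) * c"
    by (simp add: power2_eq_square)
  also have "\<dots> \<le> 49 / 64 * c"
    by (rule mult_right_mono) (use c c1 in auto)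
  finally show ?case
    unfolding eq using c by simp
qed

lemma amplification:
  assumes "0 < \<epsilon>"
  shows "\<exists>d. odd d \<and> 1 < d \<and> amp (1 / 2) d < \<epsilon> \<and> 1 - \<epsilon> < amp (3 / 4) d"
proof -
  obtain m where m: "(7 / 8 :: real) ^ m < \<epsilon> / 2"
    using real_arch_pow_inv[of "\<epsilon> / 2" "7 / 8"] assms by auto
  define b where "b = amp (1 / 2) (2 * Suc m)"
  define c where "c = 1 - amp (3 / 4) (2 * Suc m)"
  have "(7 / 8 :: real) ^ m \<le> 1"
    by (simp add: power_le_one)
  then have b: "0 \<le> b" "b \<le> 7 / 16 * (7 / 8) ^ m" "b \<le> 1"
    using amp_half[of m] by (auto simp: b_def)
  have "(49 / 64 :: real) ^ m \<le> (7 / 8) ^ m"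
    by (simp add: power_mono)
  then have c: "0 \<le> c" "c \<le> 49 / 256 * (7 / 8) ^ m"
    using amp_three_quarters[of m] by (auto simp: c_def)
  have "amp (1 / 2) (Suc (2 * Suc m)) = b\<^sup>2"
    by (simp add: b_def)
  moreover have "b\<^sup>2 \<le> b"
    using b by (simp add: power2_eq_square mult_left_le)
  moreover have "amp (3 / 4) (Suc (2 * Suc m)) = (1 - c)\<^sup>2"
    by (simp add: c_def)
  moreover have "(1 - c)\<^sup>2 \<ge> 1 - 2 * c"
    using zero_le_power2[of c] by (simp add: power2_eq_square algebra_simps)
  ultimately show ?thesis
    using b c m assms by (intro exI[of _ "Suc (2 * Suc m)"]) auto
qed

subsection \<open>The weight of a random block\<close>

text \<open>The signs of distinct coordinates are uncorrelated: flipping one of them negates the product.\<close>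

lemma second_moment:
  assumes "finite S" "S \<subseteq> {1..N}"
  shows "(\<Sum>s\<in>states N. (\<Sum>i\<in>S. if s i then 1 else - 1 :: real)\<^sup>2) = card S * 2 ^ N"
  using assms
proof (induction S rule: finite_induct)
  case (insert j S)
  define Z where "Z = (\<lambda>s. \<Sum>i\<in>S. if s i then 1 else - 1 :: real)"
  define e where "e = (\<lambda>s :: bstate. if s j then 1 else - 1 :: real)"
  have j: "j \<in> {1..N}"
    using insert.prems by simp
  have "(\<Sum>s\<in>states N. Z s * e s) = (\<Sum>s\<in>states N. Z (flip j s) * e (flip j s))"
    by (rule sum.reindex_bij_witness[where i = "flip j" and j = "flip j"])
       (use flip_in_states[OF _ j] in \<open>auto simp: flip_def\<close>)
  also have "\<dots> = (\<Sum>s\<in>states N. - (Z s * e s))"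
  proof (rule sum.cong[OF refl])
    fix s
    have "Z (flip j s) = Z s"
      unfolding Z_def using insert.hyps(2) by (intro sum.cong) (auto simp: flip_def)
    then show "Z (flip j s) * e (flip j s) = - (Z s * e s)"
      by (simp add: e_def flip_def)
  qed
  finally have cross: "(\<Sum>s\<in>states N. Z s * e s) = 0"
    by (simp add: sum_negf)
  have "(\<Sum>s\<in>states N. (\<Sum>i\<in>insert j S. if s i then 1 else - 1 :: real)\<^sup>2) =
      (\<Sum>s\<in>states N. (Z s)\<^sup>2 + 2 * (Z s * e s) + 1)"
  proof (rule sum.cong[OF refl])
    fix s
    have "(\<Sum>i\<in>insert j S. if s i then 1 else - 1 :: real) = e s + Z s"
      unfolding Z_def e_def using insert.hyps by simp
    moreover have "(e s + Z s)\<^sup>2 = (Z s)\<^sup>2 + 2 * (Z s * e s) + (e s)\<^sup>2"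
      by (simp add: power2_eq_square algebra_simps)
    moreover have "(e s)\<^sup>2 = 1"
      by (simp add: e_def)
    ultimately show "(\<Sum>i\<in>insert j S. if s i then 1 else - 1 :: real)\<^sup>2 =
        (Z s)\<^sup>2 + 2 * (Z s * e s) + 1"
      by simp
  qed
  also have "\<dots> = card S * 2 ^ N + 2 ^ N"
  proof -
    have "(\<Sum>s\<in>states N. (Z s)\<^sup>2) = card S * 2 ^ N"
      unfolding Z_def using insert.IH insert.prems by simp
    then show ?thesis
      using cross card_states[of N] by (simp add: sum.distrib sum_distrib_left[symmetric])
  qed
  finally show ?case
    using insert.hyps by (simp add: algebra_simps)
qed simp

text \<open>This is Chebyshev's inequality for the weight \<open>(Z + 2 w) / 2\<close>, where \<open>Z\<close> is a sum of \<open>2 w\<close>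
  uncorrelated signs and has variance \<open>2 w\<close>.\<close>

lemma weight_concentration:
  assumes S: "S \<subseteq> {1..N}" "card S = 2 * w" and q: "0 < q"
  shows "fraction N (\<lambda>s. \<not> (w < card {i \<in> S. s i} + q \<and> card {i \<in> S. s i} < w + q)) \<le> w / (2 * q\<^sup>2)"
    (is "fraction N ?E \<le> _")
proof -
  have fin: "finite S"
    using S(1) finite_subset by blast
  define Z where "Z = (\<lambda>s. \<Sum>i\<in>S. if s i then 1 else - 1 :: real)"
  have Z: "Z s = 2 * real (card {i \<in> S. s i}) - 2 * real w" for s
  proof -
    have "Z s = (\<Sum>i\<in>S. 2 * (if s i then 1 else 0) - 1)"
      unfolding Z_def by (rule sum.cong) auto
    also have "\<dots> = 2 * (\<Sum>i\<in>S. if s i then 1 else 0) - real (card S)"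
      by (simp add: sum_subtractf sum_distrib_left)
    also have "(\<Sum>i\<in>S. if s i then 1 else 0 :: real) = card {i \<in> S. s i}"
      using fin by (simp add: sum.If_cases Int_def)
    finally show ?thesis
      using S(2) by simp
  qed
  have far: "4 * (real q)\<^sup>2 \<le> (Z s)\<^sup>2" if "?E s" for s
  proof -
    have "2 * real q \<le> \<bar>Z s\<bar>"
      unfolding Z using that by linarith
    then have "(2 * real q)\<^sup>2 \<le> \<bar>Z s\<bar>\<^sup>2"
      by (rule power_mono) simp
    then show ?thesis
      by (simp add: power2_eq_square)
  qed
  have "4 * (real q)\<^sup>2 * card {s \<in> states N. ?E s} = (\<Sum>s\<in>{s \<in> states N. ?E s}. 4 * (real q)\<^sup>2)"
    by simp
  also have "\<dots> \<le> (\<Sum>s\<in>{s \<in> states N. ?E s}. (Z s)\<^sup>2)"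
    by (rule sum_mono) (use far in blast)
  also have "\<dots> \<le> (\<Sum>s\<in>states N. (Z s)\<^sup>2)"
    by (rule sum_mono2) (use finite_states in auto)
  also have "\<dots> = 2 * w * 2 ^ N"
    using second_moment[OF fin S(1)] S(2) by (simp add: Z_def)
  finally have "4 * (real q)\<^sup>2 * card {s \<in> states N. ?E s} \<le> 2 * w * 2 ^ N" .
  then show ?thesis
    using q unfolding fraction_def by (simp add: field_simps)
qed

section \<open>The vertices of the machine\<close>

text \<open>Tracks \<open>p < P\<close> are delay lines of pairs; control rail \<open>b\<close> is the input pair number \<open>P\<close>.

  \<open>Ring p sd i\<close> is stage \<open>i\<close> of the conjunction (\<open>sd = True\<close>) or disjunction line of track \<open>p\<close>.
  \<open>Form j q\<close> is a node of the formula tree for output \<open>j\<close>, \<open>Copy i q\<close> a node of the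
  tree that multiplies input \<open>i\<close>, and \<open>Src k\<close> supplies the constant 1 that turns the \<open>k\<close>-th copy
  gate into a wire.  \<open>Line\<close>, \<open>Tree\<close> and \<open>Aux\<close> form the start timer, and \<open>Dummy\<close> is padding.\<close>

datatype vert =
    Ring nat bool nat
  | Form "nat \<times> bool" "bool list"
  | Copy "nat \<times> bool" "bool list"
  | Src nat
  | Line bool nat
  | Tree bool "bool list"
  | Aux bool "bool list"
  | Dummy nat

definition cell :: "nat \<Rightarrow> bool \<Rightarrow> nat \<Rightarrow> vert" where
  "cell p sd i = (if i = 0 then Form (p, sd) [] else Ring p sd i)"

text \<open>The root of the timer tree and one of its children serve as stages 1 and 0 of the timer line.\<close>

definition stage :: "bool \<Rightarrow> nat \<Rightarrow> vert" where
  "stage b i = (if i = 0 then Tree b [True] else if i = 1 then Tree b [] else Line b i)"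

text \<open>The formula for output \<open>j\<close> has depth \<open>D\<close> with gates \<open>fop j\<close> and leaf labels \<open>lab j\<close>.  The copy
  trees have depth \<open>r\<close>, and \<open>code\<close> assigns to every formula leaf a leaf of the copy tree of its label;
  injectivity makes sure that no copy is used twice.  The \<open>F\<close> copy gates are numbered by \<open>num\<close>.  The
  timer trees have depth \<open>d\<close> and the timer lines end at stage \<open>L\<close>; \<open>m\<close> is the amount of padding.\<close>

locale design =
  fixes P L r D d F m :: nat and len :: "nat \<Rightarrow> nat"
    and fop :: "nat \<times> bool \<Rightarrow> bool list \<Rightarrow> bool"
    and lab :: "nat \<times> bool \<Rightarrow> bool list \<Rightarrow> nat \<times> bool"
    and code :: "nat \<times> bool \<Rightarrow> bool list \<Rightarrow> bool list"
    and num :: "nat \<times> bool \<Rightarrow> bool list \<Rightarrow> nat"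
  assumes len_pos: "p < P \<Longrightarrow> 0 < len p"
    and D_pos: "0 < D" and d_odd: "odd d" and d_gt: "1 < d" and L_ge: "2 \<le> L" and m_ge: "2 \<le> m"
    and lab_le: "fst j < P \<Longrightarrow> fst (lab j q) \<le> P"
    and code_length: "fst j < P \<Longrightarrow> length q = D \<Longrightarrow> length (code j q) = r"
    and code_inj: "fst j < P \<Longrightarrow> length q = D \<Longrightarrow> fst j' < P \<Longrightarrow> length q' = D \<Longrightarrow>
        code j q = code j' q' \<Longrightarrow> j = j' \<and> q = q'"
    and num_less: "fst i \<le> P \<Longrightarrow> length q \<le> r \<Longrightarrow> num i q < F"
    and num_inj: "fst i \<le> P \<Longrightarrow> length q \<le> r \<Longrightarrow> fst i' \<le> P \<Longrightarrow> length q' \<le> r \<Longrightarrow>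
        num i q = num i' q' \<Longrightarrow> i = i' \<and> q = q'"
    and num_surj: "k < F \<Longrightarrow> \<exists>i q. fst i \<le> P \<and> length q \<le> r \<and> num i q = k"
begin

definition input :: "nat \<times> bool \<Rightarrow> vert" where
  "input i = (if fst i < P then Ring (fst i) (snd i) (len (fst i)) else Line (snd i) L)"

definition is_leaf :: "bool list \<Rightarrow> bool" where
  "is_leaf q \<longleftrightarrow> length q = d"

fun vin :: "vert \<Rightarrow> bool" where
  "vin (Ring p sd i) = (p < P \<and> 0 < i \<and> i \<le> len p)"
| "vin (Form j q) = (fst j < P \<and> length q < D)"
| "vin (Copy i q) = (fst i \<le> P \<and> length q \<le> r)"
| "vin (Src k) = (k < F)"
| "vin (Line b i) = (2 \<le> i \<and> i \<le> L)"
| "vin (Tree b q) = (length q < d \<or> is_leaf q)"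
| "vin (Aux b q) = is_leaf q"
| "vin (Dummy k) = (k < m)"

fun op :: "vert \<Rightarrow> bool" where
  "op (Ring p sd i) = sd"
| "op (Form j q) = fop j q"
| "op (Copy i q) = True"
| "op (Src k) = False"
| "op (Line b i) = b"
| "op (Tree b q) = (if is_leaf q then \<not> b else even (length q) = b)"
| "op (Aux b q) = (\<not> b)"
| "op (Dummy k) = True"

text \<open>Only the second in-slots of \<open>Src\<close> and \<open>Aux\<close> are left open.  Arbitrary signals may enter there:
  \<open>Src\<close> is a disjunction and stays 1 once its first source is constantly 1, and the timer relies on \<open>Aux\<close>
  only at time 0.  These slots absorb the out-slots that nothing else uses.\<close>

fun src :: "vert \<Rightarrow> bool \<Rightarrow> (vert \<times> bool) option" where
  "src (Ring p sd i) c = Some (cell p c (i - 1), sd)"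
| "src (Form j q) c = Some (if Suc (length q) < D then Form j (c # q)
     else Copy (lab j (c # q)) (code j (c # q)), False)"
| "src (Copy i q) c = Some (if c then (Src (num i q), True)
     else if q = [] then (input i, False) else (Copy i (tl q), hd q))"
| "src (Src k) c = (if c then None
     else Some (if k = 0 then (Tree True [False], True) else (Src (k - 1), False)))"
| "src (Line b i) c = Some (stage b (if c then i - 2 else i - 1), c)"
| "src (Tree b q) c = Some (if is_leaf q then if c then (Aux b q, False) else (Tree b q, True)
     else (Tree b (c # q), False))"
| "src (Aux b q) c = (if c then None else Some (Aux b q, True))"
| "src (Dummy k) c = Some (Dummy (if c then Suc k mod m else k), c)"

lemma is_leaf_simps [simp]:
  "\<not> is_leaf []" "\<not> is_leaf [c]" "0 < d" "Suc 0 < d"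
  "length q < d \<Longrightarrow> \<not> is_leaf q" "is_leaf q \<Longrightarrow> \<not> length q < d"
  using d_gt by (auto simp: is_leaf_def)

lemma is_leaf_child: "length q < d \<Longrightarrow> Suc (length q) < d \<or> is_leaf (c # q)"
  by (auto simp: is_leaf_def)

lemma src_in: "vin v \<Longrightarrow> src v c = Some (u, e) \<Longrightarrow> vin u"
  by (cases v; cases c)
     (auto simp: cell_def stage_def input_def len_pos lab_le code_length num_less d_gt D_pos L_ge
        m_ge is_leaf_child split: if_splits)

lemma src_distinct: "vin v \<Longrightarrow> src v False = Some (u, e) \<Longrightarrow> src v True = Some (u', e') \<Longrightarrow> u \<noteq> u'"
proof (cases v)
  case (Form j q)
  assume "vin v" and s: "src v False = Some (u, e)" "src v True = Some (u', e')"
  then have j: "fst j < P" "length q < D"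
    using Form by auto
  show "u \<noteq> u'"
  proof (cases "Suc (length q) < D")
    case False
    then have "code j (False # q) \<noteq> code j (True # q)"
      using code_inj[of j "False # q" j "True # q"] j by auto
    then show ?thesis
      using s Form False by auto
  qed (use s Form in auto)
next
  case (Dummy k)
  assume "vin v" and s: "src v False = Some (u, e)" "src v True = Some (u', e')"
  then have "k \<noteq> Suc k mod m"
    using Dummy m_ge by (auto simp: mod_Suc split: if_splits)
  then show ?thesis
    using s Dummy by auto
next
  case (Aux b q)
  assume "src v True = Some (u', e')"
  then show ?thesis
    using Aux by simp
qed (auto simp: cell_def stage_def input_def split: if_splits)

lemma src_left: "src v False \<noteq> None"
  by (cases v) auto

lemma src_full:
  assumes "vin v" "src v False = Some (u, e)" "src v True = None"
  shows "\<exists>w c. vin w \<and> src w c = Some (u, e')"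
proof (cases v)
  case (Src k)
  show ?thesis
  proof (cases "k = 0")
    case True
    then have u: "u = Tree True [False]"
      using assms Src by simp
    show ?thesis
    proof (cases e')
      case True
      then show ?thesis
        using assms Src u by (intro exI[of _ "Src 0"] exI[of _ False]) auto
    next
      case False
      then show ?thesis
        using u d_gt by (intro exI[of _ "Tree True []"] exI[of _ False]) auto
    qed
  next
    case False
    then have u: "u = Src (k - 1)" and k: "k - 1 < F"
      using assms Src by auto
    show ?thesis
    proof (cases e')
      case True
      obtain i q where "fst i \<le> P" "length q \<le> r" "num i q = k - 1"
        using num_surj[OF k] by blast
      then show ?thesis
        using u True by (intro exI[of _ "Copy i q"] exI[of _ True]) auto
    next
      case False
      then show ?thesis
        using assms Src u \<open>k \<noteq> 0\<close> by (intro exI[of _ "Src k"] exI[of _ False]) auto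
    qed
  qed
next
  case (Aux b q)
  then have u: "u = Aux b q"
    using assms by simp
  show ?thesis
  proof (cases e')
    case True
    then show ?thesis
      using assms Aux u by (intro exI[of _ "Aux b q"] exI[of _ False]) auto
  next
    case False
    then show ?thesis
      using assms Aux u by (intro exI[of _ "Tree b q"] exI[of _ True]) auto
  qed
qed (use assms in \<open>auto split: if_splits\<close>)

text \<open>The slot that an out-slot feeds, written as a function: exhibiting this inverse is how the
  prescribed part of the wiring is seen to be injective.\<close>

fun dst :: "vert \<Rightarrow> bool \<Rightarrow> vert \<times> bool" where
  "dst (Ring p sd i) e =
     (if i < len p then (Ring p e (Suc i), sd) else (Copy (p, sd) [], False))"
| "dst (Form j q) e =
     (if q = [] then (Ring (fst j) e 1, snd j) else (Form j (tl q), hd q))"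
| "dst (Copy i q) e =
     (if length q < r then (Copy i (e # q), False)
      else SOME w. \<exists>j t c. w = (Form j t, c) \<and> fst j < P \<and> Suc (length t) = D \<and> code j (c # t) = q)"
| "dst (Src k) e =
     (if e then SOME w. \<exists>i q. w = (Copy i q, True) \<and> fst i \<le> P \<and> length q \<le> r \<and> num i q = k
      else (Src (Suc k), False))"
| "dst (Line b i) e = (if i = L then (Copy (P, b) [], False) else (Line b (if e then i + 2 else i + 1), e))"
| "dst (Tree b q) e =
     (if q = [] then (Line b (if e then 3 else 2), e)
      else if is_leaf q \<and> e then (Tree b q, False)
      else if e then (if q = [True] then (Line b 2, True) else (Src 0, False))
      else (Tree b (tl q), hd q))"
| "dst (Aux b q) e = (if e then (Aux b q, False) else (Tree b q, True))"
| "dst (Dummy k) e = (Dummy (if e then (if k = 0 then m - 1 else k - 1) else k), e)"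

lemma dst_src: "vin v \<Longrightarrow> src v c = Some (u, e) \<Longrightarrow> dst u e = (v, c)"
proof (cases v)
  case (Form j q)
  assume v: "vin v" and s: "src v c = Some (u, e)"
  then have j: "fst j < P" "length q < D"
    using Form by auto
  show "dst u e = (v, c)"
  proof (cases "Suc (length q) < D")
    case True
    then show ?thesis
      using s Form by auto
  next
    case False
    then have l: "Suc (length q) = D"
      using j by simp
    have u: "u = Copy (lab j (c # q)) (code j (c # q))" "e = False"
      using s Form False by auto
    have "w = (Form j q, c)"
      if ex: "\<exists>j' t c'. w = (Form j' t, c') \<and> fst j' < P \<and> Suc (length t) = D \<and> code j' (c' # t) = code j (c # q)"
      for w
    proof -
      obtain j' t c' where "w = (Form j' t, c')" "fst j' < P" "length (c' # t) = D"
        "code j' (c' # t) = code j (c # q)"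
        using ex by auto
      then show ?thesis
        using code_inj[of j' "c' # t" j "c # q"] j l by simp
    qed
    then have "(SOME w. \<exists>j' t c'. w = (Form j' t, c') \<and> fst j' < P \<and> Suc (length t) = D \<and>
        code j' (c' # t) = code j (c # q)) = (Form j q, c)"
      using j l by (intro some_equality) blast+
    then show ?thesis
      using u code_length[of j "c # q"] j l Form by simp
  qed
next
  case (Copy i q)
  assume v: "vin v" and s: "src v c = Some (u, e)"
  then have i: "fst i \<le> P" "length q \<le> r"
    using Copy by auto
  show "dst u e = (v, c)"
  proof (cases c)
    case True
    have "w = (Copy i q, True)"
      if "\<exists>i' q'. w = (Copy i' q', True) \<and> fst i' \<le> P \<and> length q' \<le> r \<and> num i' q' = num i q" for w
      using that num_inj[of _ _ i q] i by blast
    then have "(SOME w. \<exists>i' q'. w = (Copy i' q', True) \<and> fst i' \<le> P \<and> length q' \<le> r \<and>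
        num i' q' = num i q) = (Copy i q, True)"
      using i by (intro some_equality) blast+
    then show ?thesis
      using s Copy True by auto
  next
    case False
    show ?thesis
    proof (cases q)
      case Nil
      have "(P, snd i) = i" if "\<not> fst i < P"
        using that i by (cases i) auto
      then show ?thesis
        using s Copy False Nil by (auto simp: input_def)
    next
      case (Cons x q')
      then show ?thesis
        using s Copy False i by auto
    qed
  qed
next
  case (Dummy k)
  assume v: "vin v" and s: "src v c = Some (u, e)"
  have k: "k < m"
    using v Dummy by simp
  have "Suc k mod m = (if k = m - 1 then 0 else Suc k)"
    using k by auto
  then show "dst u e = (v, c)"
    using s Dummy k m_ge by (cases "k = m - 1") (auto simp del: mod_Suc)
qed (use len_pos d_gt L_ge in \<open>auto simp: cell_def stage_def split: if_splits\<close>)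

lemma src_inj: "vin v \<Longrightarrow> vin v' \<Longrightarrow> src v c = Some y \<Longrightarrow> src v' c' = Some y \<Longrightarrow> v = v' \<and> c = c'"
  using dst_src[of v c "fst y" "snd y"] dst_src[of v' c' "fst y" "snd y"] by simp

abbreviation verts :: "vert set" where
  "verts \<equiv> {v. vin v}"

definition gadget_size :: nat where
  "gadget_size = card ({Form j q |j q. fst j < P \<and> length q < D} \<union>
     {Copy i q |i q. fst i \<le> P \<and> length q \<le> r} \<union> Src ` {..<F} \<union>
     {Tree b q |b q. length q < d \<or> is_leaf q} \<union> {Aux b q |b q. is_leaf q})"

lemma finite_paths: "finite {q :: bool list. length q \<le> k}"
  using finite_lists_length_le[of "UNIV :: bool set" k] by simp

lemma finite_gadget:
  "finite ({Form j q |j q. fst j < P \<and> length q < D} \<union>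
     {Copy i q |i q. fst i \<le> P \<and> length q \<le> r} \<union> Src ` {..<F} \<union>
     {Tree b q |b q. length q < d \<or> is_leaf q} \<union> {Aux b q |b q. is_leaf q})"
proof -
  have "finite ({..P} \<times> (UNIV :: bool set) \<times> {q :: bool list. length q \<le> k})" for k
    using finite_paths by simp
  note fin = this
  have "{Form j q |j q. fst j < P \<and> length q < D} \<subseteq>
      (\<lambda>(p, sd, q). Form (p, sd) q) ` ({..P} \<times> UNIV \<times> {q. length q \<le> D})"
    by (force simp: image_def)
  then have 1: "finite {Form j q |j q. fst j < P \<and> length q < D}"
    using finite_subset fin by blast
  have "{Copy i q |i q. fst i \<le> P \<and> length q \<le> r} \<subseteq>
      (\<lambda>(p, sd, q). Copy (p, sd) q) ` ({..P} \<times> UNIV \<times> {q. length q \<le> r})"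
    by (force simp: image_def)
  then have 2: "finite {Copy i q |i q. fst i \<le> P \<and> length q \<le> r}"
    using finite_subset fin by blast
  have "{Tree b q |b q. length q < d \<or> is_leaf q} \<subseteq> (\<lambda>(p, sd, q). Tree sd q) ` ({..P} \<times> UNIV \<times> {q. length q \<le> d})"
    by (force simp: image_def is_leaf_def)
  then have 3: "finite {Tree b q |b q. length q < d \<or> is_leaf q}"
    using finite_subset fin by blast
  have "{Aux b q |b q. is_leaf q} \<subseteq> (\<lambda>(p, sd, q). Aux sd q) ` ({..P} \<times> UNIV \<times> {q. length q \<le> d})"
    by (force simp: image_def is_leaf_def)
  then have 4: "finite {Aux b q |b q. is_leaf q}"
    using finite_subset fin by blast
  show ?thesis
    using 1 2 3 4 by blast
qed

lemma verts_decomp: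
  "verts = ({Form j q |j q. fst j < P \<and> length q < D} \<union>
     {Copy i q |i q. fst i \<le> P \<and> length q \<le> r} \<union> Src ` {..<F} \<union>
     {Tree b q |b q. length q < d \<or> is_leaf q} \<union> {Aux b q |b q. is_leaf q}) \<union>
     (\<lambda>(p, sd, i). Ring p sd i) ` (SIGMA p:{..<P}. UNIV \<times> {1..len p}) \<union>
     (\<lambda>(b, i). Line b i) ` (UNIV \<times> {2..L}) \<union> Dummy ` {..<m}" (is "_ = ?R")
proof (intro equalityI subsetI)
  fix v assume "v \<in> verts"
  then show "v \<in> ?R"
    by (cases v) (force simp: image_iff)+
qed auto

lemma finite_verts: "finite verts"
  unfolding verts_decomp using finite_gadget by (intro finite_UnI) auto

lemma card_verts: "card verts = gadget_size + (\<Sum>p<P. 2 * len p) + 2 * (L - 1) + m"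
proof -
  let ?G = "{Form j q |j q. fst j < P \<and> length q < D} \<union>
     {Copy i q |i q. fst i \<le> P \<and> length q \<le> r} \<union> Src ` {..<F} \<union>
     {Tree b q |b q. length q < d \<or> is_leaf q} \<union> {Aux b q |b q. is_leaf q}"
  let ?R = "(\<lambda>(p, sd, i). Ring p sd i) ` (SIGMA p:{..<P}. (UNIV :: bool set) \<times> {1..len p})"
  let ?L = "(\<lambda>(b, i). Line b i) ` ((UNIV :: bool set) \<times> {2..L})"
  have R: "card ?R = (\<Sum>p<P. 2 * len p)"
    by (subst card_image) (auto simp: inj_on_def card_cartesian_product)
  have Li: "card ?L = 2 * (L - 1)"
    by (subst card_image) (auto simp: inj_on_def card_cartesian_product)
  have Du: "card (Dummy ` {..<m}) = m"
    by (subst card_image) (auto simp: inj_on_def)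
  define G where "G = ?G"
  have fG: "finite G"
    unfolding G_def by (rule finite_gadget)
  have G: "Ring p sd i \<notin> G" "Line b i \<notin> G" "Dummy i \<notin> G" for p sd i b
    unfolding G_def by blast+
  have fR: "finite ?R" and fL: "finite ?L"
    by simp_all
  have "verts = G \<union> ?R \<union> ?L \<union> Dummy ` {..<m}"
    unfolding G_def by (rule verts_decomp)
  also have "card \<dots> = card (G \<union> ?R \<union> ?L) + card (Dummy ` {..<m})"
    by (rule card_Un_disjoint) (auto simp: fG G)
  also have "card (G \<union> ?R \<union> ?L) = card (G \<union> ?R) + card ?L"
    by (rule card_Un_disjoint) (auto simp: fG G)
  also have "card (G \<union> ?R) = card G + card ?R"
    by (rule card_Un_disjoint) (auto simp: fG G)
  finally show ?thesis
    unfolding gadget_size_def R Li Du G_def by simp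
qed

lemma wiring_exists:
  "\<exists>inp. (\<forall>v\<in>verts. \<forall>c. inp v c \<in> verts) \<and> (\<forall>v\<in>verts. inp v False \<noteq> inp v True) \<and>
     (\<forall>u\<in>verts. card {v \<in> verts. u = inp v False \<or> u = inp v True} = 2) \<and>
     (\<forall>v\<in>verts. \<forall>c u e. src v c = Some (u, e) \<longrightarrow> inp v c = u)"
proof (rule complete_wiring[OF finite_verts])
  show "u \<in> verts" if "v \<in> verts" "src v c = Some (u, e)" for v c u e
    using that src_in by simp
  show "v = v' \<and> c = c'" if "v \<in> verts" "v' \<in> verts" "src v c = Some y" "src v' c' = Some y"
    for v c v' c' y
    using that src_inj by simp
  show "u \<noteq> u'" if "v \<in> verts" "src v False = Some (u, e)" "src v True = Some (u', e')"
    for v u e u' e'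
    using that src_distinct by simp
  show "\<exists>w\<in>verts. \<exists>c. src w c = Some (u, e')"
    if "v \<in> verts" "src v False = Some (u, e)" "src v True = None" for v u e e'
    using src_full[of v u e e'] that by auto
qed (rule src_left)

end

section \<open>A pipelined odometer\<close>

text \<open>A ring of \<open>n\<close> columns meets a ring of \<open>n + 1\<close> heads, one pair per time step.  Columns hold a
  digit below \<open>B\<close>, the marker \<open>B\<close>, or the blank \<open>B + 1\<close>; a head carries \<open>0\<close> or \<open>1\<close>, or is fresh
  (\<open>2\<close>).  The marker issues a carry to every head passing it.  It is written where a fresh head meets
  a column that is no longer blank; with \<open>n\<close> blank columns and \<open>n + 1\<close> fresh heads this happens
  exactly once, at column \<open>0\<close> in the second revolution.  So a uniform start suffices.\<close>

fun odo :: "nat \<Rightarrow> nat \<times> nat \<Rightarrow> nat \<times> nat" where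
  "odo B (a, h) =
     (if a = B then (B, 1) else if a = B + 1 then (0, 0) else if h = 2 then (B, 1)
      else if h = 1 then (if Suc a = B then (0, 1) else (Suc a, 0)) else (a, 0))"

function meet :: "nat \<Rightarrow> nat \<Rightarrow> nat \<Rightarrow> nat \<times> nat" where
  "meet B n t = (if n = 0 then (0, 0) else
     (if t < n then B + 1 else fst (odo B (meet B n (t - n))),
      if t \<le> n then 2 else snd (odo B (meet B n (t - Suc n)))))"
  by auto
termination
  by (relation "Wellfounded.measure (\<lambda>(B, n, t). t)") auto

declare meet.simps [simp del]

abbreviation column :: "nat \<Rightarrow> nat \<Rightarrow> nat \<Rightarrow> nat" where
  "column B n t \<equiv> fst (meet B n t)"

abbreviation head :: "nat \<Rightarrow> nat \<Rightarrow> nat \<Rightarrow> nat" where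
  "head B n t \<equiv> snd (meet B n t)"

lemma column_start: "t < n \<Longrightarrow> column B n t = B + 1"
  by (subst meet.simps) simp

lemma head_start: "0 < n \<Longrightarrow> t \<le> n \<Longrightarrow> head B n t = 2"
  by (subst meet.simps) simp

lemma column_step: "0 < n \<Longrightarrow> column B n (t + n) = fst (odo B (meet B n t))"
  by (subst meet.simps) simp

lemma head_step: "0 < n \<Longrightarrow> head B n (t + Suc n) = snd (odo B (meet B n t))"
  by (subst meet.simps) simp

lemma odo_bound: "fst x \<le> B + 1 \<Longrightarrow> fst (odo B x) \<le> B + 1 \<and> snd (odo B x) \<le> 2"
  by (cases x) auto

lemma meet_bound: "0 < n \<Longrightarrow> column B n t \<le> B + 1 \<and> head B n t \<le> 2"
proof (induction t rule: less_induct)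
  case (less t)
  have "column B n t \<le> B + 1"
  proof (cases "t < n")
    case False
    then show ?thesis
      using column_step[OF less.prems, of B "t - n"] less odo_bound[of "meet B n (t - n)" B] by simp
  qed (simp add: column_start)
  moreover have "head B n t \<le> 2"
  proof (cases "t \<le> n")
    case False
    then show ?thesis
      using head_step[OF less.prems, of B "t - Suc n"] less odo_bound[of "meet B n (t - Suc n)" B]
      by simp
  qed (simp add: head_start less.prems)
  ultimately show ?case ..
qed

lemma digit_Suc:
  fixes B m x :: nat
  assumes "0 < B" "0 < m"
  shows "(Suc x div m) mod B =
      (if m dvd Suc x then if Suc ((x div m) mod B) = B then 0 else Suc ((x div m) mod B)
       else (x div m) mod B)"
    and "m dvd Suc x \<and> Suc ((x div m) mod B) = B \<longleftrightarrow> m * B dvd Suc x"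
proof -
  have d: "Suc x div m = (if m dvd Suc x then Suc (x div m) else x div m)"
    using div_Suc[of x m] by (simp add: dvd_eq_mod_eq_0)
  then show "(Suc x div m) mod B =
      (if m dvd Suc x then if Suc ((x div m) mod B) = B then 0 else Suc ((x div m) mod B)
       else (x div m) mod B)"
    by (simp add: mod_Suc)
  have "m * B dvd Suc x \<longleftrightarrow> B dvd Suc (x div m)" if "m dvd Suc x"
    using that d assms by (metis dvd_div_iff_mult mult.commute not_gr_zero)
  moreover have "B dvd Suc (x div m) \<longleftrightarrow> Suc ((x div m) mod B) = B"
    using assms by (simp add: dvd_eq_mod_eq_0 mod_Suc)
  ultimately show "m dvd Suc x \<and> Suc ((x div m) mod B) = B \<longleftrightarrow> m * B dvd Suc x"
    by (metis dvd_mult_left)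
qed

text \<open>The head that leaves the marker in revolution \<open>r - i\<close> reaches column \<open>i\<close> in revolution \<open>r\<close>, so
  column \<open>i\<close> then shows digit \<open>i - 1\<close> of the number of earlier heads.\<close>

lemma odometer:
  assumes B: "2 \<le> B" and n: "2 \<le> n" and r: "1 \<le> r"
  shows "(\<forall>i. 1 \<le> i \<longrightarrow> i < n \<longrightarrow>
           column B n (n * r + i) = ((r - i - 1) div B ^ (i - 1)) mod B \<and>
           head B n (n * r + i) = (if i + 1 \<le> r \<and> B ^ (i - 1) dvd r - i then 1 else 0)) \<and>
         column B n (n * r) = (if r = 1 then 0 else B) \<and> (r = 1 \<longrightarrow> head B n (n * r) = 2)"
  using r
proof (induction r rule: dec_induct)
  case base
  have c: "column B n (n + i) = 0" if "i < n" for i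
    using column_step[of n B i] that
    by (cases "meet B n i") (use column_start[OF that, of B] in \<open>simp add: add.commute\<close>)
  have h: "head B n (n + Suc i) = 0" if "i < n" for i
    using head_step[of n B i] that
    by (cases "meet B n i") (use column_start[OF that, of B] in \<open>simp add: add.commute\<close>)
  have "head B n (n + i) = 0" if "1 \<le> i" "i < n" for i
    using h[of "i - 1"] that by simp
  then show ?case
    using n head_start[of n n B] c c[of 0] by auto
next
  case (step r)
  define a where "a = (\<lambda>i. column B n (n * r + i))"
  define h where "h = (\<lambda>i. head B n (n * r + i))"
  have m: "meet B n (n * r + i) = (a i, h i)" for i
    by (simp add: a_def h_def)
  have a': "column B n (n * Suc r + i) = fst (odo B (a i, h i))" for i
    using column_step[of n B "n * r + i"] n m by (simp add: algebra_simps)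
  have h': "head B n (n * Suc r + Suc i) = snd (odo B (a i, h i))" for i
    using head_step[of n B "n * r + i"] n m by (simp add: algebra_simps)
  have a0: "a 0 = (if r = 1 then 0 else B)" and h0: "r = 1 \<Longrightarrow> h 0 = 2"
    using step.IH by (auto simp: a_def h_def)
  have ai: "a i = ((r - i - 1) div B ^ (i - 1)) mod B"
    and hi: "h i = (if i + 1 \<le> r \<and> B ^ (i - 1) dvd r - i then 1 else 0)" if "1 \<le> i" "i < n" for i
    using step.IH that by (auto simp: a_def h_def)
  have zero: "odo B (a 0, h 0) = (B, 1)"
    using a0 h0 B by (cases "r = 1") auto
  have col: "odo B (a i, h i) = (((Suc r - i - 1) div B ^ (i - 1)) mod B,
      if i + 2 \<le> Suc r \<and> B ^ i dvd r - i then 1 else 0)" if i: "1 \<le> i" "i < n" for i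
  proof (cases "i + 1 \<le> r")
    case True
    define x where "x = r - i - 1"
    have x: "r - i = Suc x" "Suc r - i - 1 = Suc x" "r - i - 1 = x"
      using True by (auto simp: x_def)
    have Bi: "B ^ i = B ^ (i - 1) * B"
      using i by (cases i) auto
    have "a i < B"
      using ai[OF i] B by simp
    moreover have "h i \<noteq> 2"
      using hi[OF i] by simp
    ultimately have "odo B (a i, h i) =
        (if h i = 1 then if Suc (a i) = B then (0, 1) else (Suc (a i), 0) else (a i, 0))"
      by simp
    also have "\<dots> = ((Suc x div B ^ (i - 1)) mod B, if B ^ i dvd Suc x then 1 else 0)"
      using digit_Suc[of B "B ^ (i - 1)" x] B ai[OF i] hi[OF i] True unfolding x Bi by auto
    finally show ?thesis
      using True x by simp
  next
    case False
    then have "a i = 0" "h i = 0" "Suc r - i - 1 = 0"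
      using ai[OF i] hi[OF i] by auto
    then show ?thesis
      using B False by auto
  qed
  have heads: "head B n (n * Suc r + i) =
      (if i + 1 \<le> Suc r \<and> B ^ (i - 1) dvd Suc r - i then 1 else 0)" if i: "1 \<le> i" "i < n" for i
  proof (cases "i = 1")
    case True
    then show ?thesis
      using h'[of 0] zero step.hyps by simp
  next
    case False
    then obtain j where j: "i = Suc j" "1 \<le> j" "j < n"
      using i by (cases i) auto
    show ?thesis
      using h'[of j] col[OF j(2,3)] j by simp
  qed
  show ?case
    using heads col a' a'[of 0] zero step.hyps by auto
qed

lemma digits_zero_dvd:
  fixes B X :: nat
  assumes "\<And>j. j < k \<Longrightarrow> (X div B ^ j) mod B = 0"
  shows "B ^ k dvd X"
  using assms
proof (induction k)
  case (Suc k)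
  then have "B ^ k dvd X" "B dvd X div B ^ k"
    by (simp_all add: dvd_eq_mod_eq_0)
  then show ?case
    by (metis dvd_div_mult_self mult_dvd_mono dvd_refl power_Suc)
qed simp

lemma odometer_period:
  assumes B: "2 \<le> B" and n: "2 \<le> n" and pos: "0 < \<delta>"
    and per: "\<And>u. column B n (T + u) = column B n (T + \<delta> + u)"
  shows "B ^ (n - 1) \<le> \<delta>"
proof -
  have per': "column B n (t + \<delta>) = column B n t" if "T \<le> t" for t
    using per[of "t - T"] that by (simp add: algebra_simps)
  have big: "T \<le> n * r + i" if "T \<le> r" for r i
    using that n mult_le_mono[of 1 n T r] by simp
  define r where "r = T + 2"
  have "column B n (n * r + \<delta>) = B"
    using per'[of "n * r"] big[of r 0] odometer[OF B n, of r] by (simp add: r_def)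
  moreover have "column B n (n * (r + \<delta> div n) + \<delta> mod n) \<noteq> B" if "\<delta> mod n \<noteq> 0"
  proof -
    have "\<delta> mod n < n" "1 \<le> r + \<delta> div n"
      using n by (auto simp: r_def)
    then have "column B n (n * (r + \<delta> div n) + \<delta> mod n) < B"
      using odometer[OF B n, of "r + \<delta> div n"] that B by simp
    then show ?thesis
      by simp
  qed
  moreover have "n * r + \<delta> = n * (r + \<delta> div n) + \<delta> mod n"
    by (simp add: algebra_simps)
  ultimately have "\<delta> mod n = 0"
    by metis
  then obtain e where e: "\<delta> = n * e"
    by (metis dvd_def dvd_eq_mod_eq_0)
  define X where "X = T * B ^ (n - 1)"
  have XT: "T \<le> X"
    using B by (simp add: X_def)
  have dX: "B ^ (n - 1) dvd X"
    by (simp add: X_def)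
  have "((X + e) div B ^ j) mod B = 0" if j: "j < n - 1" for j
  proof -
    let ?r = "X + j + 2"
    have j': "1 \<le> Suc j" "Suc j < n"
      using j by auto
    have dig: "column B n (n * k + Suc j) = ((k - Suc j - 1) div B ^ j) mod B" if "1 \<le> k" for k
      using odometer[OF B n that] j' by (metis diff_Suc_1)
    have "((X + e) div B ^ j) mod B = column B n (n * (?r + e) + Suc j)"
      by (subst dig) simp_all
    also have "\<dots> = column B n (n * ?r + Suc j)"
      using per'[OF big[of ?r "Suc j"]] XT e by (simp add: algebra_simps)
    also have "\<dots> = (X div B ^ j) mod B"
      by (subst dig) simp_all
    also have "\<dots> = 0"
    proof -
      have "B ^ Suc j dvd X"
        using dX by (rule dvd_trans[rotated]) (rule le_imp_power_dvd, use j in simp)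
      then have "B * B ^ j dvd X"
        by simp
      then have "B dvd X div B ^ j"
        using B by (metis dvd_div_iff_mult dvd_mult_right power_not_zero not_numeral_le_zero)
      then show ?thesis
        by (simp add: dvd_eq_mod_eq_0)
    qed
    finally show ?thesis .
  qed
  then have "B ^ (n - 1) dvd X + e"
    by (rule digits_zero_dvd)
  then have "B ^ (n - 1) dvd e"
    using dX dvd_add_right_iff by blast
  moreover have "0 < e"
    using pos e by (cases e) auto
  ultimately have "B ^ (n - 1) \<le> e"
    by (rule dvd_imp_le)
  also have "e \<le> \<delta>"
    using e n by simp
  finally show ?thesis .
qed

section \<open>Running the machine\<close>

context design
begin

text \<open>The initial states from which the timer works, with \<open>x v = b\<close> read as "rail \<open>b\<close> is on at
  \<open>v\<close>".  The tree evaluates to off on its initial leaves and to on after the first step of the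
  latches; and each stretch of the line that is about to arrive contains an off bit.\<close>

definition good :: "nat \<Rightarrow> (vert \<Rightarrow> bool) \<Rightarrow> bool" where
  "good \<kappa> x \<longleftrightarrow> (\<forall>b.
     \<not> tree_value d [] (\<lambda>p. x (Tree b p) = b) \<and>
     tree_value d [] (\<lambda>p. x (Tree b p) = b \<or> x (Aux b p) = b) \<and>
     (\<forall>t. \<kappa> \<le> t \<longrightarrow> 2 * t < L - 1 + 2 * d \<longrightarrow>
        (\<exists>i. 2 \<le> i \<and> i + t \<le> L \<and> L \<le> i + 2 * t \<and> x (Line b i) \<noteq> b)))"

end

lemma tree_value_mono:
  assumes "\<And>p. length p = length q + k \<Longrightarrow> x p \<Longrightarrow> y p" "tree_value k q x"
  shows "tree_value k q y"
  using assms
proof (induction k arbitrary: q)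
  case (Suc k)
  have "tree_value k (c # q) y" if "tree_value k (c # q) x" for c
    by (rule Suc.IH[OF _ that]) (use Suc.prems(1) in simp)
  then show ?case
    using Suc.prems(2) by (auto simp: gate_def split: if_splits)
qed simp

locale machine = design +
  fixes X :: "nat \<Rightarrow> vert \<Rightarrow> bool" and inp :: "vert \<Rightarrow> bool \<Rightarrow> vert"
  assumes step: "vin v \<Longrightarrow> X (Suc t) v = gate (op v) (X t (inp v False)) (X t (inp v True))"
    and known: "vin v \<Longrightarrow> src v c = Some (u, e) \<Longrightarrow> inp v c = u"
begin

lemma inp_src: "vin v \<Longrightarrow> src v c = Some y \<Longrightarrow> inp v c = fst y"
  using known[of v c "fst y" "snd y"] by simp

lemma step_known:
  "vin v \<Longrightarrow> src v False = Some (u, e) \<Longrightarrow> src v True = Some (u', e') \<Longrightarrow>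
     X (Suc t) v = gate (op v) (X t u) (X t u')"
  using step known by simp

lemma step_Ring:
  "p < P \<Longrightarrow> Suc i \<le> len p \<Longrightarrow>
     X (Suc t) (Ring p sd (Suc i)) = gate sd (X t (cell p False i)) (X t (cell p True i))"
  by (subst step_known) auto

lemma ring_shift:
  assumes "p < P" "a + Suc i \<le> len p"
  shows "X (t + Suc i) (Ring p sd (a + Suc i)) = gate sd (X t (cell p False a)) (X t (cell p True a))"
  using assms(2)
proof (induction i arbitrary: sd)
  case 0
  then show ?case
    using step_Ring[OF assms(1), of a t sd] by simp
next
  case (Suc i)
  have "X (t + Suc (Suc i)) (Ring p sd (a + Suc (Suc i))) =
      gate sd (X (t + Suc i) (Ring p False (a + Suc i))) (X (t + Suc i) (Ring p True (a + Suc i)))"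
    using step_Ring[OF assms(1), of "a + Suc i" "t + Suc i" sd] Suc.prems by (simp add: cell_def)
  then show ?case
    using Suc.IH Suc.prems by (auto simp: gate_def)
qed

subsection \<open>The start timer\<close>

lemma step_Line:
  "2 \<le> i \<Longrightarrow> i \<le> L \<Longrightarrow> (X (Suc t) (Line b i) = b) \<longleftrightarrow>
     (X t (stage b (i - 1)) = b) \<and> (X t (stage b (i - 2)) = b)"
  by (subst step_known) (auto simp: gate_def)

lemma step_Tree:
  "length q < d \<Longrightarrow> (X (Suc t) (Tree b q) = b) \<longleftrightarrow>
     gate (even (length q)) (X t (Tree b (False # q)) = b) (X t (Tree b (True # q)) = b)"
  by (subst step_known) (auto simp: gate_def)

lemma step_leaf:
  "length q = d \<Longrightarrow> (X (Suc t) (Tree b q) = b) \<longleftrightarrow> X t (Tree b q) = b \<or> X t (Aux b q) = b"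
  by (subst step_known) (auto simp: gate_def is_leaf_def)

lemma tree_run:
  "length q + k = d \<Longrightarrow>
     (X (t + k) (Tree b q) = b) \<longleftrightarrow> tree_value k q (\<lambda>p. X t (Tree b p) = b)"
proof (induction k arbitrary: q)
  case (Suc k)
  then show ?case
    using step_Tree[of q "t + k" b] Suc.IH[of "False # q"] Suc.IH[of "True # q"] by simp
qed simp

context
  fixes \<kappa> :: nat
  assumes good: "good \<kappa> (X 0)"
begin

lemma root_off: "X d (Tree b []) \<noteq> b"
  using good tree_run[of "[]" d 0 b] unfolding good_def by simp

lemma leaf_on:
  "length p = d \<Longrightarrow> X 0 (Tree b p) = b \<or> X 0 (Aux b p) = b \<Longrightarrow> X (Suc t) (Tree b p) = b"
  by (induction t) (simp_all add: step_leaf)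

lemma root_on:
  assumes "d < t" shows "X t (Tree b []) = b"
proof -
  define u where "u = t - Suc d"
  have t: "t = Suc u + d"
    using assms by (simp add: u_def)
  have "tree_value d [] (\<lambda>p. X (Suc u) (Tree b p) = b)"
    by (rule tree_value_mono[where x = "\<lambda>p. X 0 (Tree b p) = b \<or> X 0 (Aux b p) = b"])
       (use leaf_on good in \<open>simp_all add: good_def\<close>)
  then show ?thesis
    unfolding t using tree_run[of "[]" d "Suc u" b] by simp
qed

lemma root_child_on:
  assumes "d \<le> t" shows "X t (Tree b [c]) = b"
proof -
  have "gate True (X t (Tree b [False]) = b) (X t (Tree b [True]) = b)"
    using step_Tree[of "[]" t b] root_on[of "Suc t" b] assms by simp
  then show ?thesis
    by (cases c) (simp_all add: gate_def)
qed

lemma stage_on: "i \<le> L \<Longrightarrow> d + i \<le> t \<Longrightarrow> X t (stage b i) = b"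
proof (induction i arbitrary: t rule: less_induct)
  case (less i)
  consider "i = 0" | "i = 1" | "2 \<le> i"
    by linarith
  then show ?case
  proof cases
    case 3
    have "X (t - 1) (stage b (i - 1)) = b" "X (t - 1) (stage b (i - 2)) = b"
      by (rule less.IH; use less.prems 3 in simp)+
    then show ?thesis
      using step_Line[of i "t - 1" b] 3 less.prems by (simp add: stage_def)
  qed (use less.prems root_child_on root_on in \<open>simp_all add: stage_def\<close>)
qed

text \<open>Each stage takes the conjunction of the two stages before it, so an off bit travels between one and
  two stages per step and blocks everything in between.\<close>

lemma stage_off:
  assumes "X t (stage b i) \<noteq> b"
  shows "i + u \<le> j \<Longrightarrow> j \<le> i + 2 * u \<Longrightarrow> j \<le> L \<Longrightarrow> 0 < i \<or> u = 0 \<Longrightarrow> X (t + u) (stage b j) \<noteq> b"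
proof (induction u arbitrary: j)
  case 0
  then show ?case
    using assms by simp
next
  case (Suc u)
  have j: "2 \<le> j"
    using Suc.prems by simp
  have "X (t + u) (stage b (j - 1)) \<noteq> b \<or> X (t + u) (stage b (j - 2)) \<noteq> b"
  proof (cases "j - 1 \<le> i + 2 * u")
    case True
    then have "X (t + u) (stage b (j - 1)) \<noteq> b"
      using Suc.prems by (intro Suc.IH) auto
    then show ?thesis ..
  next
    case False
    then have "X (t + u) (stage b (j - 2)) \<noteq> b"
      using Suc.prems by (intro Suc.IH) auto
    then show ?thesis ..
  qed
  then show ?case
    using step_Line[of j "t + u" b] j Suc.prems by (auto simp: stage_def)
qed

text \<open>The rails switch together and exactly once.  Before the zero of the root at time \<open>d\<close> has
  spread over the window that arrives, off bits of the initial content of the line do the same.\<close>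

lemma control:
  assumes "\<kappa> \<le> t"
  shows "X t (input (P, b)) = (b \<longleftrightarrow> d + L \<le> t)"
proof -
  have in_stage: "input (P, b) = stage b L"
    using L_ge by (simp add: input_def stage_def)
  show ?thesis
  proof (cases "d + L \<le> t")
    case True
    then show ?thesis
      using stage_on[of L t b] in_stage by simp
  next
    case False
    have "X t (stage b L) \<noteq> b"
    proof (cases "2 * t < L - 1 + 2 * d")
      case True
      then obtain i where i: "2 \<le> i" "i + t \<le> L" "L \<le> i + 2 * t" "X 0 (Line b i) \<noteq> b"
        using good assms unfolding good_def by blast
      then have "X 0 (stage b i) \<noteq> b"
        by (simp add: stage_def)
      from stage_off[OF this, of t L] i show ?thesis
        by simp
    next
      case late: False
      have "X d (stage b 1) \<noteq> b"
        using root_off by (simp add: stage_def)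
      moreover have "1 + (t - d) \<le> L" "L \<le> 1 + 2 * (t - d)" "d + (t - d) = t"
        using late False L_ge by auto
      ultimately show ?thesis
        using stage_off[of d b 1 "t - d" L] by simp
    qed
    then show ?thesis
      using in_stage False by auto
  qed
qed

subsection \<open>The gadget\<close>

text \<open>The constants come from a timer tree: a chain of disjunctions fed by a signal that is
  permanently on from time \<open>d\<close>.\<close>

lemma src_on: "k < F \<Longrightarrow> d + Suc k \<le> t \<Longrightarrow> X t (Src k)"
proof (induction k arbitrary: t)
  case 0
  have "X (t - 1) (Tree True [False]) = True"
    by (rule root_child_on) (use 0 in simp)
  moreover have "inp (Src 0) False = Tree True [False]"
    using known[of "Src 0" False] 0 by simp
  ultimately show ?case
    using step[of "Src 0" "t - 1"] 0 by (simp add: gate_def)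
next
  case (Suc k)
  have "X (t - 1) (Src k)"
    by (rule Suc.IH) (use Suc.prems in auto)
  moreover have "inp (Src (Suc k)) False = Src k"
    using inp_src[of "Src (Suc k)" False] Suc.prems by simp
  ultimately show ?case
    using step[of "Src (Suc k)" "t - 1"] Suc.prems by (simp add: gate_def)
qed

lemma copy_step:
  assumes "fst i \<le> P" "length q \<le> r" "d + F \<le> t"
  shows "X (Suc t) (Copy i q) = X t (if q = [] then input i else Copy i (tl q))"
proof -
  have "num i q < F"
    using num_less assms by simp
  then have "X t (Src (num i q))"
    using src_on assms(3) by simp
  moreover have "inp (Copy i q) True = Src (num i q)"
    using known[of "Copy i q" True] assms by simp
  moreover have "inp (Copy i q) False = (if q = [] then input i else Copy i (tl q))"
    using inp_src[of "Copy i q" False] assms by simp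
  ultimately show ?thesis
    using step[of "Copy i q" t] assms by (simp add: gate_def)
qed

lemma copy_run:
  "fst i \<le> P \<Longrightarrow> length q \<le> r \<Longrightarrow> d + F \<le> t \<Longrightarrow> X (t + Suc (length q)) (Copy i q) = X t (input i)"
proof (induction q)
  case Nil
  then show ?case
    using copy_step[of i "[]" t] by simp
next
  case (Cons c q)
  then show ?case
    using copy_step[of i "c # q" "t + Suc (length q)"] by simp
qed

lemma formula_run:
  assumes j: "fst j < P" and t: "d + F \<le> t"
  shows "length q + Suc k = D \<Longrightarrow> X (t + Suc r + Suc k) (Form j q) =
     formula_value (fop j) (lab j) (Suc k) q (\<lambda>i. X t (input i))"
proof (induction k arbitrary: q)
  case 0
  have "X (t + Suc r) (Copy (lab j (c # q)) (code j (c # q))) = X t (input (lab j (c # q)))" for c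
    using copy_run[of "lab j (c # q)" "code j (c # q)" t] lab_le[OF j] code_length[OF j, of "c # q"]
      0 t by simp
  moreover have "X (Suc (t + Suc r)) (Form j q) =
      gate (fop j q) (X (t + Suc r) (Copy (lab j (False # q)) (code j (False # q))))
        (X (t + Suc r) (Copy (lab j (True # q)) (code j (True # q))))"
    using 0 j by (subst step_known) auto
  ultimately show ?case
    by simp
next
  case (Suc k)
  have "X (Suc (t + Suc r + Suc k)) (Form j q) =
      gate (fop j q) (X (t + Suc r + Suc k) (Form j (False # q)))
        (X (t + Suc r + Suc k) (Form j (True # q)))"
    using Suc.prems j by (subst step_known) auto
  moreover have "X (t + Suc r + Suc k) (Form j (c # q)) =
      formula_value (fop j) (lab j) (Suc k) (c # q) (\<lambda>i. X t (input i))" for c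
    using Suc.prems by (intro Suc.IH) simp
  ultimately show ?case
    by simp
qed

text \<open>One turn of track \<open>p\<close> takes \<open>r + 1\<close> steps in the copy trees, \<open>D\<close> steps in the formulas, and
  \<open>len p\<close> steps in the delay line, which sorts the pair.\<close>

lemma loop:
  assumes p: "p < P" and t: "d + F \<le> t"
  defines "out \<equiv> \<lambda>sd. formula_value (fop (p, sd)) (lab (p, sd)) D [] (\<lambda>i. X t (input i))"
  shows "X (t + (Suc r + D + len p)) (input (p, sd)) = gate sd (out False) (out True)"
proof -
  obtain k where D: "D = Suc k"
    using D_pos by (cases D) auto
  obtain l where l: "len p = Suc l"
    using len_pos[OF p] by (cases "len p") auto
  have "X (t + Suc r + D) (cell p c 0) = out c" for c
    using formula_run[of "(p, c)" t "[]" k] p t by (simp add: cell_def out_def D)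
  then show ?thesis
    using ring_shift[OF p, of 0 l "t + Suc r + D" sd] l p by (simp add: input_def add.assoc)
qed

end

lemma input_sorted:
  assumes p: "p < P" and t: "0 < t" and on: "X t (input (p, True))"
  shows "X t (input (p, False))"
proof -
  obtain l where l: "len p = Suc l"
    using len_pos[OF p] by (cases "len p") auto
  have "X (Suc (t - 1)) (Ring p sd (Suc l)) =
      gate sd (X (t - 1) (cell p False l)) (X (t - 1) (cell p True l))" for sd
    by (rule step_Ring) (use p l in simp_all)
  then show ?thesis
    using on p t l by (simp add: input_def gate_def)
qed

lemma input_initial:
  assumes p: "p < P" and t: "0 < t" "t \<le> len p"
  shows "X t (input (p, sd)) =
     gate sd (X 0 (cell p False (len p - t))) (X 0 (cell p True (len p - t)))"
  using ring_shift[OF p, of "len p - t" "t - 1" 0 sd] p t by (simp add: input_def)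

lemma agree_forever:
  assumes closed: "\<And>v c. vin v \<Longrightarrow> vin (inp v c)" and "\<And>v. vin v \<Longrightarrow> X t v = X t' v"
  shows "vin v \<Longrightarrow> X (t + u) v = X (t' + u) v"
  by (induction u arbitrary: v) (simp_all add: assms step)

lemma input_in: "fst i \<le> P \<Longrightarrow> vin (input i)"
  using len_pos L_ge by (simp add: input_def)

end

declare odo.simps [simp del]

section \<open>Programming the gadget\<close>

text \<open>Words of constant weight over the digits \<open>0, 1, 2\<close> form an antichain, and by the pigeonhole
  principle some weight class contains a share \<open>1 / (2 w + 1)\<close> of all \<open>3\<^sup>w\<close> words.  A digit is written
  as the pair (at least 1, equal to 2).\<close>

lemma antichain_code:
  "\<exists>M (enc :: nat \<Rightarrow> nat \<Rightarrow> bool \<Rightarrow> bool). 3 ^ w \<le> (2 * w + 1) * M \<and>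
     (\<forall>a p. enc a p True \<longrightarrow> enc a p False) \<and>
     (\<forall>a<M. \<forall>a'<M. (\<forall>p<w. \<forall>sd. enc a p sd \<longrightarrow> enc a' p sd) \<longrightarrow> a = a')"
proof -
  define \<Omega> where "\<Omega> = ({..<w} \<rightarrow>\<^sub>E {..2 :: nat})"
  define cls where "cls = (\<lambda>k. {f \<in> \<Omega>. (\<Sum>p<w. f p) = k})"
  have fin: "finite \<Omega>"
    by (simp add: \<Omega>_def finite_PiE)
  have card\<Omega>: "card \<Omega> = 3 ^ w"
    by (simp add: \<Omega>_def card_PiE numeral_3_eq_3)
  have "(\<Sum>p<w. f p) \<le> 2 * w" if "f \<in> \<Omega>" for f
    using sum_bounded_above[of "{..<w}" f 2] that by (auto simp: \<Omega>_def PiE_def Pi_def)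
  then have "\<Omega> \<subseteq> (\<Union>k\<in>{..2 * w}. cls k)"
    by (auto simp: cls_def)
  then have "card \<Omega> \<le> card (\<Union>k\<in>{..2 * w}. cls k)"
    using fin by (intro card_mono) (auto simp: cls_def)
  also have "\<dots> \<le> (\<Sum>k\<le>2 * w. card (cls k))"
    by (rule card_UN_le) simp
  finally have le: "3 ^ w \<le> (\<Sum>k\<le>2 * w. card (cls k))"
    by (simp add: card\<Omega>)
  have "\<exists>k. 3 ^ w \<le> (2 * w + 1) * card (cls k)"
  proof (rule ccontr)
    assume "\<nexists>k. 3 ^ w \<le> (2 * w + 1) * card (cls k)"
    then have lt: "(2 * w + 1) * card (cls k) < 3 ^ w" for k
      by (simp add: not_le)
    have "(2 * w + 1) * (\<Sum>k\<le>2 * w. card (cls k)) = (\<Sum>k\<le>2 * w. (2 * w + 1) * card (cls k))"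
      by (rule sum_distrib_left)
    also have "\<dots> < (\<Sum>k\<le>2 * w. 3 ^ w)"
      by (rule sum_strict_mono) (use lt in auto)
    also have "\<dots> = (2 * w + 1) * 3 ^ w"
      by simp
    finally show False
      using mult_le_mono2[OF le, of "2 * w + 1"] by linarith
  qed
  then obtain k where k: "3 ^ w \<le> (2 * w + 1) * card (cls k)"
    by blast
  have "finite (cls k)"
    using fin by (simp add: cls_def)
  then obtain word where word: "bij_betw word {..<card (cls k)} (cls k)"
    using ex_bij_betw_nat_finite lessThan_atLeast0 by metis
  define enc where "enc = (\<lambda>a p sd. if sd then word a p = 2 else 1 \<le> word a p)"
  have "a = a'"
    if a: "a < card (cls k)" "a' < card (cls k)" and le: "\<forall>p<w. \<forall>sd. enc a p sd \<longrightarrow> enc a' p sd"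
    for a a'
  proof -
    have cl: "word a \<in> cls k" "word a' \<in> cls k"
      using word a by (auto simp: bij_betw_def)
    have pw: "word a p \<le> word a' p" if "p < w" for p
    proof -
      have "word a p \<le> 2"
        using cl(1) that by (auto simp: cls_def \<Omega>_def PiE_def Pi_def)
      moreover have "enc a p True \<longrightarrow> enc a' p True" "enc a p False \<longrightarrow> enc a' p False"
        using le that by blast+
      ultimately show ?thesis
        by (auto simp: enc_def split: if_splits)
    qed
    have "word a p = word a' p" if "p < w" for p
    proof (rule ccontr)
      assume "word a p \<noteq> word a' p"
      then have "word a p < word a' p"
        using pw[OF that] by simp
      then have "(\<Sum>p<w. word a p) < (\<Sum>p<w. word a' p)"
        using pw that by (intro sum_strict_mono_ex1) auto
      then show False
        using cl by (simp add: cls_def)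
    qed
    then have "word a = word a'"
      using cl by (intro PiE_ext[of _ "{..<w}" "\<lambda>_. {..2}"]) (auto simp: cls_def \<Omega>_def)
    then show "a = a'"
      using word a by (auto simp: bij_betw_def inj_on_def)
  qed
  moreover have "\<forall>a p. enc a p True \<longrightarrow> enc a p False"
    by (simp add: enc_def)
  ultimately show ?thesis
    using k by blast
qed

text \<open>The three head symbols are the words 02, 11 and 20.\<close>

definition henc :: "nat \<Rightarrow> nat \<Rightarrow> bool \<Rightarrow> bool" where
  "henc h p sd = (let v = if p = 0 then h else 2 - h in if sd then v = 2 else 1 \<le> v)"

lemma henc_sorted: "henc h p True \<Longrightarrow> henc h p False"
  by (auto simp: henc_def Let_def split: if_splits)

lemma henc_antichain:
  assumes "h \<le> 2" "h' \<le> 2" "\<And>p sd. p < 2 \<Longrightarrow> henc h p sd \<Longrightarrow> henc h' p sd"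
  shows "h = h'"
proof -
  have "h = 0 \<or> h = 1 \<or> h = 2" "h' = 0 \<or> h' = 1 \<or> h' = 2"
    using assms(1,2) by auto
  then show ?thesis
    using assms(3)[of 0 True] assms(3)[of 0 False] assms(3)[of 1 True] assms(3)[of 1 False]
    by (auto simp: henc_def Let_def)
qed

definition weight :: "nat \<Rightarrow> (nat \<times> bool \<Rightarrow> bool) \<Rightarrow> nat" where
  "weight w x = card {i. fst i < w \<and> x i}"

lemma finite_weight: "finite {i :: nat \<times> bool. fst i < w \<and> x i}"
  by (rule finite_subset[of _ "{..<w} \<times> UNIV"]) auto

lemma weight_sum: "weight w x = (\<Sum>p<w. of_bool (x (p, True)) + of_bool (x (p, False)))"
proof -
  have "weight w x = (\<Sum>i\<in>{..<w} \<times> UNIV. of_bool (x i))"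
  proof -
    have "{i. fst i < w \<and> x i} = ({..<w} \<times> UNIV) \<inter> {i. x i}"
      by (simp add: set_eq_iff)
    then show ?thesis
      by (simp add: weight_def sum_of_bool_eq)
  qed
  also have "\<dots> = (\<Sum>p<w. \<Sum>sd\<in>UNIV. of_bool (x (p, sd)))"
    by (simp only: sum.cartesian_product case_prod_beta' prod.collapse)
  finally show ?thesis
    by (simp only: UNIV_bool) (simp add: add.commute del: sum_of_bool_eq)
qed

text \<open>Before the start, the gadget blanks the column, freshens the head, and records in the store which
  of the \<open>2 q\<close> thresholds around the mean \<open>w\<close> the weight of the old column reaches.  Consecutive
  thresholds share a pair, which is therefore sorted and survives the delay line.\<close>

definition init_out :: "nat \<Rightarrow> nat \<Rightarrow> nat \<Rightarrow> (nat \<Rightarrow> nat \<Rightarrow> bool \<Rightarrow> bool) \<Rightarrow> nat \<times> bool \<Rightarrow>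
    (nat \<times> bool \<Rightarrow> bool) \<Rightarrow> bool" where
  "init_out w q B enc = (\<lambda>(p, sd) x.
     if p < w then enc (B + 1) p sd
     else if p < w + q then w - q + 1 + 2 * (p - w) + of_bool sd \<le> weight w x
     else henc 2 (p - (w + q)) sd)"

text \<open>Reading asks for at least the bits of a symbol, which is monotone; on valid symbols it
  identifies them, since they form an antichain.\<close>

definition reads :: "nat \<Rightarrow> nat \<Rightarrow> (nat \<Rightarrow> nat \<Rightarrow> bool \<Rightarrow> bool) \<Rightarrow> (nat \<times> bool \<Rightarrow> bool) \<Rightarrow> nat \<Rightarrow> nat \<Rightarrow> bool"
where
  "reads w q enc x a h \<longleftrightarrow> (\<forall>p<w. \<forall>sd. enc a p sd \<longrightarrow> x (p, sd)) \<and>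
     (\<forall>p<2. \<forall>sd. henc h p sd \<longrightarrow> x (w + q + p, sd))"

definition run_out :: "nat \<Rightarrow> nat \<Rightarrow> nat \<Rightarrow> (nat \<Rightarrow> nat \<Rightarrow> bool \<Rightarrow> bool) \<Rightarrow> nat \<times> bool \<Rightarrow>
    (nat \<times> bool \<Rightarrow> bool) \<Rightarrow> bool" where
  "run_out w q B enc = (\<lambda>(p, sd) x.
     if p < w then \<exists>a\<le>B + 1. \<exists>h\<le>2. reads w q enc x a h \<and> enc (fst (odo B (a, h))) p sd
     else if p < w + q then x (p, sd)
     else \<exists>a\<le>B + 1. \<exists>h\<le>2. reads w q enc x a h \<and> henc (snd (odo B (a, h))) (p - (w + q)) sd)"

text \<open>The gadget is made false and true at the two extreme assignments so that it has a formula; these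
  do not occur once the control rails are complementary.\<close>

definition gadget :: "nat \<Rightarrow> nat \<Rightarrow> nat \<Rightarrow> (nat \<Rightarrow> nat \<Rightarrow> bool \<Rightarrow> bool) \<Rightarrow> nat \<times> bool \<Rightarrow>
    (nat \<times> bool \<Rightarrow> bool) \<Rightarrow> bool" where
  "gadget w q B enc j x \<longleftrightarrow>
     ((x (w + q + 2, False) \<and> init_out w q B enc j x) \<or> (x (w + q + 2, True) \<and> run_out w q B enc j x) \<or>
      (\<forall>i. fst i \<le> w + q + 2 \<longrightarrow> x i)) \<and> (\<exists>i. fst i \<le> w + q + 2 \<and> x i)"

lemma weight_mono: "(\<And>i. fst i < w \<Longrightarrow> x i \<Longrightarrow> y i) \<Longrightarrow> weight w x \<le> weight w y"
  unfolding weight_def by (rule card_mono[OF finite_weight]) auto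

lemma weight_cong: "(\<And>i. fst i < w \<Longrightarrow> x i = y i) \<Longrightarrow> weight w x = weight w y"
  by (rule antisym; rule weight_mono; simp)

lemma reads_mono:
  assumes "\<And>i. fst i \<le> w + q + 2 \<Longrightarrow> x i \<Longrightarrow> y i" "reads w q enc x a h"
  shows "reads w q enc y a h"
  using assms unfolding reads_def by simp

lemma gadget_mono:
  assumes j: "fst j < w + q + 2" and le: "\<And>i. fst i \<le> w + q + 2 \<Longrightarrow> x i \<Longrightarrow> y i"
    and x: "gadget w q B enc j x"
  shows "gadget w q B enc j y"
proof -
  obtain p sd where ps: "j = (p, sd)"
    by (cases j)
  have "weight w x \<le> weight w y"
    by (rule weight_mono) (use le in simp)
  then have "init_out w q B enc j x \<Longrightarrow> init_out w q B enc j y"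
    by (auto simp: init_out_def ps split: if_splits)
  moreover have "run_out w q B enc j y" if "run_out w q B enc j x"
  proof -
    have store: "x (p, sd) \<Longrightarrow> y (p, sd)"
      using le[of j] j ps by simp
    have "reads w q enc x a h \<Longrightarrow> reads w q enc y a h" for a h
      by (rule reads_mono[OF le])
    then have symbols: "\<exists>a\<le>B + 1. \<exists>h\<le>2. reads w q enc x a h \<and> Q a h \<Longrightarrow>
        \<exists>a\<le>B + 1. \<exists>h\<le>2. reads w q enc y a h \<and> Q a h" for Q
      by (elim exE conjE, intro exI conjI)
    show ?thesis
      using that unfolding run_out_def ps prod.case
      by (cases "p < w"; cases "p < w + q") (simp_all only: if_True if_False symbols store)
  qed
  moreover have "x (w + q + 2, b) \<Longrightarrow> y (w + q + 2, b)" for b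
    using le by simp
  moreover have "\<exists>i. fst i \<le> w + q + 2 \<and> x i" "\<And>i. fst i \<le> w + q + 2 \<Longrightarrow> x i \<Longrightarrow> y i"
    using x le unfolding gadget_def by simp_all
  ultimately show ?thesis
    using x unfolding gadget_def by blast
qed

lemma gadget_formulas:
  "\<exists>D op lab. 0 < D \<and>
     (\<forall>j. fst j < w + q + 2 \<longrightarrow> (\<forall>p. fst (lab j p) \<le> w + q + 2) \<and>
        (\<forall>x. formula_value (op j) (lab j) D [] x = gadget w q B enc j x))"
proof -
  define I where "I = {i :: nat \<times> bool. fst i \<le> w + q + 2}"
  define J where "J = {j :: nat \<times> bool. fst j < w + q + 2}"
  have I: "finite I"
    unfolding I_def by (rule finite_subset[of _ "{..w + q + 2} \<times> UNIV"]) auto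
  have "finite J"
    by (rule finite_subset[OF _ I]) (auto simp: I_def J_def)
  with I have "\<exists>k op lab. 0 < k \<and> (\<forall>j\<in>J. \<forall>p. lab j p \<in> I) \<and>
      (\<forall>j\<in>J. \<forall>x. formula_value (op j) (lab j) k [] x = gadget w q B enc j x)"
  proof (rule monotone_formulas)
    show "gadget w q B enc j y"
      if "j \<in> J" "\<And>i. i \<in> I \<Longrightarrow> x i \<Longrightarrow> y i" "gadget w q B enc j x" for j x y
      by (rule gadget_mono[OF _ _ that(3)]) (use that(1,2) in \<open>auto simp: I_def J_def\<close>)
    show "\<not> gadget w q B enc j (\<lambda>_. False)" "gadget w q B enc j (\<lambda>_. True)" for j
      by (auto simp: gadget_def intro: exI[of _ 0])
  qed
  then obtain k op lab where "0 < k" "\<forall>j\<in>J. \<forall>p. lab j p \<in> I"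
      "\<forall>j\<in>J. \<forall>x. formula_value (op j) (lab j) k [] x = gadget w q B enc j x"
    by blast
  then show ?thesis
    by (intro exI[of _ k] exI[of _ op] exI[of _ lab]) (simp add: I_def J_def)
qed

text \<open>The tracks \<open>p < w\<close> are the tape, the next \<open>q\<close> are the store, and the last two carry the heads.
  Tape and store have turns of length \<open>n\<close> and the heads of length \<open>n + 1\<close>, as the odometer requires.
  Time \<open>\<kappa>\<close> is late enough for the constants and the rails to be reliable, and the rails switch at time
  \<open>\<kappa> + n + 1\<close>.\<close>

locale program = design P L r D d F m len fop lab code num
  for P L r D d F m len fop lab code num +
  fixes w q B n \<kappa> :: nat and enc :: "nat \<Rightarrow> nat \<Rightarrow> bool \<Rightarrow> bool"
  assumes P_eq: "P = w + q + 2" and q_le: "q \<le> w" and B_ge: "2 \<le> B" and n_ge: "2 \<le> n"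
    and enc_sorted: "enc a p True \<Longrightarrow> enc a p False"
    and enc_antichain: "a \<le> B + 1 \<Longrightarrow> a' \<le> B + 1 \<Longrightarrow>
        (\<And>p sd. p < w \<Longrightarrow> enc a p sd \<Longrightarrow> enc a' p sd) \<Longrightarrow> a = a'"
    and formulas: "fst j < P \<Longrightarrow> formula_value (fop j) (lab j) D [] x = gadget w q B enc j x"
    and len_eq: "p < P \<Longrightarrow> Suc r + D + len p = (if p < w + q then n else Suc n)"
    and start: "d + L = \<kappa> + n + 1" and \<kappa>_ge: "d + F \<le> \<kappa>" "2 * d \<le> \<kappa>"

locale odometer_machine = program P L r D d F m len fop lab code num w q B n \<kappa> enc +
    machine P L r D d F m len fop lab code num X inp
  for P L r D d F m len fop lab code num w q B n \<kappa> enc X inp +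
  assumes good: "good \<kappa> (X 0)"
begin

abbreviation view :: "nat \<Rightarrow> nat \<times> bool \<Rightarrow> bool" where
  "view t i \<equiv> X t (input i)"

lemma view_ctrl: "\<kappa> \<le> t \<Longrightarrow> view t (w + q + 2, b) \<longleftrightarrow> (b \<longleftrightarrow> \<kappa> + n + 1 \<le> t)"
  using control[OF good, of t b] P_eq start by simp

lemma view_sorted: "p < P \<Longrightarrow> 0 < t \<Longrightarrow> view t (p, True) \<Longrightarrow> view t (p, False)"
  by (rule input_sorted)

lemma \<kappa>_pos: "0 < \<kappa>"
  using \<kappa>_ge d_gt by linarith

lemma gadget_view:
  assumes "\<kappa> \<le> t"
  shows "gadget w q B enc j (view t) \<longleftrightarrow>
     (if \<kappa> + n + 1 \<le> t then run_out w q B enc j (view t) else init_out w q B enc j (view t))"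
proof -
  have "\<exists>b. view t (w + q + 2, b)" "\<exists>b. \<not> view t (w + q + 2, b)"
    using view_ctrl[OF assms] by auto
  then have "(\<exists>i. fst i \<le> w + q + 2 \<and> view t i) \<and> \<not> (\<forall>i. fst i \<le> w + q + 2 \<longrightarrow> view t i)"
    by (metis fst_conv order_refl)
  then show ?thesis
    unfolding gadget_def using view_ctrl[OF assms] by auto
qed

lemma init_sorted: "init_out w q B enc (p, True) x \<Longrightarrow> init_out w q B enc (p, False) x"
  using enc_sorted henc_sorted by (auto simp: init_out_def split: if_splits)

lemma run_sorted:
  assumes "p < P" "0 < t" "run_out w q B enc (p, True) (view t)"
  shows "run_out w q B enc (p, False) (view t)"
proof -
  consider "p < w" | "w \<le> p" "p < w + q" | "w + q \<le> p"
    by linarith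
  then show ?thesis
  proof cases
    case 2
    then show ?thesis
      using assms view_sorted[OF assms(1,2)] by (simp add: run_out_def)
  next
    case 1
    then show ?thesis
      using assms(3) enc_sorted unfolding run_out_def by auto
  next
    case 3
    then show ?thesis
      using assms(3) henc_sorted unfolding run_out_def by auto
  qed
qed

lemma turn:
  assumes p: "p < P" and t: "\<kappa> \<le> t"
  shows "view (t + (if p < w + q then n else Suc n)) (p, sd) \<longleftrightarrow>
     (if \<kappa> + n + 1 \<le> t then run_out w q B enc (p, sd) (view t)
      else init_out w q B enc (p, sd) (view t))"
proof -
  have "view (t + (Suc r + D + len p)) (p, sd) =
      gate sd (gadget w q B enc (p, False) (view t)) (gadget w q B enc (p, True) (view t))"
    using loop[OF good p, of t sd] t \<kappa>_ge p by (simp add: formulas)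
  also have "\<dots> = gadget w q B enc (p, sd) (view t)"
    unfolding gadget_view[OF t]
    using init_sorted[of p "view t"] run_sorted[OF p, of t] t \<kappa>_pos
    by (cases sd) (auto simp: gate_def)
  finally show ?thesis
    unfolding len_eq[OF p] gadget_view[OF t] .
qed

definition shows_symbols :: "nat \<Rightarrow> nat \<Rightarrow> nat \<Rightarrow> bool" where
  "shows_symbols t a h \<longleftrightarrow> (\<forall>p<w. \<forall>sd. view t (p, sd) = enc a p sd) \<and>
     (\<forall>p<2. \<forall>sd. view t (w + q + p, sd) = henc h p sd)"

lemma reads_unique:
  assumes "shows_symbols t a h" "a \<le> B + 1" "h \<le> 2" "a' \<le> B + 1" "h' \<le> 2"
  shows "reads w q enc (view t) a' h' \<longleftrightarrow> a' = a \<and> h' = h"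
proof
  assume "reads w q enc (view t) a' h'"
  then have "\<And>p sd. p < w \<Longrightarrow> enc a' p sd \<Longrightarrow> enc a p sd"
    "\<And>p sd. p < 2 \<Longrightarrow> henc h' p sd \<Longrightarrow> henc h p sd"
    using assms(1) unfolding reads_def shows_symbols_def by simp_all
  then show "a' = a \<and> h' = h"
    using enc_antichain[OF assms(4,2)] henc_antichain[OF assms(5,3)] by blast
next
  assume "a' = a \<and> h' = h"
  then show "reads w q enc (view t) a' h'"
    using assms(1) unfolding reads_def shows_symbols_def by simp
qed

lemma run_out_symbols:
  assumes "shows_symbols t a h" "a \<le> B + 1" "h \<le> 2"
  shows "p < w \<Longrightarrow> run_out w q B enc (p, sd) (view t) \<longleftrightarrow> enc (fst (odo B (a, h))) p sd"
    and "p < 2 \<Longrightarrow> run_out w q B enc (w + q + p, sd) (view t) \<longleftrightarrow> henc (snd (odo B (a, h))) p sd"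
proof -
  have "(\<exists>a'\<le>B + 1. \<exists>h'\<le>2. reads w q enc (view t) a' h' \<and> Q a' h') \<longleftrightarrow> Q a h" for Q
    using reads_unique[OF assms] assms(2,3) by blast
  then show "p < w \<Longrightarrow> run_out w q B enc (p, sd) (view t) \<longleftrightarrow> enc (fst (odo B (a, h))) p sd"
    and "p < 2 \<Longrightarrow> run_out w q B enc (w + q + p, sd) (view t) \<longleftrightarrow> henc (snd (odo B (a, h))) p sd"
    unfolding run_out_def by simp_all
qed

text \<open>From the start on, the machine is the odometer.  The initialising phase lasts \<open>n + 1\<close> steps, long
  enough for every column and every head to pass the gadget.\<close>

lemma runs_odometer: "shows_symbols (\<kappa> + n + 1 + u) (column B n u) (head B n u)"
proof (induction u rule: less_induct)
  case (less u)
  have n0: "0 < n"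
    using n_ge by simp
  have "view (\<kappa> + n + 1 + u) (p, sd) = enc (column B n u) p sd" if p: "p < w" for p sd
  proof (cases "u < n")
    case True
    have "view (\<kappa> + 1 + u + n) (p, sd) = init_out w q B enc (p, sd) (view (\<kappa> + 1 + u))"
      using turn[of p "\<kappa> + 1 + u" sd] p True P_eq by simp
    then show ?thesis
      using p True by (simp add: init_out_def column_start ac_simps)
  next
    case False
    define v where "v = u - n"
    have u: "u = v + n"
      using False by (simp add: v_def)
    have IH: "shows_symbols (\<kappa> + n + 1 + v) (column B n v) (head B n v)"
      by (rule less.IH) (use u n0 in simp)
    have "view (\<kappa> + n + 1 + v + n) (p, sd) = run_out w q B enc (p, sd) (view (\<kappa> + n + 1 + v))"
      using turn[of p "\<kappa> + n + 1 + v" sd] p P_eq by simp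
    then show ?thesis
      using run_out_symbols(1)[OF IH _ _ p, of sd] meet_bound[OF n0, of B v] column_step[OF n0, of B v]
      by (simp add: u ac_simps)
  qed
  moreover have "view (\<kappa> + n + 1 + u) (w + q + p, sd) = henc (head B n u) p sd" if p: "p < 2" for p sd
  proof (cases "u \<le> n")
    case True
    have "view (\<kappa> + u + Suc n) (w + q + p, sd) = init_out w q B enc (w + q + p, sd) (view (\<kappa> + u))"
      using turn[of "w + q + p" "\<kappa> + u" sd] p True P_eq by simp
    then show ?thesis
      using p True n0 by (simp add: init_out_def head_start ac_simps)
  next
    case False
    define v where "v = u - Suc n"
    have u: "u = v + Suc n"
      using False by (simp add: v_def)
    have IH: "shows_symbols (\<kappa> + n + 1 + v) (column B n v) (head B n v)"
      by (rule less.IH) (use u n0 in simp)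
    have "view (\<kappa> + n + 1 + v + Suc n) (w + q + p, sd) =
        run_out w q B enc (w + q + p, sd) (view (\<kappa> + n + 1 + v))"
      using turn[of "w + q + p" "\<kappa> + n + 1 + v" sd] p P_eq by simp
    then show ?thesis
      using run_out_symbols(2)[OF IH _ _ p, of sd] meet_bound[OF n0, of B v] head_step[OF n0, of B v]
      by (simp add: u ac_simps)
  qed
  ultimately show ?case
    unfolding shows_symbols_def by simp
qed

lemma long_return:
  assumes closed: "\<And>v c. vin v \<Longrightarrow> vin (inp v c)"
    and t: "\<kappa> + n + 1 \<le> t" "t < t'" and same: "\<And>v. vin v \<Longrightarrow> X t v = X t' v"
  shows "B ^ (n - 1) \<le> t' - t"
proof (rule odometer_period[OF B_ge n_ge])
  show "0 < t' - t"
    using t by simp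
  define T where "T = t - (\<kappa> + n + 1)"
  have T: "t = \<kappa> + n + 1 + T" "t' = \<kappa> + n + 1 + (T + (t' - t))"
    using t by (simp_all add: T_def)
  fix u
  have "view (t + u) i = view (t' + u) i" if "fst i \<le> P" for i
    by (rule agree_forever[OF closed same input_in[OF that]])
  then have "view (\<kappa> + n + 1 + (T + u)) (p, sd) =
      view (\<kappa> + n + 1 + (T + (t' - t) + u)) (p, sd)" if "p < w" for p sd
    using that P_eq T by (simp add: add.assoc)
  then have "enc (column B n (T + u)) p sd = enc (column B n (T + (t' - t) + u)) p sd" if "p < w" for p sd
    using that runs_odometer[of "T + u"] runs_odometer[of "T + (t' - t) + u"]
    unfolding shows_symbols_def by simp
  then show "column B n (T + u) = column B n (T + (t' - t) + u)"
    using n_ge meet_bound[of n B] by (intro enc_antichain) auto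
qed

text \<open>The store keeps for ever what it learnt about the initial weight of a column.\<close>

lemma store_keeps:
  assumes p: "w \<le> p" "p < w + q" and u: "u < n"
  shows "view (\<kappa> + n + 1 + u + k * n) (p, sd) \<longleftrightarrow>
     w - q + 1 + 2 * (p - w) + of_bool sd \<le> weight w (view (\<kappa> + 1 + u))"
proof (induction k)
  case 0
  have "view (\<kappa> + 1 + u + n) (p, sd) = init_out w q B enc (p, sd) (view (\<kappa> + 1 + u))"
    using turn[of p "\<kappa> + 1 + u" sd] p u P_eq by simp
  then show ?case
    using p by (simp add: init_out_def ac_simps)
next
  case (Suc k)
  have "view (\<kappa> + n + 1 + u + k * n + n) (p, sd) =
      run_out w q B enc (p, sd) (view (\<kappa> + n + 1 + u + k * n))"
    using turn[of p "\<kappa> + n + 1 + u + k * n" sd] p P_eq by simp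
  then show ?case
    using Suc p by (simp add: run_out_def ac_simps)
qed

lemma initial_weight:
  assumes t: "0 < t" and len: "\<And>p. p < w \<Longrightarrow> t \<le> len p"
  shows "weight w (view t) = weight w (\<lambda>(p, sd). X 0 (cell p sd (len p - t)))"
  unfolding weight_sum
proof (rule sum.cong[OF refl])
  fix p assume "p \<in> {..<w}"
  then have "p < w"
    by simp
  then show "of_bool (view t (p, True)) + of_bool (view t (p, False)) =
      (of_bool (case (p, True) of (p, sd) \<Rightarrow> X 0 (cell p sd (len p - t))) +
       of_bool (case (p, False) of (p, sd) \<Rightarrow> X 0 (cell p sd (len p - t))) :: nat)"
    using input_initial[of p t True] input_initial[of p t False] t len[of p] P_eq
    by (simp add: gate_def)
qed

end

section \<open>Most initial states start the machine\<close>

locale network = program P L r D d F m len fop lab code num w q B n \<kappa> enc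
  for P L r D d F m len fop lab code num w q B n \<kappa> enc +
  fixes N :: nat and \<gamma> :: "vert \<Rightarrow> nat" and inp :: "vert \<Rightarrow> bool \<Rightarrow> vert"
  assumes numbered_verts: "bij_betw \<gamma> verts {1..N}"
    and inp_closed: "vin v \<Longrightarrow> vin (inp v c)"
    and inp_distinct: "vin v \<Longrightarrow> inp v False \<noteq> inp v True"
    and inp_twice: "vin u \<Longrightarrow> card {v \<in> verts. u = inp v False \<or> u = inp v True} = 2"
    and inp_known: "vin v \<Longrightarrow> src v c = Some (u, e) \<Longrightarrow> inp v c = u"
begin

sublocale wiring N verts \<gamma> op inp
  by unfold_locales (use numbered_verts inp_closed inp_distinct inp_twice in auto)

lemma \<gamma>_in: "vin v \<Longrightarrow> \<gamma> v \<in> {1..N}"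
  using numbering by simp

lemma \<gamma>_eq: "vin u \<Longrightarrow> vin v \<Longrightarrow> \<gamma> u = \<gamma> v \<longleftrightarrow> u = v"
  using numbering_eq by simp

lemma vin_leaf: "length p = d \<Longrightarrow> vin (Tree b p) \<and> vin (Aux b p)"
  by (simp add: is_leaf_def)

lemma fraction_tree_off: "fraction N (\<lambda>s. tree_value d [] (\<lambda>p. s (\<gamma> (Tree b p)) = b)) = amp (1 / 2) d"
proof (rule fraction_tree_value[where S = "\<lambda>p. {\<gamma> (Tree b p)}" and d = d])
  show "depends (\<lambda>s. s (\<gamma> (Tree b p)) = b) {\<gamma> (Tree b p)}" for p
    by (rule depends_bit)
  show "{\<gamma> (Tree b p)} \<inter> {\<gamma> (Tree b p')} = {}" if "length p = d" "length p' = d" "p \<noteq> p'" for p p'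
    using \<gamma>_eq[of "Tree b p" "Tree b p'"] vin_leaf that by simp
  show "fraction N (\<lambda>s. s (\<gamma> (Tree b p)) = b) = 1 / 2" if "length p = d" for p
    by (rule fraction_bit, rule \<gamma>_in) (use vin_leaf[OF that] in blast)
qed (simp_all add: d_odd)

lemma fraction_tree_on:
  "fraction N (\<lambda>s. tree_value d [] (\<lambda>p. s (\<gamma> (Tree b p)) = b \<or> s (\<gamma> (Aux b p)) = b)) = amp (3 / 4) d"
proof (rule fraction_tree_value[where S = "\<lambda>p. {\<gamma> (Tree b p), \<gamma> (Aux b p)}" and d = d])
  show "depends (\<lambda>s. s (\<gamma> (Tree b p)) = b \<or> s (\<gamma> (Aux b p)) = b) {\<gamma> (Tree b p), \<gamma> (Aux b p)}" for p
    by (simp add: depends_def)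
  show "{\<gamma> (Tree b p), \<gamma> (Aux b p)} \<inter> {\<gamma> (Tree b p'), \<gamma> (Aux b p')} = {}"
    if "length p = d" "length p' = d" "p \<noteq> p'" for p p'
    using \<gamma>_eq[of "Tree b p" "Tree b p'"] \<gamma>_eq[of "Tree b p" "Aux b p'"]
      \<gamma>_eq[of "Aux b p" "Tree b p'"] \<gamma>_eq[of "Aux b p" "Aux b p'"] vin_leaf that by simp
  show "fraction N (\<lambda>s. s (\<gamma> (Tree b p)) = b \<or> s (\<gamma> (Aux b p)) = b) = 3 / 4" if p: "length p = d" for p
  proof -
    have v: "vin (Tree b p)" "vin (Aux b p)"
      using vin_leaf[OF p] by blast+
    have "fraction N (\<lambda>s. s (\<gamma> (Tree b p)) = (\<not> b) \<and> s (\<gamma> (Aux b p)) = (\<not> b)) = 1 / 2 * (1 / 2)"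
      using fraction_indep[OF depends_bit depends_bit, of "\<gamma> (Tree b p)" "\<gamma> (Aux b p)" N "\<not> b" "\<not> b"]
        \<gamma>_eq[OF v] fraction_bit[OF \<gamma>_in[OF v(1)], of "\<not> b"] fraction_bit[OF \<gamma>_in[OF v(2)], of "\<not> b"]
      by simp
    moreover have "(s (\<gamma> (Tree b p)) = b \<or> s (\<gamma> (Aux b p)) = b) \<longleftrightarrow>
        \<not> (s (\<gamma> (Tree b p)) = (\<not> b) \<and> s (\<gamma> (Aux b p)) = (\<not> b))" for s
      by (cases b) simp_all
    ultimately show ?thesis
      by (simp only: fraction_compl)
  qed
qed (simp_all add: d_odd)

text \<open>The window arriving at time \<open>t\<close> has \<open>t + 1\<close> stages unless the beginning of the line cuts it off;
  then \<open>L - t - 1\<close> stages are left, which the bound on \<open>t\<close> makes at least \<open>t + 1 - 2 d\<close>.\<close>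

lemma fraction_window:
  assumes t: "\<kappa> \<le> t" "2 * t < L - 1 + 2 * d"
  shows "fraction N (\<lambda>s. \<forall>i. 2 \<le> i \<longrightarrow> i + t \<le> L \<longrightarrow> L \<le> i + 2 * t \<longrightarrow> s (\<gamma> (Line b i)) = b)
    \<le> (1 / 2) ^ (t + 1 - 2 * d)"
proof -
  define T where "T = {max 2 (L - 2 * t)..L - t}"
  have T: "i \<in> T \<longleftrightarrow> 2 \<le> i \<and> i + t \<le> L \<and> L \<le> i + 2 * t" for i
    unfolding T_def by auto
  have "L - t + 1 - 2 \<ge> t + 1 - 2 * d" "L - t + 1 - (L - 2 * t) \<ge> t + 1 - 2 * d"
    using t \<kappa>_ge by linarith+
  then have card: "t + 1 - 2 * d \<le> card T"
    unfolding T_def by (simp add: max_def)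
  have vinT: "vin (Line b i)" if "i \<in> T" for i
    using that unfolding T by simp
  have "fraction N (\<lambda>s. \<forall>i. 2 \<le> i \<longrightarrow> i + t \<le> L \<longrightarrow> L \<le> i + 2 * t \<longrightarrow> s (\<gamma> (Line b i)) = b)
      = fraction N (\<lambda>s. \<forall>i\<in>T. s (\<gamma> (Line b i)) = b)"
    unfolding Ball_def T by (simp add: imp_conjL)
  also have "\<dots> = (1 / 2) ^ card T"
  proof (rule fraction_cylinder)
    show "inj_on (\<lambda>i. \<gamma> (Line b i)) T"
      using \<gamma>_eq[OF vinT vinT] by (auto intro!: inj_onI)
    show "(\<lambda>i. \<gamma> (Line b i)) ` T \<subseteq> {1..N}"
      using \<gamma>_in[OF vinT] by blast
  qed (simp add: T_def)
  also have "\<dots> \<le> (1 / 2) ^ (t + 1 - 2 * d)"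
    by (rule power_decreasing[OF card]) simp_all
  finally show ?thesis .
qed

lemma geometric_tail: "2 * d \<le> \<kappa> \<Longrightarrow>
    (\<Sum>t\<in>{\<kappa>..<\<kappa> + j}. (1 / 2 :: real) ^ (t + 1 - 2 * d)) = (1 / 2) ^ (\<kappa> - 2 * d) * (1 - (1 / 2) ^ j)"
proof (induction j)
  case (Suc j)
  have "\<kappa> + j + 1 - 2 * d = (\<kappa> - 2 * d) + j + 1"
    using Suc.prems by simp
  then have "(1 / 2 :: real) ^ (\<kappa> + j + 1 - 2 * d) = (1 / 2) ^ (\<kappa> - 2 * d) * (1 / 2) ^ j / 2"
    by (simp only: power_add) simp
  moreover have "(\<Sum>t\<in>{\<kappa>..<\<kappa> + Suc j}. (1 / 2 :: real) ^ (t + 1 - 2 * d)) =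
      (\<Sum>t\<in>{\<kappa>..<\<kappa> + j}. (1 / 2) ^ (t + 1 - 2 * d)) + (1 / 2) ^ (\<kappa> + j + 1 - 2 * d)"
    by simp
  ultimately show ?case
    using Suc.IH[OF Suc.prems] by (simp only:) (simp add: algebra_simps)
qed simp

text \<open>A union bound over the two rails and the three ways for a rail to fail.  The windows contribute a
  geometric series, since they grow with the arrival time.\<close>

lemma fraction_not_good:
  "fraction N (\<lambda>s. \<not> good \<kappa> (\<lambda>v. s (\<gamma> v))) \<le>
     2 * (amp (1 / 2) d + (1 - amp (3 / 4) d) + (1 / 2) ^ (\<kappa> - 2 * d))"
proof -
  define E1 where "E1 = (\<lambda>b s. tree_value d [] (\<lambda>p. s (\<gamma> (Tree b p)) = b))"
  define E2 where "E2 = (\<lambda>b s. tree_value d [] (\<lambda>p. s (\<gamma> (Tree b p)) = b \<or> s (\<gamma> (Aux b p)) = b))"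
  define E3 where "E3 = (\<lambda>b t s. \<forall>i. 2 \<le> i \<longrightarrow> i + t \<le> L \<longrightarrow> L \<le> i + 2 * t \<longrightarrow> s (\<gamma> (Line b i)) = b)"
  define T where "T = {t \<in> {\<kappa>..<\<kappa> + (L + d)}. 2 * t < L - 1 + 2 * d}"
  define E where "E = (\<lambda>b s. (E1 b s \<or> \<not> E2 b s) \<or> (\<exists>t\<in>T. E3 b t s))"
  have one: "fraction N (E b) \<le> amp (1 / 2) d + (1 - amp (3 / 4) d) + (1 / 2) ^ (\<kappa> - 2 * d)" for b
  proof -
    have "fraction N (\<lambda>s. \<exists>t\<in>T. E3 b t s) \<le> (\<Sum>t\<in>T. fraction N (E3 b t))"
      by (rule fraction_Bex) (simp add: T_def)
    also have "\<dots> \<le> (\<Sum>t\<in>T. (1 / 2) ^ (t + 1 - 2 * d))"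
      by (rule sum_mono) (use fraction_window in \<open>simp add: T_def E3_def\<close>)
    also have "\<dots> \<le> (\<Sum>t\<in>{\<kappa>..<\<kappa> + (L + d)}. (1 / 2) ^ (t + 1 - 2 * d))"
      by (rule sum_mono2) (auto simp: T_def)
    also have "\<dots> \<le> (1 / 2) ^ (\<kappa> - 2 * d)"
      unfolding geometric_tail[OF \<kappa>_ge(2)] by (simp add: mult_left_le)
    finally have 3: "fraction N (\<lambda>s. \<exists>t\<in>T. E3 b t s) \<le> (1 / 2) ^ (\<kappa> - 2 * d)" .
    have "fraction N (E b) \<le> fraction N (\<lambda>s. E1 b s \<or> \<not> E2 b s) + fraction N (\<lambda>s. \<exists>t\<in>T. E3 b t s)"
      unfolding E_def by (rule fraction_disj)
    moreover have "fraction N (\<lambda>s. E1 b s \<or> \<not> E2 b s) \<le> fraction N (E1 b) + fraction N (\<lambda>s. \<not> E2 b s)"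
      by (rule fraction_disj)
    moreover have "fraction N (E1 b) = amp (1 / 2) d" "fraction N (\<lambda>s. \<not> E2 b s) = 1 - amp (3 / 4) d"
      unfolding E1_def E2_def fraction_compl fraction_tree_off fraction_tree_on by simp_all
    ultimately show ?thesis
      using 3 by linarith
  qed
  have "fraction N (\<lambda>s. \<not> good \<kappa> (\<lambda>v. s (\<gamma> v))) \<le> fraction N (\<lambda>s. \<exists>b\<in>UNIV. E b s)"
  proof (rule fraction_mono)
    fix s assume "\<not> good \<kappa> (\<lambda>v. s (\<gamma> v))"
    then obtain b where b: "E1 b s \<or> \<not> E2 b s \<or> (\<exists>t. \<kappa> \<le> t \<and> 2 * t < L - 1 + 2 * d \<and> E3 b t s)"
      unfolding good_def E1_def E2_def E3_def by blast
    have "t \<in> T" if "\<kappa> \<le> t" "2 * t < L - 1 + 2 * d" for t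
      using that by (auto simp: T_def)
    with b have "E b s"
      unfolding E_def by blast
    then show "\<exists>b\<in>UNIV. E b s"
      by blast
  qed
  also have "\<dots> \<le> (\<Sum>b\<in>UNIV. fraction N (E b))"
    by (rule fraction_Bex) simp
  also have "\<dots> = fraction N (E False) + fraction N (E True)"
    by (simp add: UNIV_bool)
  finally show ?thesis
    using add_mono[OF one[of False] one[of True]]
    unfolding mult_2[of "amp (1 / 2) d + (1 - amp (3 / 4) d) + (1 / 2) ^ (\<kappa> - 2 * d)"]
    by (rule order_trans)
qed

section \<open>Chaos and instability of the network\<close>

abbreviation traj :: "bstate \<Rightarrow> nat \<Rightarrow> vert \<Rightarrow> bool" where
  "traj s \<equiv> \<lambda>t v. (net ^^ t) s (\<gamma> v)"

lemma machine_of: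
  assumes "good \<kappa> (\<lambda>v. s (\<gamma> v))"
  shows "odometer_machine P L r D d F m len fop lab code num w q B n \<kappa> enc (traj s) inp"
proof unfold_locales
  show "traj s (Suc t) v = gate (op v) (traj s t (inp v False)) (traj s t (inp v True))" if "vin v" for t v
    using trajectory_step[of v t s] that by simp
qed (use assms inp_known in auto)

lemma good_long_attractor:
  assumes "s \<in> states N" "good \<kappa> (\<lambda>v. s (\<gamma> v))"
  shows "\<exists>A. attractor N net A \<and> B ^ (n - 1) \<le> card A \<and> s \<in> basin N net A"
proof (rule long_attractor[OF boolean_network assms(1)])
  interpret M: odometer_machine P L r D d F m len fop lab code num w q B n \<kappa> enc "traj s" inp
    by (rule machine_of[OF assms(2)])
  fix t u assume "\<kappa> + n + 1 \<le> t" "t < u" "(net ^^ t) s = (net ^^ u) s"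
  then show "B ^ (n - 1) \<le> u - t"
    by (intro M.long_return[OF inp_closed]) simp_all
qed

definition column_cells :: "nat \<Rightarrow> nat set" where
  "column_cells j = (\<lambda>(p, sd). \<gamma> (cell p sd j)) ` ({..<w} \<times> UNIV)"

text \<open>The bits that start in stage \<open>j\<close> of the tape reach the gadget at time \<open>n - (r + 1 + D + j)\<close>.  If this
  is later than \<open>\<kappa>\<close>, it happens exactly once before the odometer starts.\<close>

definition recorded :: "nat \<Rightarrow> bool" where
  "recorded j \<longleftrightarrow> Suc r + D + j + \<kappa> < n"

lemma len_tape: "p < w \<Longrightarrow> Suc r + D + len p = n"
  using len_eq[of p] P_eq by simp

lemma cell_in:
  assumes "recorded j" "p < w" shows "vin (cell p sd j)"
proof -
  have "p < P" "j \<le> len p"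
    using assms len_tape[OF assms(2)] P_eq by (auto simp: recorded_def)
  then show ?thesis
    using D_pos by (simp add: cell_def)
qed

lemma cell_eq: "cell p sd j = cell p' sd' j' \<longleftrightarrow> p = p' \<and> sd = sd' \<and> j = j'"
  by (auto simp: cell_def)

lemma column_cells_card:
  assumes "recorded j"
  shows "column_cells j \<subseteq> {1..N}" "card (column_cells j) = 2 * w"
    "card {i \<in> column_cells j. s i} = weight w (\<lambda>(p, sd). s (\<gamma> (cell p sd j)))"
proof -
  show "column_cells j \<subseteq> {1..N}"
    using \<gamma>_in[OF cell_in[OF assms]] by (auto simp: column_cells_def)
  have inj: "inj_on (\<lambda>(p, sd). \<gamma> (cell p sd j)) ({..<w} \<times> UNIV)"
    using \<gamma>_eq[OF cell_in[OF assms] cell_in[OF assms]] by (auto simp: inj_on_def cell_eq)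
  then show "card (column_cells j) = 2 * w"
    unfolding column_cells_def by (simp add: card_image)
  define A where "A = {i. fst i < w \<and> (case i of (p, sd) \<Rightarrow> s (\<gamma> (cell p sd j)))}"
  have "{i \<in> column_cells j. s i} = (\<lambda>(p, sd). \<gamma> (cell p sd j)) ` A"
    by (auto simp: column_cells_def A_def image_iff)
  moreover have "A \<subseteq> {..<w} \<times> UNIV"
    by (auto simp: A_def)
  ultimately show "card {i \<in> column_cells j. s i} = weight w (\<lambda>(p, sd). s (\<gamma> (cell p sd j)))"
    unfolding weight_def A_def[symmetric] using card_image[OF inj_on_subset[OF inj]] by simp
qed

definition central :: "nat \<Rightarrow> bstate \<Rightarrow> bool" where
  "central j s \<longleftrightarrow> w < card {i \<in> column_cells j. s i} + q \<and> card {i \<in> column_cells j. s i} < w + q"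

lemma fraction_not_central:
  "recorded j \<Longrightarrow> 0 < q \<Longrightarrow> fraction N (\<lambda>s. \<not> central j s) \<le> real w / (2 * (real q)\<^sup>2)"
  unfolding central_def by (rule weight_concentration[OF column_cells_card(1,2)])

text \<open>A flip in a recorded column changes its weight by one, so it crosses the threshold given by the
  larger of the two weights; the store bit for this threshold then differs for ever.\<close>

lemma flip_changes_attractor:
  fixes sd :: bool
  assumes s: "s \<in> states N" and gd: "good \<kappa> (\<lambda>v. s (\<gamma> v))"
    and j: "recorded j" and p: "p < w" and mid: "central j s"
  defines "s' \<equiv> flip (\<gamma> (cell p sd j)) s"
  shows "\<exists>A A'. attractor N net A \<and> attractor N net A' \<and> A \<noteq> A' \<and>
           s \<in> basin N net A \<and> s' \<in> basin N net A'"
proof -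
  have flipped: "s' (\<gamma> v) = (if v = cell p sd j then \<not> s (\<gamma> v) else s (\<gamma> v))" if "vin v" for v
    using \<gamma>_eq[OF that cell_in[OF j p]] by (simp add: s'_def flip_def)
  have gd': "good \<kappa> (\<lambda>v. s' (\<gamma> v))"
  proof -
    have line: "s' (\<gamma> (Line b i)) = s (\<gamma> (Line b i))" if "2 \<le> i" "i + t \<le> L" for b i t
      using flipped[of "Line b i"] that by (simp add: cell_def)
    have leaf: "s' (\<gamma> (Tree b p)) = s (\<gamma> (Tree b p)) \<and> s' (\<gamma> (Aux b p)) = s (\<gamma> (Aux b p))"
      if "length p = d" for b p
      using flipped[of "Tree b p"] flipped[of "Aux b p"] vin_leaf[OF that] by (simp add: cell_def)
    have same: "tree_value d [] x = tree_value d [] y" if "\<And>p. length p = d \<Longrightarrow> x p = y p" for x y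
      using tree_value_mono[of "[]" d x y] tree_value_mono[of "[]" d y x] that by auto
    have "tree_value d [] (\<lambda>p. s' (\<gamma> (Tree b p)) = b) = tree_value d [] (\<lambda>p. s (\<gamma> (Tree b p)) = b)"
      "tree_value d [] (\<lambda>p. s' (\<gamma> (Tree b p)) = b \<or> s' (\<gamma> (Aux b p)) = b) =
       tree_value d [] (\<lambda>p. s (\<gamma> (Tree b p)) = b \<or> s (\<gamma> (Aux b p)) = b)" for b
      by (rule same, simp add: leaf)+
    then show ?thesis
      using gd line unfolding good_def by (simp cong: conj_cong)
  qed
  interpret M: odometer_machine P L r D d F m len fop lab code num w q B n \<kappa> enc "traj s" inp
    by (rule machine_of[OF gd])
  interpret M': odometer_machine P L r D d F m len fop lab code num w q B n \<kappa> enc "traj s'" inp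
    by (rule machine_of[OF gd'])
  define W where "W = weight w (\<lambda>(p, sd). s (\<gamma> (cell p sd j)))"
  define W' where "W' = weight w (\<lambda>(p, sd). s' (\<gamma> (cell p sd j)))"
  define u where "u = len p - j - (\<kappa> + 1)"
  have u: "len p' - (\<kappa> + 1 + u) = j" "\<kappa> + 1 + u \<le> len p'" if "p' < w" for p'
    using len_tape[OF p] len_tape[OF that] j by (auto simp: u_def recorded_def)
  have un: "u < n"
    using len_tape[OF p] by (simp add: u_def)
  have WM: "weight w (M.view (\<kappa> + 1 + u)) = W"
  proof -
    have "weight w (M.view (\<kappa> + 1 + u)) = weight w (\<lambda>(p, sd). traj s 0 (cell p sd (len p - (\<kappa> + 1 + u))))"
      by (rule M.initial_weight) (use u in simp_all)
    also have "\<dots> = W"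
      unfolding W_def by (rule weight_cong) (use u(1) in \<open>auto simp del: One_nat_def\<close>)
    finally show ?thesis .
  qed
  have WM': "weight w (M'.view (\<kappa> + 1 + u)) = W'"
  proof -
    have "weight w (M'.view (\<kappa> + 1 + u)) = weight w (\<lambda>(p, sd). traj s' 0 (cell p sd (len p - (\<kappa> + 1 + u))))"
      by (rule M'.initial_weight) (use u in simp_all)
    also have "\<dots> = W'"
      unfolding W'_def by (rule weight_cong) (use u(1) in \<open>auto simp del: One_nat_def\<close>)
    finally show ?thesis .
  qed
  have step: "W' = Suc W \<or> W = Suc W'"
  proof -
    define A where "A = {i. fst i < w \<and> i \<noteq> (p, sd) \<and> s (\<gamma> (cell (fst i) (snd i) j))}"
    have A: "finite A" "(p, sd) \<notin> A"
      using finite_weight[of w] by (auto simp: A_def intro: rev_finite_subset)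
    have eq: "s' (\<gamma> (cell a b j)) = (if a = p \<and> b = sd then \<not> s (\<gamma> (cell p sd j))
        else s (\<gamma> (cell a b j)))" if "a < w" for a b
      using flipped[OF cell_in[OF j that], of b] by (auto simp: cell_eq)
    have "{i. fst i < w \<and> s (\<gamma> (cell (fst i) (snd i) j))} =
        (if s (\<gamma> (cell p sd j)) then insert (p, sd) A else A)"
      using p by (auto simp: A_def)
    moreover have "{i. fst i < w \<and> s' (\<gamma> (cell (fst i) (snd i) j))} =
        (if s (\<gamma> (cell p sd j)) then A else insert (p, sd) A)"
      using p by (auto simp: A_def eq split: if_splits)
    ultimately show ?thesis
      using A by (auto simp: W_def W'_def weight_def case_prod_beta)
  qed
  have WC: "w < W + q" "W < w + q"
    using mid column_cells_card(3)[OF j, of s] by (simp_all add: central_def W_def)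
  define k where "k = max W W' - (w - q + 1)"
  have k: "k div 2 < q" "w - q + 1 + k = max W W'"
    using q_le step WC by (auto simp: k_def)
  define p' where "p' = w + k div 2"
  have "2 * (k div 2) + of_bool (odd k) = k"
    by (cases "even k") auto
  then have p': "w \<le> p'" "p' < w + q" "w - q + 1 + 2 * (p' - w) + of_bool (odd k) = max W W'"
    using k by (simp_all add: p'_def)
  have "M.view (\<kappa> + n + 1 + u + t * n) (p', odd k) \<longleftrightarrow> max W W' \<le> W" for t
    unfolding M.store_keeps[OF p'(1,2) un] p'(3) WM ..
  moreover have "M'.view (\<kappa> + n + 1 + u + t * n) (p', odd k) \<longleftrightarrow> max W W' \<le> W'" for t
    unfolding M'.store_keeps[OF p'(1,2) un] p'(3) WM' ..
  moreover have "(max W W' \<le> W) \<noteq> (max W W' \<le> W')"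
    using step by auto
  ultimately have diff: "M.view (\<kappa> + n + 1 + u + t * n) (p', odd k) \<noteq>
      M'.view (\<kappa> + n + 1 + u + t * n) (p', odd k)" for t
    by simp
  have "(net ^^ t) s \<noteq> (net ^^ t) s'" for t
  proof
    assume eq: "(net ^^ t) s = (net ^^ t) s'"
    define t' where "t' = \<kappa> + n + 1 + u + t * n"
    have "t * 1 \<le> t * n"
      by (rule mult_le_mono2) (use n_ge in simp)
    then have "t \<le> t'"
      unfolding t'_def by linarith
    then have "(net ^^ t') s = (net ^^ t') s'"
      using eq funpow_add[of "t' - t" t net] by simp
    then show False
      using diff[of t] by (simp add: t'_def)
  qed
  moreover have "s' \<in> states N"
    unfolding s'_def by (rule flip_in_states[OF s \<gamma>_in[OF cell_in[OF j p]]])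
  ultimately show ?thesis
    using different_attractors[OF boolean_network cooperative s] flip_comparable[of N s]
    unfolding s'_def by blast
qed

end

context network
begin

text \<open>Counting pairs of a state and a bit, bit by bit: for each of the \<open>2 w\<close> bits of every recorded column,
  all states are sensitive except those with a bad start or an untypical weight of that column.\<close>

lemma many_sensitive_flips:
  assumes bad: "fraction N (\<lambda>s. \<not> good \<kappa> (\<lambda>v. s (\<gamma> v))) \<le> \<epsilon>" and q: "0 < q"
  defines "J \<equiv> n - (Suc r + D + \<kappa>)"
  shows "2 * real w * real J * ((1 - (\<epsilon> + real w / (2 * (real q)\<^sup>2))) * 2 ^ N) \<le>
    card {(s, i) \<in> states N \<times> {1..N}. \<exists>A A'. attractor N net A \<and> attractor N net A' \<and>
      A \<noteq> A' \<and> s \<in> basin N net A \<and> flip i s \<in> basin N net A'}" (is "_ \<le> real (card ?U)")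
proof -
  define K where "K = {..<w} \<times> (UNIV :: bool set) \<times> {..<J}"
  define \<delta> where "\<delta> = \<epsilon> + real w / (2 * (real q)\<^sup>2)"
  define G where "G = (\<lambda>(p :: nat, sd :: bool, j). {s \<in> states N. good \<kappa> (\<lambda>v. s (\<gamma> v)) \<and> central j s})"
  define g where "g = (\<lambda>((p, sd, j), s). (s :: bstate, \<gamma> (cell p sd j)))"
  have rec: "recorded j" if "j < J" for j
    using that by (simp add: J_def recorded_def)
  have finK: "finite K"
    by (simp add: K_def)
  have G: "(1 - \<delta>) * 2 ^ N \<le> card (G k)" if k: "k \<in> K" for k
  proof -
    obtain p sd j where kk: "k = (p, sd, j)" "j < J"
      using k by (auto simp: K_def)
    have "fraction N (\<lambda>s. \<not> (good \<kappa> (\<lambda>v. s (\<gamma> v)) \<and> central j s)) =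
        fraction N (\<lambda>s. \<not> good \<kappa> (\<lambda>v. s (\<gamma> v)) \<or> \<not> central j s)"
      by simp
    also have "\<dots> \<le> \<delta>"
      using fraction_disj[of N "\<lambda>s. \<not> good \<kappa> (\<lambda>v. s (\<gamma> v))" "\<lambda>s. \<not> central j s"]
        fraction_not_central[OF rec[OF kk(2)] q] bad by (simp add: \<delta>_def)
    finally have "1 - \<delta> \<le> fraction N (\<lambda>s. good \<kappa> (\<lambda>v. s (\<gamma> v)) \<and> central j s)"
      unfolding fraction_compl by simp
    then show ?thesis
      by (simp add: fraction_def G_def kk field_simps)
  qed
  have "real (card K) * ((1 - \<delta>) * 2 ^ N) = (\<Sum>k\<in>K. (1 - \<delta>) * 2 ^ N)"
    by simp
  also have "\<dots> \<le> (\<Sum>k\<in>K. real (card (G k)))"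
    by (rule sum_mono) (rule G)
  also have "\<dots> = card (Sigma K G)"
    using finK by (subst card_SigmaI) (auto simp: G_def finite_states)
  also have "\<dots> \<le> card ?U"
  proof (rule of_nat_mono, rule card_inj_on_le)
    show "inj_on g (Sigma K G)"
    proof (rule inj_onI)
      fix x y assume x: "x \<in> Sigma K G" and y: "y \<in> Sigma K G" and eq: "g x = g y"
      obtain p sd j s where xx: "x = ((p, sd, j), s)" "p < w" "j < J"
        using x by (auto simp: K_def)
      obtain p' sd' j' s' where yy: "y = ((p', sd', j'), s')" "p' < w" "j' < J"
        using y by (auto simp: K_def)
      have "s = s'" "\<gamma> (cell p sd j) = \<gamma> (cell p' sd' j')"
        using eq by (simp_all add: g_def xx(1) yy(1))
      then show "x = y"
        using \<gamma>_eq[OF cell_in[OF rec[OF xx(3)] xx(2)] cell_in[OF rec[OF yy(3)] yy(2)]]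
        by (simp add: xx(1) yy(1) cell_eq)
    qed
    show "finite ?U"
      by (rule finite_subset[of _ "states N \<times> {1..N}"]) (use finite_states in auto)
    show "g ` Sigma K G \<subseteq> ?U"
    proof
      fix z assume "z \<in> g ` Sigma K G"
      then obtain p sd j s where z: "z = (s, \<gamma> (cell p sd j))" and "p < w" "j < J"
        and s: "s \<in> states N" "good \<kappa> (\<lambda>v. s (\<gamma> v))" "central j s"
        by (auto simp: g_def K_def G_def)
      moreover have "\<gamma> (cell p sd j) \<in> {1..N}"
        using \<gamma>_in[OF cell_in[OF rec]] \<open>p < w\<close> \<open>j < J\<close> by blast
      ultimately show "z \<in> ?U"
        using flip_changes_attractor[OF s(1,2) rec \<open>p < w\<close> s(3)] by simp
    qed
  qed
  finally have "real (card K) * ((1 - \<delta>) * 2 ^ N) \<le> real (card ?U)" .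
  moreover have "real (card K) = 2 * real w * real J"
    by (simp add: K_def card_cartesian_product)
  ultimately show ?thesis
    by (simp only: \<delta>_def)
qed

end

section \<open>Networks of every size\<close>

lemma finite_nodes: "finite {i :: (nat \<times> bool) \<times> bool list. fst (fst i) \<le> P \<and> length (snd i) \<le> r}"
proof -
  have "finite (({..P} \<times> (UNIV :: bool set)) \<times> {q :: bool list. length q \<le> r})"
    using finite_lists_length_le[of "UNIV :: bool set" r] by simp
  then show ?thesis
    by (rule rev_finite_subset) auto
qed

lemma leaf_code_exists:
  "\<exists>(r :: nat) code. \<forall>j q. fst (j :: nat \<times> bool) < P \<longrightarrow> length (q :: bool list) = D \<longrightarrow>
     length (code j q :: bool list) = r \<and>
     (\<forall>j' q'. fst j' < P \<longrightarrow> length q' = D \<longrightarrow> code j q = code j' q' \<longrightarrow> j = j' \<and> q = q')"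
proof -
  define A where "A = {i :: (nat \<times> bool) \<times> bool list. fst (fst i) < P \<and> length (snd i) = D}"
  have finA: "finite A"
    by (rule finite_subset[OF _ finite_nodes[of P D]]) (auto simp: A_def)
  define r where "r = card A"
  define B where "B = {q :: bool list. length q = r}"
  have "card B = 2 ^ r"
    using card_lists_length_eq[of "UNIV :: bool set" r] by (simp add: B_def)
  moreover have "finite B"
    using finite_lists_length_eq[of "UNIV :: bool set" r] by (simp add: B_def)
  moreover have "card A \<le> 2 ^ r"
    using less_exp[of r] by (simp add: r_def)
  ultimately obtain h where h: "h ` A \<subseteq> B" "inj_on h A"
    using card_le_inj[OF finA, of B] by auto
  show ?thesis
  proof (intro exI[of _ r] exI[of _ "\<lambda>j q. h (j, q)"] allI impI conjI)
    fix j :: "nat \<times> bool" and q :: "bool list" assume jq: "fst j < P" "length q = D"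
    then have "(j, q) \<in> A"
      by (simp add: A_def)
    then show "length (h (j, q)) = r"
      using h(1) by (auto simp: B_def)
    fix j' :: "nat \<times> bool" and q' :: "bool list"
    assume "fst j' < P" "length q' = D" "h (j, q) = h (j', q')"
    moreover from this have "(j', q') \<in> A"
      by (simp add: A_def)
    ultimately have "(j, q) = (j', q')"
      using inj_onD[OF h(2)] \<open>(j, q) \<in> A\<close> by blast
    then show "j = j'" "q = q'"
      by simp_all
  qed
qed

text \<open>The size of the gadget is fixed before the length \<open>n\<close> of the tape is chosen; the padding absorbs
  what is left of \<open>N\<close>.\<close>

lemma networks_exist:
  fixes enc :: "nat \<Rightarrow> nat \<Rightarrow> bool \<Rightarrow> bool"
  assumes q: "0 < q" "q \<le> w" and B: "2 \<le> B"
    and enc_sorted: "\<forall>a p. enc a p True \<longrightarrow> enc a p False"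
    and enc_antichain: "\<forall>a<B + 2. \<forall>a'<B + 2.
        (\<forall>p<w. \<forall>sd. enc a p sd \<longrightarrow> enc a' p sd) \<longrightarrow> a = a'"
    and \<epsilon>: "0 < \<epsilon>"
  shows "\<exists>h C. \<forall>n N. 2 + h \<le> n \<longrightarrow> (2 * w + 2 * q + 6) * n + C \<le> N \<longrightarrow>
     (\<exists>f. boolean_network N f \<and> cooperative N f \<and> strictly_biquadratic N f \<and>
        1 - \<epsilon> \<le> fraction N (\<lambda>s. \<exists>A. attractor N f A \<and> B ^ (n - 1) \<le> card A \<and> s \<in> basin N f A) \<and>
        2 * real w * real (n - h) * ((1 - (\<epsilon> + real w / (2 * (real q)\<^sup>2))) * 2 ^ N) \<le>
          card {(s, i) \<in> states N \<times> {1..N}. \<exists>A A'. attractor N f A \<and> attractor N f A' \<and>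
            A \<noteq> A' \<and> s \<in> basin N f A \<and> flip i s \<in> basin N f A'})"
proof -
  define P where "P = w + q + 2"
  obtain D fop lab where D: "0 < D"
    and lab: "\<And>j p. fst j < P \<Longrightarrow> fst (lab j p) \<le> P"
    and formulas: "\<And>j x. fst j < P \<Longrightarrow> formula_value (fop j) (lab j) D [] x = gadget w q B enc j x"
    using gadget_formulas[of w q B enc] unfolding P_def by metis
  obtain r code where code: "\<And>j q. fst (j :: nat \<times> bool) < P \<Longrightarrow> length (q :: bool list) = D \<Longrightarrow>
     length (code j q :: bool list) = r"
    "\<And>j q j' q'. fst (j :: nat \<times> bool) < P \<Longrightarrow> length (q :: bool list) = D \<Longrightarrow>
     fst j' < P \<Longrightarrow> length q' = D \<Longrightarrow> code j q = code j' q' \<Longrightarrow> j = j' \<and> q = q'"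
    using leaf_code_exists[of P D] by metis
  define I where "I = {i :: (nat \<times> bool) \<times> bool list. fst (fst i) \<le> P \<and> length (snd i) \<le> r}"
  define F where "F = card I"
  obtain h where h: "bij_betw h I {0..<F}"
    using ex_bij_betw_finite_nat finite_nodes unfolding F_def I_def by blast
  define num where "num = (\<lambda>i q. h (i, q))"
  \<comment> \<open>two rails with three kinds of failure each, hence the sixth part of \<open>\<epsilon>\<close>\<close>
  obtain d where d: "odd d" "1 < d" "amp (1 / 2) d < \<epsilon> / 6" "1 - \<epsilon> / 6 < amp (3 / 4) d"
    using amplification[of "\<epsilon> / 6"] \<epsilon> by auto
  obtain e where e: "(1 / 2 :: real) ^ e < \<epsilon> / 6"
    using real_arch_pow_inv[of "\<epsilon> / 6" "1 / 2"] \<epsilon> by auto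
  define \<kappa> where "\<kappa> = 2 * d + F + e"
  have "(1 / 2 :: real) ^ (\<kappa> - 2 * d) \<le> (1 / 2) ^ e"
    by (rule power_decreasing) (simp_all add: \<kappa>_def)
  then have "(1 / 2 :: real) ^ (\<kappa> - 2 * d) < \<epsilon> / 6"
    using e by (rule le_less_trans)
  moreover have "2 * (x + (1 - y) + z) \<le> \<epsilon>" if "x < \<epsilon> / 6" "1 - \<epsilon> / 6 < y" "z < \<epsilon> / 6" for x y z
    using that by simp
  ultimately have \<epsilon>': "2 * (amp (1 / 2) d + (1 - amp (3 / 4) d) + (1 / 2) ^ (\<kappa> - 2 * d)) \<le> \<epsilon>"
    using d(3,4) by blast
  define H where "H = Suc r + D + \<kappa>"
  define C where "C = design.gadget_size P r D d F + 2 * \<kappa> + 2"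
  show ?thesis
  proof (rule exI[of _ H], rule exI[of _ C], intro allI impI)
    fix n N assume n: "2 + H \<le> n" and N: "(2 * w + 2 * q + 6) * n + C \<le> N"
    define len where "len = (\<lambda>p. (if p < w + q then n else Suc n) - (Suc r + D))"
    define L where "L = \<kappa> + n + 1 - d"
    define base where "base = design.gadget_size P r D d F + (\<Sum>p<P. 2 * len p) + 2 * (L - 1)"
    define m where "m = N - base"
    have lenle: "len p \<le> n" for p
      by (simp add: len_def)
    have "(\<Sum>p<P. 2 * len p) \<le> (\<Sum>p<P. 2 * n)"
      by (rule sum_mono) (simp add: lenle)
    also have "\<dots> = P * (2 * n)"
      by simp
    finally have "(\<Sum>p<P. 2 * len p) \<le> P * (2 * n)" .
    moreover have "L - 1 \<le> \<kappa> + n"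
      by (simp add: L_def)
    moreover have "(2 * w + 2 * q + 6) * n = P * (2 * n) + 2 * n"
      by (simp add: P_def algebra_simps)
    ultimately have "base + 2 \<le> (2 * w + 2 * q + 6) * n + C"
      unfolding base_def C_def by linarith
    then have m: "2 \<le> m" "N = base + m"
      using N by (simp_all add: m_def)
    have prog: "program P L r D d F m len fop lab code num w q B n \<kappa> enc"
    proof unfold_locales
      show "0 < len p" for p
        using n by (simp add: len_def H_def)
      show "2 \<le> L" "d + L = \<kappa> + n + 1" "d + F \<le> \<kappa>" "2 * d \<le> \<kappa>" "2 \<le> n"
        using n by (auto simp: L_def \<kappa>_def)
      show "Suc r + D + len p = (if p < w + q then n else Suc n)" for p
        using n by (simp add: len_def H_def)
      show "num i q < F" if "fst i \<le> P" "length q \<le> r" for i q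
        using h that by (force simp: num_def I_def bij_betw_def)
      show "i = i' \<and> q = q'"
        if "fst i \<le> P" "length q \<le> r" "fst i' \<le> P" "length q' \<le> r" "num i q = num i' q'" for i q i' q'
      proof -
        have "(i, q) = (i', q')"
          using h that by (intro inj_onD[of h I]) (auto simp: num_def I_def bij_betw_def)
        then show ?thesis
          by simp
      qed
      show "\<exists>i q. fst i \<le> P \<and> length q \<le> r \<and> num i q = k" if "k < F" for k
      proof -
        have "k \<in> h ` I"
          using h that by (simp add: bij_betw_def)
        then obtain i where "i \<in> I" "k = h i"
          by blast
        then show ?thesis
          by (intro exI[of _ "fst i"] exI[of _ "snd i"]) (simp add: num_def I_def)
      qed
      show "a = a'" if "a \<le> B + 1" "a' \<le> B + 1" "\<And>p sd. p < w \<Longrightarrow> enc a p sd \<Longrightarrow> enc a' p sd" for a a'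
        using enc_antichain that by simp
      show "enc a p False" if "enc a p True" for a p
        using enc_sorted that by blast
    qed (use D d lab code m q B formulas in \<open>auto simp: P_def\<close>)
    interpret program P L r D d F m len fop lab code num w q B n \<kappa> enc
      by (rule prog)
    have cardN: "card verts = N"
      using card_verts m(2) by (simp add: base_def)
    obtain \<gamma> where \<gamma>: "bij_betw \<gamma> verts {1..N}"
      using finite_same_card_bij[OF finite_verts, of "{1..N}"] cardN by auto
    obtain inp where inp: "\<forall>v\<in>verts. \<forall>c. inp v c \<in> verts" "\<forall>v\<in>verts. inp v False \<noteq> inp v True"
      "\<forall>u\<in>verts. card {v \<in> verts. u = inp v False \<or> u = inp v True} = 2"
      "\<forall>v\<in>verts. \<forall>c u e. src v c = Some (u, e) \<longrightarrow> inp v c = u"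
      using wiring_exists by blast
    interpret network P L r D d F m len fop lab code num w q B n \<kappa> enc N \<gamma> inp
      by unfold_locales (use \<gamma> inp in auto)
    have bad: "fraction N (\<lambda>s. \<not> good \<kappa> (\<lambda>v. s (\<gamma> v))) \<le> \<epsilon>"
      using fraction_not_good \<epsilon>' by (rule order_trans)
    then have "1 - \<epsilon> \<le> fraction N (\<lambda>s. good \<kappa> (\<lambda>v. s (\<gamma> v)))"
      unfolding fraction_compl by simp
    also have "\<dots> \<le> fraction N (\<lambda>s. \<exists>A. attractor N net A \<and> B ^ (n - 1) \<le> card A \<and> s \<in> basin N net A)"
      by (rule fraction_mono) (rule good_long_attractor)
    finally show "\<exists>f. boolean_network N f \<and> cooperative N f \<and> strictly_biquadratic N f \<and>
        1 - \<epsilon> \<le> fraction N (\<lambda>s. \<exists>A. attractor N f A \<and> B ^ (n - 1) \<le> card A \<and> s \<in> basin N f A) \<and>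
        2 * real w * real (n - H) * ((1 - (\<epsilon> + real w / (2 * (real q)\<^sup>2))) * 2 ^ N) \<le>
          card {(s, i) \<in> states N \<times> {1..N}. \<exists>A A'. attractor N f A \<and> attractor N f A' \<and>
            A \<noteq> A' \<and> s \<in> basin N f A \<and> flip i s \<in> basin N f A'}"
      using many_sensitive_flips[OF bad q(1), folded H_def] boolean_network cooperative
        strictly_biquadratic
      by (intro exI[of _ net] conjI) simp_all
  qed
qed

section \<open>Choice of the parameters\<close>

text \<open>With \<open>w = R\<^sup>3\<close> and \<open>q = R\<^sup>2\<close> the store is a vanishing part of the network, yet its \<open>2 q\<close> thresholds
  cover many standard deviations of the weight of a column.\<close>

lemma track_widths:
  fixes c \<delta> :: real
  assumes c: "1 < c" "c < sqrt 3" and \<delta>: "0 < \<delta>"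
  shows "\<exists>w q. 0 < q \<and> q \<le> w \<and> real w / (2 * (real q)\<^sup>2) < \<delta> \<and>
     (1 - \<delta>) * real (2 * w + 2 * q + 6) < 2 * real w \<and>
     5 * real (2 * w + 1) * c ^ (2 * w + 2 * q + 6) \<le> 3 ^ w"
proof -
  define a where "a = ln c"
  have "c\<^sup>2 < 3"
    using c by (metis less_eq_real_def real_sqrt_less_iff real_sqrt_unique zero_less_one order_less_trans)
  then have "2 * a < ln 3"
    using c ln_less_cancel_iff[of "c\<^sup>2" 3] by (simp add: a_def ln_realpow)
  then have e: "0 < ln 3 - 2 * a"
    by simp
  have "eventually (\<lambda>R :: nat. 0 \<le> (ln 3 - 2 * a) * real R ^ 3 - (2 * real R ^ 2 + 6) * a -
      ln (2 * real R ^ 3 + 1) - ln 5) at_top"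
    using e by real_asymp
  moreover have "eventually (\<lambda>R :: nat. 1 / (2 * real R) < \<delta>) at_top"
    using \<delta> by real_asymp
  moreover have "eventually (\<lambda>R :: nat. (1 - \<delta>) * (2 * real R ^ 3 + 2 * real R ^ 2 + 6) < 2 * real R ^ 3) at_top"
    using \<delta> by real_asymp
  moreover have "eventually (\<lambda>R :: nat. 0 < R) at_top"
    by (rule eventually_gt_at_top)
  ultimately have "eventually (\<lambda>R :: nat. 0 \<le> (ln 3 - 2 * a) * real R ^ 3 - (2 * real R ^ 2 + 6) * a -
      ln (2 * real R ^ 3 + 1) - ln 5 \<and> 1 / (2 * real R) < \<delta> \<and>
      (1 - \<delta>) * (2 * real R ^ 3 + 2 * real R ^ 2 + 6) < 2 * real R ^ 3 \<and> 0 < R) at_top"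
    by eventually_elim simp
  then obtain R :: nat where R: "0 \<le> (ln 3 - 2 * a) * real R ^ 3 - (2 * real R ^ 2 + 6) * a -
      ln (2 * real R ^ 3 + 1) - ln 5" "1 / (2 * real R) < \<delta>"
      "(1 - \<delta>) * (2 * real R ^ 3 + 2 * real R ^ 2 + 6) < 2 * real R ^ 3" "0 < R"
    using eventually_happens[of _ "at_top :: nat filter"] by force
  define w q where "w = R ^ 3" and "q = R ^ 2"
  have wq: "real w = real R ^ 3" "real q = real R ^ 2"
    by (simp_all add: w_def q_def)
  have "real w / (2 * (real q)\<^sup>2) = 1 / (2 * real R)"
    using R(4) by (simp add: wq field_simps power_numeral_reduce)
  moreover have "5 * real (2 * w + 1) * c ^ (2 * w + 2 * q + 6) \<le> 3 ^ w"
  proof -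
    have pos: "0 < c" "0 < 2 * real w + 1"
      using c by simp_all
    have "ln (5 * x * c ^ k) = ln 5 + ln x + real k * a" if "0 < x" for x k
      using pos that by (simp add: ln_mult ln_realpow a_def)
    from this[of "real (2 * w + 1)" "2 * w + 2 * q + 6"]
    have "ln (5 * real (2 * w + 1) * c ^ (2 * w + 2 * q + 6)) =
        ln 5 + ln (2 * real w + 1) + (2 * real w + 2 * real q + 6) * a"
      by simp
    also have "\<dots> \<le> real w * ln 3"
      using R(1) unfolding wq by (simp add: algebra_simps)
    also have "\<dots> = ln (3 ^ w)"
      by (simp add: ln_realpow)
    finally show ?thesis
      using pos by (subst (asm) ln_le_cancel_iff) auto
  qed
  moreover have "0 < q" "q \<le> w"
    using R(4) by (simp_all add: w_def q_def power_increasing)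
  moreover have "(1 - \<delta>) * real (2 * w + 2 * q + 6) < 2 * real w"
    using R(3) by (simp add: wq)
  ultimately show ?thesis
    using R(2) by (intro exI[of _ w] exI[of _ q]) simp
qed

text \<open>For \<open>N \<le> \<rho> (n + 1) + C\<close> the period \<open>B\<^sup>n\<^sup>-\<^sup>1\<close> beats \<open>c\<^sup>N\<close> for large \<open>n\<close>, because
  \<open>B / c\<^sup>\<rho> > 1\<close>; constant factors are irrelevant.\<close>

lemma tape_long_enough:
  fixes c :: real
  assumes c: "1 < c" and B: "c ^ \<rho> < real B"
  shows "\<forall>\<^sub>F n in sequentially. c ^ (\<rho> * Suc n + C) < real (B ^ (n - 1))"
proof -
  define x where "x = real B / c ^ \<rho>"
  have cp: "0 < c ^ \<rho>"
    using c by simp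
  have x: "1 < x"
    using B cp by (simp add: x_def)
  obtain n0 where n0: "c ^ (2 * \<rho> + C) < x ^ n0"
    using real_arch_pow[OF x] by blast
  show ?thesis
  proof (rule eventually_sequentiallyI[of "Suc n0"])
    fix n assume n: "Suc n0 \<le> n"
    have "x ^ n0 \<le> x ^ (n - 1)"
      by (rule power_increasing) (use n x in auto)
    with n0 have "c ^ (2 * \<rho> + C) < x ^ (n - 1)"
      by (rule less_le_trans)
    then have "c ^ (2 * \<rho> + C) * (c ^ \<rho>) ^ (n - 1) < real B ^ (n - 1)"
      using cp by (simp add: x_def power_divide field_simps)
    moreover have "\<rho> * Suc n + C = (2 * \<rho> + C) + \<rho> * (n - 1)"
      using n by (cases n) (simp_all add: algebra_simps)
    ultimately show "c ^ (\<rho> * Suc n + C) < real (B ^ (n - 1))"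
      by (simp only: power_add[of c "2 * \<rho> + C"] power_mult[of c \<rho> "n - 1"] of_nat_power)
  qed
qed

lemma tape_dominates:
  fixes \<delta> :: real
  assumes "(1 - \<delta>) * real \<rho> < 2 * real w"
  shows "\<forall>\<^sub>F n in sequentially. (1 - \<delta>) * real (\<rho> * Suc n + C) \<le> 2 * real w * real (n - h)"
proof -
  have e: "0 < 2 * real w - (1 - \<delta>) * real \<rho>"
    using assms by simp
  have "\<forall>\<^sub>F n :: nat in sequentially. (1 - \<delta>) * (real \<rho> * (real n + 1) + real C) \<le>
      2 * real w * (real n - real h)"
  proof -
    have "\<forall>\<^sub>F n :: nat in sequentially.
        ((1 - \<delta>) * (real \<rho> + real C) + 2 * real w * real h) / (2 * real w - (1 - \<delta>) * real \<rho>) \<le> real n"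
      by (rule eventually_sequentiallyI[of "nat \<lceil>((1 - \<delta>) * (real \<rho> + real C) + 2 * real w * real h) /
          (2 * real w - (1 - \<delta>) * real \<rho>)\<rceil>"]) linarith
    then show ?thesis
      by eventually_elim (use e in \<open>simp add: divide_le_eq algebra_simps\<close>)
  qed
  moreover have "\<forall>\<^sub>F n in sequentially. h \<le> n"
    by (rule eventually_ge_at_top)
  ultimately show ?thesis
    by eventually_elim (simp add: of_nat_diff algebra_simps)
qed

lemma pair_pmf_of_sets:
  assumes "finite A" "A \<noteq> {}" "finite B" "B \<noteq> {}"
  shows "pair_pmf (pmf_of_set A) (pmf_of_set B) = pmf_of_set (A \<times> B)"
proof (rule pmf_eqI)
  fix i :: "'a \<times> 'b"
  show "pmf (pair_pmf (pmf_of_set A) (pmf_of_set B)) i = pmf (pmf_of_set (A \<times> B)) i"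
    using assms by (cases i) (simp add: pmf_pair card_cartesian_product indicator_def)
qed

theorem theorem3p10:
  fixes p c :: real
  assumes "0 < p" and "p < 1" and "1 < c" and "c < sqrt 3"
  shows "\<forall>\<^sub>F N in sequentially. \<exists>f. boolean_network N f \<and> cooperative N f \<and>
           strictly_biquadratic N f \<and> chaotic p c N f \<and> unstable p N f"
proof -
  \<comment> \<open>a share \<open>\<delta>\<close> each is lost to bad starts, to untypical columns, and to bits off the tape\<close>
  define \<delta> where "\<delta> = (1 - p) / 4"
  have \<delta>: "0 < \<delta>" "\<delta> < 1"
    using assms by (simp_all add: \<delta>_def)
  obtain w q where wq: "0 < q" "q \<le> w" "real w / (2 * (real q)\<^sup>2) < \<delta>"
    and tape: "(1 - \<delta>) * real (2 * w + 2 * q + 6) < 2 * real w"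
    and rate: "5 * real (2 * w + 1) * c ^ (2 * w + 2 * q + 6) \<le> 3 ^ w"
    using track_widths[OF assms(3,4) \<delta>(1)] by blast
  define \<rho> where "\<rho> = 2 * w + 2 * q + 6"
  obtain M and enc :: "nat \<Rightarrow> nat \<Rightarrow> bool \<Rightarrow> bool" where M: "3 ^ w \<le> (2 * w + 1) * M"
    and enc: "\<forall>a p. enc a p True \<longrightarrow> enc a p False"
      "\<forall>a<M. \<forall>a'<M. (\<forall>p<w. \<forall>sd. enc a p sd \<longrightarrow> enc a' p sd) \<longrightarrow> a = a'"
    using antichain_code[of w] by blast
  have c1: "1 \<le> c ^ \<rho>"
    using assms(3) by (simp add: one_le_power)
  \<comment> \<open>two symbols are the marker and the blank, so that \<open>M\<close> must exceed \<open>c\<^sup>\<rho> + 2\<close>\<close>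
  have "5 * c ^ \<rho> \<le> real M"
  proof -
    have "real (3 ^ w) \<le> real ((2 * w + 1) * M)"
      using M by (rule of_nat_mono)
    then have "real (2 * w + 1) * (5 * c ^ \<rho>) \<le> real (2 * w + 1) * real M"
      using rate by (simp add: \<rho>_def algebra_simps)
    then show ?thesis
      by (rule mult_left_le_imp_le) simp
  qed
  then have M5: "5 \<le> M" and B: "c ^ \<rho> < real (M - 2)"
    using c1 by (auto simp: of_nat_diff)
  define B where "B = M - 2"
  have MB: "M = B + 2" "2 \<le> B"
    using M5 by (auto simp: B_def)
  obtain h C where nets: "\<forall>n N. 2 + h \<le> n \<longrightarrow> \<rho> * n + C \<le> N \<longrightarrow>
     (\<exists>f. boolean_network N f \<and> cooperative N f \<and> strictly_biquadratic N f \<and>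
        1 - \<delta> \<le> fraction N (\<lambda>s. \<exists>A. attractor N f A \<and> B ^ (n - 1) \<le> card A \<and> s \<in> basin N f A) \<and>
        2 * real w * real (n - h) * ((1 - (\<delta> + real w / (2 * (real q)\<^sup>2))) * 2 ^ N) \<le>
          card {(s, i) \<in> states N \<times> {1..N}. \<exists>A A'. attractor N f A \<and> attractor N f A' \<and>
            A \<noteq> A' \<and> s \<in> basin N f A \<and> flip i s \<in> basin N f A'})"
    using networks_exist[OF wq(1,2) MB(2) enc(1) enc(2)[unfolded MB(1)] \<delta>(1), folded \<rho>_def]
    by (elim exE) (rule that)
  have "\<forall>\<^sub>F n in sequentially. c ^ (\<rho> * Suc n + C) < real (B ^ (n - 1)) \<and>
      (1 - \<delta>) * real (\<rho> * Suc n + C) \<le> 2 * real w * real (n - h) \<and> 2 + h \<le> n"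
    using tape_long_enough[OF assms(3), of \<rho> B C] B tape_dominates[of \<delta> \<rho> w C h] tape
      eventually_ge_at_top[of "2 + h"]
    by (intro eventually_conj) (simp_all add: B_def \<rho>_def)
  then obtain n0 where n0: "\<And>n. n0 \<le> n \<Longrightarrow> c ^ (\<rho> * Suc n + C) < real (B ^ (n - 1)) \<and>
      (1 - \<delta>) * real (\<rho> * Suc n + C) \<le> 2 * real w * real (n - h) \<and> 2 + h \<le> n"
    unfolding eventually_sequentially by blast
  show ?thesis
  proof (rule eventually_sequentiallyI[of "\<rho> * n0 + C + 1"])
    fix N assume N: "\<rho> * n0 + C + 1 \<le> N"
    have \<rho>: "0 < \<rho>"
      by (simp add: \<rho>_def)
    define n where "n = (N - C) div \<rho>"
    have "n0 \<le> n"
      using N \<rho> unfolding n_def by (subst less_eq_div_iff_mult_less_eq) (auto simp: mult.commute)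
    note n = n0[OF this]
    have "\<rho> * n \<le> N - C"
      unfolding n_def by simp
    then have lo: "\<rho> * n + C \<le> N"
      using N by simp
    have "N - C < \<rho> * Suc n"
      using dividend_less_times_div[OF \<rho>, of "N - C"] by (simp add: n_def)
    then have hi: "N \<le> \<rho> * Suc n + C"
      by simp
    obtain f where f: "boolean_network N f" "cooperative N f" "strictly_biquadratic N f"
      and long: "1 - \<delta> \<le> fraction N (\<lambda>s. \<exists>A. attractor N f A \<and> B ^ (n - 1) \<le> card A \<and> s \<in> basin N f A)"
      and sens: "2 * real w * real (n - h) * ((1 - (\<delta> + real w / (2 * (real q)\<^sup>2))) * 2 ^ N) \<le>
          card {(s, i) \<in> states N \<times> {1..N}. \<exists>A A'. attractor N f A \<and> attractor N f A' \<and>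
            A \<noteq> A' \<and> s \<in> basin N f A \<and> flip i s \<in> basin N f A'}" (is "_ \<le> real (card ?U)")
      using nets[rule_format, OF _ lo] n by blast
    have "c ^ N \<le> c ^ (\<rho> * Suc n + C)"
      by (rule power_increasing[OF hi]) (use assms(3) in simp)
    then have len: "c ^ N < real (B ^ (n - 1))"
      using n by linarith
    have "chaotic p c N f"
    proof -
      have "p < 1 - \<delta>"
        using assms by (simp add: \<delta>_def field_simps)
      also have "1 - \<delta> \<le> fraction N (\<lambda>s. \<exists>A. attractor N f A \<and> real (card A) > c ^ N \<and> s \<in> basin N f A)"
      proof (rule order_trans[OF long], rule fraction_mono)
        fix s assume "\<exists>A. attractor N f A \<and> B ^ (n - 1) \<le> card A \<and> s \<in> basin N f A"
        then obtain A where A: "attractor N f A" "B ^ (n - 1) \<le> card A" "s \<in> basin N f A"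
          by blast
        have "real (B ^ (n - 1)) \<le> real (card A)"
          using A(2) by (rule of_nat_mono)
        then have "c ^ N < real (card A)"
          using len by linarith
        then show "\<exists>A. attractor N f A \<and> real (card A) > c ^ N \<and> s \<in> basin N f A"
          using A by blast
      qed
      also have "\<dots> = measure_pmf.prob (pmf_of_set (states N))
          {s. \<exists>A. attractor N f A \<and> real (card A) > c ^ N \<and> s \<in> basin N f A}"
        unfolding measure_pmf_of_set[OF states_nonempty finite_states] fraction_def card_states
        by (simp add: Int_def)
      finally show ?thesis
        unfolding chaotic_def .
    qed
    moreover have "unstable p N f"
    proof -
      have N0: "0 < N"
        using N by simp
      have "(1 - 2 * \<delta>) * ((1 - \<delta>) * real N) \<le>
          (1 - (\<delta> + real w / (2 * (real q)\<^sup>2))) * (2 * real w * real (n - h))"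
      proof (rule mult_mono)
        have "(1 - \<delta>) * real N \<le> (1 - \<delta>) * real (\<rho> * Suc n + C)"
          by (rule mult_left_mono) (use of_nat_mono[OF hi, where 'a = real] \<delta> in simp_all)
        then show "(1 - \<delta>) * real N \<le> 2 * real w * real (n - h)"
          using n by linarith
        have half: "\<delta> < 1 / 2"
          using assms by (simp add: \<delta>_def)
        show "1 - 2 * \<delta> \<le> 1 - (\<delta> + real w / (2 * (real q)\<^sup>2))"
          using wq(3) by linarith
        show "0 \<le> 1 - (\<delta> + real w / (2 * (real q)\<^sup>2))"
          using wq(3) half by linarith
        show "0 \<le> (1 - \<delta>) * real N"
          using \<delta> by simp
      qed
      moreover have "p \<le> (1 - 2 * \<delta>) * (1 - \<delta>)"
      proof -
        have "0 \<le> \<delta> * \<delta>"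
          by simp
        moreover have "p = 1 - 4 * \<delta>"
          unfolding \<delta>_def by (simp add: field_simps)
        moreover have "(1 - 2 * \<delta>) * (1 - \<delta>) = 1 - 3 * \<delta> + 2 * (\<delta> * \<delta>)"
          by (simp add: algebra_simps)
        ultimately show ?thesis
          using \<delta> by linarith
      qed
      then have "p * real N \<le> (1 - 2 * \<delta>) * ((1 - \<delta>) * real N)"
        unfolding mult.assoc[symmetric] by (rule mult_right_mono) simp
      ultimately have "p * real N \<le> (1 - (\<delta> + real w / (2 * (real q)\<^sup>2))) * (2 * real w * real (n - h))"
        by (rule order_trans[rotated])
      then have "p * real N * 2 ^ N \<le>
          (1 - (\<delta> + real w / (2 * (real q)\<^sup>2))) * (2 * real w * real (n - h)) * 2 ^ N"
        by (rule mult_right_mono) simp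
      also have "\<dots> \<le> real (card ?U)"
        using sens by (simp only: mult_ac of_nat_mult of_nat_numeral)
      finally have "p \<le> real (card ?U) / real (2 ^ N * N)"
        using N0 by (simp add: le_divide_eq mult_ac)
      also have "\<dots> = measure_pmf.prob (pair_pmf (pmf_of_set (states N)) (pmf_of_set {1..N}))
       {(s, i). \<exists>A B. attractor N f A \<and> attractor N f B \<and> A \<noteq> B \<and>
          s \<in> basin N f A \<and> flip i s \<in> basin N f B}"
      proof -
        have "?U = (states N \<times> {1..N}) \<inter> {(s, i). \<exists>A B. attractor N f A \<and> attractor N f B \<and> A \<noteq> B \<and>
          s \<in> basin N f A \<and> flip i s \<in> basin N f B}"
          by blast
        moreover have "states N \<times> {1..N} \<noteq> {}" "finite (states N \<times> {1..N})"
          using N0 states_nonempty[of N] finite_states[of N] by auto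
        moreover have "{1..N} \<noteq> {}"
          using N0 by simp
        ultimately show ?thesis
          using pair_pmf_of_sets[OF finite_states[of N] states_nonempty[of N], of "{1..N}"]
            measure_pmf_of_set[of "states N \<times> {1..N}"]
          by (simp add: card_cartesian_product card_states)
      qed
      finally show ?thesis
        unfolding unstable_def .
    qed
    ultimately show "\<exists>f. boolean_network N f \<and> cooperative N f \<and> strictly_biquadratic N f \<and>
        chaotic p c N f \<and> unstable p N f"
      using f by blast
  qed
qed

end
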